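(* Let $(\mathcal{C},\otimes,1,\alpha,l,r)$ be a $\Bbbk$-linear GV-category with dualizing object $K$, duality functor $G$ and second tensor product $\bullet$ with unit $K$, associator $\alpha^\bullet$ and unitors $l^\bullet,r^\bullet$. Let $$d^L_{c,y,z}\colon c\otimes(y\bullet z)\to(c\otimes y)\bullet z\qquad\text{and}\qquad d^R_{w,y,c}\colon(w\bullet y)\otimes c\to w\bullet(y\otimes c)$$ be the two distributors of $\mathcal{C}$. They satisfy, for all objects $c,d,v,w,y,z\in\mathcal{C}$, the four mixed triangle identities $$(l_y\bullet\mathrm{id}_z)\circ d^L_{1,y,z}=l_{y\bullet z},\qquad r^\bullet_{c\otimes y}\circ d^L_{c,y,K}=\mathrm{id}_c\otimes r^\bullet_y,$$ $$(\mathrm{id}_w\bullet r_y)\circ d^R_{w,y,1}=r_{w\bullet y},\qquad l^\bullet_{y\otimes c}\circ d^R_{K,y,c}=l^\bullet_y\otimes\mathrm{id}_c,$$ and the four mixed pentagon identities $$(\alpha_{c,d,y}\bullet\mathrm{id}_z)\circ d^L_{c\otimes d,y,z}=d^L_{c,d\otimes y,z}\circ(\mathrm{id}_c\otimes d^L_{d,y,z})\circ\alpha_{c,d,y\bullet z},$$ $$\alpha^\bullet_{c\otimes y,z,w}\circ(d^L_{c,y,z}\bullet\mathrm{id}_w)\circ d^L_{c,y\bullet z,w}=d^L_{c,y,z\bullet w}\circ(\mathrm{id}_c\otimes\alpha^\bullet_{y,z,w}),$$ $$(\mathrm{id}_w\bullet\alpha_{y,c,d})\circ d^R_{w,y\otimes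 c,d}\circ(d^R_{w,y,c}\otimes\mathrm{id}_d)=d^R_{w,y,c\otimes d}\circ\alpha_{w\bullet y,c,d},$$ $$(\mathrm{id}_v\bullet d^R_{w,y,c})\circ d^R_{v,w\bullet y,c}\circ(\alpha^\bullet_{v,w,y}\otimes\mathrm{id}_c)=\alpha^\bullet_{v,w,y\otimes c}\circ d^R_{v\bullet w,y,c}.$$
   Context: $\Bbbk$ is an algebraically closed field. Associators are oriented as $\alpha_{x,y,z}\colon(x\otimes y)\otimes z\to x\otimes(y\otimes z)$ and $\alpha^\bullet_{x,y,z}\colon(x\bullet y)\bullet z\to x\bullet(y\bullet z)$; $l_x\colon1\otimes x\to x$ and $r_x\colon x\otimes1\to x$ are the unitors. GV-category. A dualizing object of a monoidal category $\mathcal{C}$ is an object $K$ such that for every $y$ the functor $x\mapsto\mathrm{Hom}(x\otimes y,K)$ is representable by some object $Gy$, with natural isomorphisms $\mathrm{Hom}(x\otimes y,K)\cong\mathrm{Hom}(x,Gy)$, and the resulting contravariant functor $G\colon\mathcal{C}\to\mathcal{C}$ is an anti-equivalence. A Grothendieck-Verdier category (GV-category) is a monoidal category with a chosen dualizing object $K$; $G$ is its duality functor. Second tensor product. $x\bullet y:=G^{-1}(Gy\otimes Gx)$, with associator and unitors obtained from those of $\otimes$ by transport through $G$; its unit is $K\cong G^{-1}1$. There is a natural isomorphism $\mathrm{Hom}(G^2(y)\otimes x,K)\cong\mathrm{Hom}(G^2(y),Gx)\cong\mathrm{Hom}(x,Gy)\cong\mathrm{Hom}(x\otimes y,K)$.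 By Yoneda it makes $G^2$ a monoidal functor (via $\mathrm{Hom}(G^2(x\otimes y)\otimes w,K)\cong\mathrm{Hom}(w\otimes x\otimes y,K)\cong\mathrm{Hom}(G^2y\otimes w\otimes x,K)\cong\mathrm{Hom}(G^2x\otimes G^2y\otimes w,K)$), and thereby provides a canonical identification of $x\bullet y$ with $G(G^{-1}y\otimes G^{-1}x)$, which is used throughout. Internal Hom. The functor ${-}\otimes x$ has the right adjoint $\underline{\mathrm{Hom}}^{\mathrm r}(x,-)$ given by $\underline{\mathrm{Hom}}^{\mathrm r}(x,y)=y\bullet Gx$, through $\mathrm{Hom}(c\otimes x,y)\cong\mathrm{Hom}((c\otimes x)\otimes G^{-1}y,K)\cong\mathrm{Hom}(c\otimes(x\otimes G^{-1}y),K)\cong\mathrm{Hom}(c,G(x\otimes G^{-1}y))=\mathrm{Hom}(c,y\bullet Gx)$. Write $\mathrm{ev}_{x,y}\colon(y\bullet Gx)\otimes x\to y$ for the counit and $\eta_{x,y}\colon y\to(y\otimes x)\bullet Gx$ for the unit. Distributors. (1) $d^L$: ${-}\otimes x$ is a strong left module functor on $\mathcal{C}$ as a left $(\mathcal{C},\otimes)$-module via $\alpha$, so its right adjoint ${-}\bullet Gx$ is canonically a lax left $(\mathcal{C},\otimes)$-module functor. Its constraint is $d^L_{c,y,Gx}\colon c\otimes(y\bullet Gx)\to(c\otimes y)\bullet Gx$, i.e. the morphism corresponding under the adjunction to $(\mathrm{id}_c\otimes\mathrm{ev}_{x,y})\circ\alpha_{c,y\bullet Gx,x}\colon(c\otimes(y\bullet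 Gx))\otimes x\to c\otimes y$. Since $G$ is an anti-equivalence this defines $d^L_{c,y,z}$ for all $z$. (2) $d^R$: ${-}\bullet Gc$ is a strong left module functor on $\mathcal{C}$ as a left $(\mathcal{C},\bullet)$-module via $\alpha^\bullet$, so its left adjoint ${-}\otimes c$ is canonically an oplax left $(\mathcal{C},\bullet)$-module functor. Its constraint is $d^R_{w,y,c}\colon(w\bullet y)\otimes c\to w\bullet(y\otimes c)$, i.e. the morphism corresponding under the adjunction to $(\alpha^\bullet_{w,y\otimes c,Gc})^{-1}\circ(\mathrm{id}_w\bullet\eta_{c,y})\colon w\bullet y\to(w\bullet(y\otimes c))\bullet Gc$. *)

theory Defs
  imports "HOL-Algebra.Algebraic_Closure"
begin

section \<open>Categories\<close>

record ('o, 'm) cat =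
  Ob :: "'o set"
  Hom :: "'o \<Rightarrow> 'o \<Rightarrow> 'm set"
  iden :: "'o \<Rightarrow> 'm"
  cmp :: "'m \<Rightarrow> 'm \<Rightarrow> 'm" (infixr \<open>\<cdot>\<index>\<close> 55)

text \<open>Hom-sets between distinct pairs of objects are disjoint, so that a morphism determines its
  source and target; composition is in applicative order.\<close>

locale category =
  fixes C :: "('o, 'm, 'c) cat_scheme" (structure)
  assumes Hom_disjoint:
      "\<lbrakk>x \<in> Ob C; y \<in> Ob C; x' \<in> Ob C; y' \<in> Ob C; f \<in> Hom C x y; f \<in> Hom C x' y'\<rbrakk>
        \<Longrightarrow> x = x' \<and> y = y'"
    and iden_in_Hom: "x \<in> Ob C \<Longrightarrow> iden C x \<in> Hom C x x"
    and cmp_in_Hom: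
      "\<lbrakk>x \<in> Ob C; y \<in> Ob C; z \<in> Ob C; f \<in> Hom C x y; g \<in> Hom C y z\<rbrakk> \<Longrightarrow> g \<cdot> f \<in> Hom C x z"
    and cmp_assoc:
      "\<lbrakk>w \<in> Ob C; x \<in> Ob C; y \<in> Ob C; z \<in> Ob C;
        f \<in> Hom C w x; g \<in> Hom C x y; h \<in> Hom C y z\<rbrakk> \<Longrightarrow> (h \<cdot> g) \<cdot> f = h \<cdot> (g \<cdot> f)"
    and iden_left: "\<lbrakk>x \<in> Ob C; y \<in> Ob C; f \<in> Hom C x y\<rbrakk> \<Longrightarrow> iden C y \<cdot> f = f"
    and iden_right: "\<lbrakk>x \<in> Ob C; y \<in> Ob C; f \<in> Hom C x y\<rbrakk> \<Longrightarrow> f \<cdot> iden C x = f"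

definition inverse_pair :: "('o, 'm, 'c) cat_scheme \<Rightarrow> 'o \<Rightarrow> 'o \<Rightarrow> 'm \<Rightarrow> 'm \<Rightarrow> bool" where
  "inverse_pair C x y f g \<longleftrightarrow> f \<in> Hom C x y \<and> g \<in> Hom C y x \<and>
     g \<cdot>\<^bsub>C\<^esub> f = iden C x \<and> f \<cdot>\<^bsub>C\<^esub> g = iden C y"

definition is_iso :: "('o, 'm, 'c) cat_scheme \<Rightarrow> 'o \<Rightarrow> 'o \<Rightarrow> 'm \<Rightarrow> bool" where
  "is_iso C x y f \<longleftrightarrow> (\<exists>g. inverse_pair C x y f g)"

definition cinv :: "('o, 'm, 'c) cat_scheme \<Rightarrow> 'm \<Rightarrow> 'm" where
  "cinv C f = (THE g. \<exists>x\<in>Ob C. \<exists>y\<in>Ob C. inverse_pair C x y f g)"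

locale contravariant_functor = category C for C :: "('o, 'm, 'c) cat_scheme" (structure) +
  fixes Fo :: "'o \<Rightarrow> 'o" and Fa :: "'m \<Rightarrow> 'm"
  assumes Fo_Ob: "x \<in> Ob C \<Longrightarrow> Fo x \<in> Ob C"
    and Fa_Hom: "\<lbrakk>x \<in> Ob C; y \<in> Ob C; f \<in> Hom C x y\<rbrakk> \<Longrightarrow> Fa f \<in> Hom C (Fo y) (Fo x)"
    and Fa_iden: "x \<in> Ob C \<Longrightarrow> Fa (iden C x) = iden C (Fo x)"
    and Fa_cmp:
      "\<lbrakk>x \<in> Ob C; y \<in> Ob C; z \<in> Ob C; f \<in> Hom C x y; g \<in> Hom C y z\<rbrakk>
        \<Longrightarrow> Fa (g \<cdot> f) = Fa f \<cdot> Fa g"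

text \<open>An anti-equivalence \<open>F\<close> of \<open>C\<close> together with a chosen quasi-inverse \<open>H\<close> and chosen natural
  isomorphisms \<open>e x : x \<rightarrow> F (H x)\<close> and \<open>e' x : x \<rightarrow> H (F x)\<close>. As usual the two isomorphisms are
  normalised by the triangle identities of an adjoint equivalence: every anti-equivalence admits
  such a choice (given \<open>F\<close>, \<open>H\<close> and \<open>e\<close>, there is exactly one \<open>e'\<close>), and without it the
  identifications of \<open>F (H x)\<close> and \<open>H (F x)\<close> with \<open>x\<close> would not be compatible.\<close>

locale anti_equivalence =
  F: contravariant_functor C Fo Fa + H: contravariant_functor C Ho Ha
  for C :: "('o, 'm, 'c) cat_scheme" (structure)
    and Fo :: "'o \<Rightarrow> 'o" and Fa :: "'m \<Rightarrow> 'm" and Ho :: "'o \<Rightarrow> 'o" and Ha :: "'m \<Rightarrow> 'm" +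
  fixes e e' :: "'o \<Rightarrow> 'm"
  assumes e_iso: "x \<in> Ob C \<Longrightarrow> is_iso C x (Fo (Ho x)) (e x)"
    and e'_iso: "x \<in> Ob C \<Longrightarrow> is_iso C x (Ho (Fo x)) (e' x)"
    and e_natural:
      "\<lbrakk>x \<in> Ob C; y \<in> Ob C; f \<in> Hom C x y\<rbrakk> \<Longrightarrow> e y \<cdot> f = Fa (Ha f) \<cdot> e x"
    and e'_natural:
      "\<lbrakk>x \<in> Ob C; y \<in> Ob C; f \<in> Hom C x y\<rbrakk> \<Longrightarrow> e' y \<cdot> f = Ha (Fa f) \<cdot> e' x"
    and triangle_F: "x \<in> Ob C \<Longrightarrow> Fa (e' x) \<cdot> e (Fo x) = iden C (Fo x)"
    and triangle_H: "x \<in> Ob C \<Longrightarrow> Ha (e x) \<cdot> e' (Ho x) = iden C (Ho x)"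


section \<open>Monoidal categories\<close>

record ('o, 'm) moncat = "('o, 'm) cat" +
  tobj :: "'o \<Rightarrow> 'o \<Rightarrow> 'o" (infixr \<open>\<otimes>\<^sub>o\<index>\<close> 70)
  tarr :: "'m \<Rightarrow> 'm \<Rightarrow> 'm" (infixr \<open>\<otimes>\<^sub>a\<index>\<close> 70)
  tunit :: 'o
  assoc :: "'o \<Rightarrow> 'o \<Rightarrow> 'o \<Rightarrow> 'm"
  lunit :: "'o \<Rightarrow> 'm"
  runit :: "'o \<Rightarrow> 'm"

locale monoidal_category = category C for C :: "('o, 'm, 'c) moncat_scheme" (structure) +
  assumes tobj_Ob: "\<lbrakk>x \<in> Ob C; y \<in> Ob C\<rbrakk> \<Longrightarrow> x \<otimes>\<^sub>o y \<in> Ob C"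
    and tunit_Ob: "tunit C \<in> Ob C"
    and tarr_Hom:
      "\<lbrakk>x \<in> Ob C; x' \<in> Ob C; y \<in> Ob C; y' \<in> Ob C; f \<in> Hom C x x'; g \<in> Hom C y y'\<rbrakk>
        \<Longrightarrow> f \<otimes>\<^sub>a g \<in> Hom C (x \<otimes>\<^sub>o y) (x' \<otimes>\<^sub>o y')"
    and tarr_iden:
      "\<lbrakk>x \<in> Ob C; y \<in> Ob C\<rbrakk> \<Longrightarrow> iden C x \<otimes>\<^sub>a iden C y = iden C (x \<otimes>\<^sub>o y)"
    and tarr_cmp:
      "\<lbrakk>x \<in> Ob C; x' \<in> Ob C; x'' \<in> Ob C; y \<in> Ob C; y' \<in> Ob C; y'' \<in> Ob C;
        f \<in> Hom C x x'; f' \<in> Hom C x' x''; g \<in> Hom C y y'; g' \<in> Hom C y' y''\<rbrakk>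
        \<Longrightarrow> (f' \<cdot> f) \<otimes>\<^sub>a (g' \<cdot> g) = (f' \<otimes>\<^sub>a g') \<cdot> (f \<otimes>\<^sub>a g)"
    and assoc_iso:
      "\<lbrakk>x \<in> Ob C; y \<in> Ob C; z \<in> Ob C\<rbrakk>
        \<Longrightarrow> is_iso C ((x \<otimes>\<^sub>o y) \<otimes>\<^sub>o z) (x \<otimes>\<^sub>o (y \<otimes>\<^sub>o z)) (assoc C x y z)"
    and lunit_iso: "x \<in> Ob C \<Longrightarrow> is_iso C (tunit C \<otimes>\<^sub>o x) x (lunit C x)"
    and runit_iso: "x \<in> Ob C \<Longrightarrow> is_iso C (x \<otimes>\<^sub>o tunit C) x (runit C x)"
    and assoc_natural:
      "\<lbrakk>x \<in> Ob C; x' \<in> Ob C; y \<in> Ob C; y' \<in> Ob C; z \<in> Ob C; z' \<in> Ob C;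
        f \<in> Hom C x x'; g \<in> Hom C y y'; h \<in> Hom C z z'\<rbrakk>
        \<Longrightarrow> assoc C x' y' z' \<cdot> ((f \<otimes>\<^sub>a g) \<otimes>\<^sub>a h) = (f \<otimes>\<^sub>a (g \<otimes>\<^sub>a h)) \<cdot> assoc C x y z"
    and lunit_natural:
      "\<lbrakk>x \<in> Ob C; y \<in> Ob C; f \<in> Hom C x y\<rbrakk>
        \<Longrightarrow> lunit C y \<cdot> (iden C (tunit C) \<otimes>\<^sub>a f) = f \<cdot> lunit C x"
    and runit_natural:
      "\<lbrakk>x \<in> Ob C; y \<in> Ob C; f \<in> Hom C x y\<rbrakk>
        \<Longrightarrow> runit C y \<cdot> (f \<otimes>\<^sub>a iden C (tunit C)) = f \<cdot> runit C x"
    and pentagon: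
      "\<lbrakk>w \<in> Ob C; x \<in> Ob C; y \<in> Ob C; z \<in> Ob C\<rbrakk>
        \<Longrightarrow> assoc C w x (y \<otimes>\<^sub>o z) \<cdot> assoc C (w \<otimes>\<^sub>o x) y z
          = (iden C w \<otimes>\<^sub>a assoc C x y z) \<cdot> assoc C w (x \<otimes>\<^sub>o y) z \<cdot> (assoc C w x y \<otimes>\<^sub>a iden C z)"
    and triangle:
      "\<lbrakk>x \<in> Ob C; y \<in> Ob C\<rbrakk>
        \<Longrightarrow> (iden C x \<otimes>\<^sub>a lunit C y) \<cdot> assoc C x (tunit C) y = runit C x \<otimes>\<^sub>a iden C y"

text \<open>\<open>V x y\<close> is the \<open>k\<close>-vector space structure on \<open>Hom C x y\<close>; the multiplicative components of
  the record \<^typ>\<open>('k, 'm) module\<close> are irrelevant.\<close>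

locale linear_monoidal_category =
  field k + monoidal_category C
  for k :: "('k, 'r) ring_scheme" and C :: "('o, 'm, 'c) moncat_scheme" (structure) +
  fixes V :: "'o \<Rightarrow> 'o \<Rightarrow> ('k, 'm) module"
  assumes V_module: "\<lbrakk>x \<in> Ob C; y \<in> Ob C\<rbrakk> \<Longrightarrow> Module.module k (V x y)"
    and V_carrier: "\<lbrakk>x \<in> Ob C; y \<in> Ob C\<rbrakk> \<Longrightarrow> carrier (V x y) = Hom C x y"
    and cmp_add_left:
      "\<lbrakk>x \<in> Ob C; y \<in> Ob C; z \<in> Ob C; f \<in> Hom C x y; g \<in> Hom C y z; g' \<in> Hom C y z\<rbrakk>
        \<Longrightarrow> (g \<oplus>\<^bsub>V y z\<^esub> g') \<cdot> f = (g \<cdot> f) \<oplus>\<^bsub>V x z\<^esub> (g' \<cdot> f)"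
    and cmp_add_right:
      "\<lbrakk>x \<in> Ob C; y \<in> Ob C; z \<in> Ob C; f \<in> Hom C x y; f' \<in> Hom C x y; g \<in> Hom C y z\<rbrakk>
        \<Longrightarrow> g \<cdot> (f \<oplus>\<^bsub>V x y\<^esub> f') = (g \<cdot> f) \<oplus>\<^bsub>V x z\<^esub> (g \<cdot> f')"
    and cmp_smult_left:
      "\<lbrakk>x \<in> Ob C; y \<in> Ob C; z \<in> Ob C; a \<in> carrier k; f \<in> Hom C x y; g \<in> Hom C y z\<rbrakk>
        \<Longrightarrow> (a \<odot>\<^bsub>V y z\<^esub> g) \<cdot> f = a \<odot>\<^bsub>V x z\<^esub> (g \<cdot> f)"
    and cmp_smult_right:
      "\<lbrakk>x \<in> Ob C; y \<in> Ob C; z \<in> Ob C; a \<in> carrier k; f \<in> Hom C x y; g \<in> Hom C y z\<rbrakk>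
        \<Longrightarrow> g \<cdot> (a \<odot>\<^bsub>V x y\<^esub> f) = a \<odot>\<^bsub>V x z\<^esub> (g \<cdot> f)"
    and tarr_add_left:
      "\<lbrakk>x \<in> Ob C; x' \<in> Ob C; y \<in> Ob C; y' \<in> Ob C;
        f \<in> Hom C x x'; f' \<in> Hom C x x'; g \<in> Hom C y y'\<rbrakk>
        \<Longrightarrow> (f \<oplus>\<^bsub>V x x'\<^esub> f') \<otimes>\<^sub>a g = (f \<otimes>\<^sub>a g) \<oplus>\<^bsub>V (x \<otimes>\<^sub>o y) (x' \<otimes>\<^sub>o y')\<^esub> (f' \<otimes>\<^sub>a g)"
    and tarr_add_right:
      "\<lbrakk>x \<in> Ob C; x' \<in> Ob C; y \<in> Ob C; y' \<in> Ob C;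
        f \<in> Hom C x x'; g \<in> Hom C y y'; g' \<in> Hom C y y'\<rbrakk>
        \<Longrightarrow> f \<otimes>\<^sub>a (g \<oplus>\<^bsub>V y y'\<^esub> g') = (f \<otimes>\<^sub>a g) \<oplus>\<^bsub>V (x \<otimes>\<^sub>o y) (x' \<otimes>\<^sub>o y')\<^esub> (f \<otimes>\<^sub>a g')"
    and tarr_smult_left:
      "\<lbrakk>x \<in> Ob C; x' \<in> Ob C; y \<in> Ob C; y' \<in> Ob C; a \<in> carrier k;
        f \<in> Hom C x x'; g \<in> Hom C y y'\<rbrakk>
        \<Longrightarrow> (a \<odot>\<^bsub>V x x'\<^esub> f) \<otimes>\<^sub>a g = a \<odot>\<^bsub>V (x \<otimes>\<^sub>o y) (x' \<otimes>\<^sub>o y')\<^esub> (f \<otimes>\<^sub>a g)"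
    and tarr_smult_right:
      "\<lbrakk>x \<in> Ob C; x' \<in> Ob C; y \<in> Ob C; y' \<in> Ob C; a \<in> carrier k;
        f \<in> Hom C x x'; g \<in> Hom C y y'\<rbrakk>
        \<Longrightarrow> f \<otimes>\<^sub>a (a \<odot>\<^bsub>V y y'\<^esub> g) = a \<odot>\<^bsub>V (x \<otimes>\<^sub>o y) (x' \<otimes>\<^sub>o y')\<^esub> (f \<otimes>\<^sub>a g)"


section \<open>Grothendieck-Verdier categories\<close>

text \<open>\<open>dobj\<close>, \<open>darr\<close> are the duality functor \<open>G\<close>, and \<open>pobj\<close>, \<open>parr\<close> its quasi-inverse \<open>G\<inverse>\<close>;
  \<open>rep C x y\<close> is the bijection \<open>Hom (x \<otimes> y) K \<rightarrow> Hom x (G y)\<close>; the isomorphisms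
  \<open>dp C x : x \<rightarrow> G (G\<inverse> x)\<close> and \<open>pd C x : x \<rightarrow> G\<inverse> (G x)\<close> exhibit \<open>G\<inverse>\<close> as quasi-inverse.\<close>

record ('o, 'm) gvcat = "('o, 'm) moncat" +
  dualizing :: 'o
  dobj :: "'o \<Rightarrow> 'o"
  darr :: "'m \<Rightarrow> 'm"
  rep :: "'o \<Rightarrow> 'o \<Rightarrow> 'm \<Rightarrow> 'm"
  pobj :: "'o \<Rightarrow> 'o"
  parr :: "'m \<Rightarrow> 'm"
  dp :: "'o \<Rightarrow> 'm"
  pd :: "'o \<Rightarrow> 'm"

text \<open>Naturality of \<open>rep\<close> in its second argument is what determines \<open>G\<close> on morphisms.\<close>

locale gv_category =
  monoidal_category C +
  anti_equivalence C "dobj C" "darr C" "pobj C" "parr C" "dp C" "pd C"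
  for C :: "('o, 'm, 'c) gvcat_scheme" (structure) +
  assumes dualizing_Ob: "dualizing C \<in> Ob C"
    and rep_bij:
      "\<lbrakk>x \<in> Ob C; y \<in> Ob C\<rbrakk>
        \<Longrightarrow> bij_betw (rep C x y) (Hom C (x \<otimes>\<^sub>o y) (dualizing C)) (Hom C x (dobj C y))"
    and rep_natural_left:
      "\<lbrakk>x \<in> Ob C; x' \<in> Ob C; y \<in> Ob C; f \<in> Hom C x x'; t \<in> Hom C (x' \<otimes>\<^sub>o y) (dualizing C)\<rbrakk>
        \<Longrightarrow> rep C x y (t \<cdot> (f \<otimes>\<^sub>a iden C y)) = rep C x' y t \<cdot> f"
    and rep_natural_right:
      "\<lbrakk>x \<in> Ob C; y \<in> Ob C; y' \<in> Ob C; g \<in> Hom C y y'; t \<in> Hom C (x \<otimes>\<^sub>o y') (dualizing C)\<rbrakk>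
        \<Longrightarrow> rep C x y (t \<cdot> (iden C x \<otimes>\<^sub>a g)) = darr C g \<cdot> rep C x y' t"

locale linear_gv_category =
  linear_monoidal_category k C V + gv_category C
  for k :: "('k, 'r) ring_scheme"
    and C :: "('o, 'm, 'c) gvcat_scheme" (structure)
    and V :: "'o \<Rightarrow> 'o \<Rightarrow> ('k, 'm) module"

definition rep_inv :: "('o, 'm, 'c) gvcat_scheme \<Rightarrow> 'o \<Rightarrow> 'o \<Rightarrow> 'm \<Rightarrow> 'm" where
  "rep_inv C x y = inv_into (Hom C (x \<otimes>\<^sub>o\<^bsub>C\<^esub> y) (dualizing C)) (rep C x y)"


subsection \<open>The second tensor product\<close>

definition bobj :: "('o, 'm, 'c) gvcat_scheme \<Rightarrow> 'o \<Rightarrow> 'o \<Rightarrow> 'o" (infixr \<open>\<bullet>\<^sub>o\<index>\<close> 70)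
  where "x \<bullet>\<^sub>o y = pobj C (dobj C y \<otimes>\<^sub>o dobj C x)" for C (structure)

definition barr :: "('o, 'm, 'c) gvcat_scheme \<Rightarrow> 'm \<Rightarrow> 'm \<Rightarrow> 'm" (infixr \<open>\<bullet>\<^sub>a\<index>\<close> 70)
  where "f \<bullet>\<^sub>a g = parr C (darr C g \<otimes>\<^sub>a darr C f)" for C (structure)

text \<open>\<open>G\<inverse>\<close> applied to
  \<open>G (y \<bullet> z) \<otimes> G x \<rightarrow> (G z \<otimes> G y) \<otimes> G x \<rightarrow> G z \<otimes> (G y \<otimes> G x) \<rightarrow> G z \<otimes> G (x \<bullet> y)\<close>.\<close>

definition bassoc :: "('o, 'm, 'c) gvcat_scheme \<Rightarrow> 'o \<Rightarrow> 'o \<Rightarrow> 'o \<Rightarrow> 'm"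
  where "bassoc C x y z =
    parr C ((iden C (dobj C z) \<otimes>\<^sub>a dp C (dobj C y \<otimes>\<^sub>o dobj C x)) \<cdot>
            assoc C (dobj C z) (dobj C y) (dobj C x) \<cdot>
            (cinv C (dp C (dobj C z \<otimes>\<^sub>o dobj C y)) \<otimes>\<^sub>a iden C (dobj C x)))"
  for C (structure)

text \<open>The isomorphism \<open>1 \<rightarrow> G K\<close> corresponding to \<open>l\<^sub>K : 1 \<otimes> K \<rightarrow> K\<close>. Under the anti-equivalence
  \<open>G\<close> it is the identification \<open>K \<cong> G\<inverse> 1\<close> given by Yoneda and
  \<open>Hom x K \<cong> Hom (1 \<otimes> x) K \<cong> Hom 1 (G x) \<cong> Hom x (G\<inverse> 1)\<close>.\<close>

definition unit_to_dual :: "('o, 'm, 'c) gvcat_scheme \<Rightarrow> 'm" where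
  "unit_to_dual C = rep C (tunit C) (dualizing C) (lunit C (dualizing C))"

definition blunit :: "('o, 'm, 'c) gvcat_scheme \<Rightarrow> 'o \<Rightarrow> 'm"
  where "blunit C x =
    cinv C (pd C x) \<cdot>
    parr C ((iden C (dobj C x) \<otimes>\<^sub>a unit_to_dual C) \<cdot> cinv C (runit C (dobj C x)))"
  for C (structure)

definition brunit :: "('o, 'm, 'c) gvcat_scheme \<Rightarrow> 'o \<Rightarrow> 'm"
  where "brunit C x =
    cinv C (pd C x) \<cdot>
    parr C ((unit_to_dual C \<otimes>\<^sub>a iden C (dobj C x)) \<cdot> cinv C (lunit C (dobj C x)))"
  for C (structure)


subsection \<open>The monoidal structure of the double dual\<close>

text \<open>\<open>Hom (x \<otimes> y) K \<cong> Hom x (G y) \<cong> Hom (G\<^sup>2 y) (G x) \<cong> Hom (G\<^sup>2 y \<otimes> x) K\<close>.\<close>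

definition rotate_K :: "('o, 'm, 'c) gvcat_scheme \<Rightarrow> 'o \<Rightarrow> 'o \<Rightarrow> 'm \<Rightarrow> 'm" where
  "rotate_K C x y f = rep_inv C (dobj C (dobj C y)) x (darr C (rep C x y f))"

text \<open>The morphism \<open>G\<^sup>2 x \<otimes> G\<^sup>2 y \<rightarrow> G\<^sup>2 (x \<otimes> y)\<close> that corresponds by Yoneda to the isomorphism,
  natural in \<open>w\<close>,
  \<open>Hom (G\<^sup>2 (x \<otimes> y) \<otimes> w) K \<cong> Hom (w \<otimes> x \<otimes> y) K \<cong> Hom (G\<^sup>2 y \<otimes> w \<otimes> x) K \<cong> Hom (G\<^sup>2 x \<otimes> G\<^sup>2 y \<otimes> w) K\<close>.\<close>

definition double_dual_mult :: "('o, 'm, 'c) gvcat_scheme \<Rightarrow> 'o \<Rightarrow> 'o \<Rightarrow> 'm"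
  where "double_dual_mult C x y =
    (let Dx = dobj C (dobj C x); Dy = dobj C (dobj C y); Dxy = dobj C (dobj C (x \<otimes>\<^sub>o y)) in
     THE m. m \<in> Hom C (Dx \<otimes>\<^sub>o Dy) Dxy \<and>
       (\<forall>w\<in>Ob C. \<forall>f\<in>Hom C (w \<otimes>\<^sub>o (x \<otimes>\<^sub>o y)) (dualizing C).
          rotate_K C w (x \<otimes>\<^sub>o y) f \<cdot> (m \<otimes>\<^sub>a iden C w) =
          rotate_K C (Dy \<otimes>\<^sub>o w) x
            (rotate_K C (w \<otimes>\<^sub>o x) y (f \<cdot> assoc C w x y) \<cdot> assoc C Dy w x) \<cdot>
          assoc C Dx Dy w))"
  for C (structure)

text \<open>The canonical identification \<open>G (G\<inverse> y \<otimes> G\<inverse> x) \<rightarrow> x \<bullet> y\<close>: it is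
  \<open>G (G\<inverse> y \<otimes> G\<inverse> x) \<cong> G\<inverse> (G\<^sup>2 (G\<inverse> y \<otimes> G\<inverse> x))\<close> followed by \<open>G\<inverse>\<close> of
  \<open>G y \<otimes> G x \<cong> G\<^sup>2 (G\<inverse> y) \<otimes> G\<^sup>2 (G\<inverse> x) \<cong> G\<^sup>2 (G\<inverse> y \<otimes> G\<inverse> x)\<close>.\<close>

definition bobj_ident :: "('o, 'm, 'c) gvcat_scheme \<Rightarrow> 'o \<Rightarrow> 'o \<Rightarrow> 'm"
  where "bobj_ident C x y =
    parr C (double_dual_mult C (pobj C y) (pobj C x) \<cdot>
            (darr C (cinv C (dp C y)) \<otimes>\<^sub>a darr C (cinv C (dp C x)))) \<cdot>
    pd C (dobj C (pobj C y \<otimes>\<^sub>o pobj C x))"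
  for C (structure)


subsection \<open>Internal Hom\<close>

text \<open>\<open>Hom (c \<otimes> x) y \<cong> Hom ((c \<otimes> x) \<otimes> G\<inverse> y) K \<cong> Hom (c \<otimes> (x \<otimes> G\<inverse> y)) K
  \<cong> Hom c (G (x \<otimes> G\<inverse> y)) \<cong> Hom c (G (G\<inverse> (G x) \<otimes> G\<inverse> y)) \<cong> Hom c (y \<bullet> G x)\<close>.\<close>

definition ihom_adj :: "('o, 'm, 'c) gvcat_scheme \<Rightarrow> 'o \<Rightarrow> 'o \<Rightarrow> 'o \<Rightarrow> 'm \<Rightarrow> 'm"
  where "ihom_adj C c x y f =
    bobj_ident C y (dobj C x) \<cdot>
    darr C (cinv C (pd C x) \<otimes>\<^sub>a iden C (pobj C y)) \<cdot>
    rep C c (x \<otimes>\<^sub>o pobj C y)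
      (rep_inv C (c \<otimes>\<^sub>o x) (pobj C y) (dp C y \<cdot> f) \<cdot> cinv C (assoc C c x (pobj C y)))"
  for C (structure)

definition ihom_adj_inv :: "('o, 'm, 'c) gvcat_scheme \<Rightarrow> 'o \<Rightarrow> 'o \<Rightarrow> 'o \<Rightarrow> 'm \<Rightarrow> 'm" where
  "ihom_adj_inv C c x y = inv_into (Hom C (c \<otimes>\<^sub>o\<^bsub>C\<^esub> x) y) (ihom_adj C c x y)"

definition ihom_ev :: "('o, 'm, 'c) gvcat_scheme \<Rightarrow> 'o \<Rightarrow> 'o \<Rightarrow> 'm"
  where "ihom_ev C x y = ihom_adj_inv C (y \<bullet>\<^sub>o dobj C x) x y (iden C (y \<bullet>\<^sub>o dobj C x))"
  for C (structure)

definition ihom_coev :: "('o, 'm, 'c) gvcat_scheme \<Rightarrow> 'o \<Rightarrow> 'o \<Rightarrow> 'm"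
  where "ihom_coev C x y = ihom_adj C y x (y \<otimes>\<^sub>o x) (iden C (y \<otimes>\<^sub>o x))"
  for C (structure)


subsection \<open>Distributors\<close>

definition distL_dual :: "('o, 'm, 'c) gvcat_scheme \<Rightarrow> 'o \<Rightarrow> 'o \<Rightarrow> 'o \<Rightarrow> 'm"
  where "distL_dual C c y x =
    ihom_adj C (c \<otimes>\<^sub>o (y \<bullet>\<^sub>o dobj C x)) x (c \<otimes>\<^sub>o y)
      ((iden C c \<otimes>\<^sub>a ihom_ev C x y) \<cdot> assoc C c (y \<bullet>\<^sub>o dobj C x) x)"
  for C (structure)

text \<open>\<open>distL_dual C c y x\<close> is the left distributor at \<open>(c, y, G x)\<close>; at a general \<open>(c, y, z)\<close> it is
  transported along the isomorphism \<open>dp C z : z \<rightarrow> G (G\<inverse> z)\<close>.\<close>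

definition distL :: "('o, 'm, 'c) gvcat_scheme \<Rightarrow> 'o \<Rightarrow> 'o \<Rightarrow> 'o \<Rightarrow> 'm"
  where "distL C c y z =
    (iden C (c \<otimes>\<^sub>o y) \<bullet>\<^sub>a cinv C (dp C z)) \<cdot>
    distL_dual C c y (pobj C z) \<cdot>
    (iden C c \<otimes>\<^sub>a (iden C y \<bullet>\<^sub>a dp C z))"
  for C (structure)

definition distR :: "('o, 'm, 'c) gvcat_scheme \<Rightarrow> 'o \<Rightarrow> 'o \<Rightarrow> 'o \<Rightarrow> 'm"
  where "distR C w y c =
    ihom_adj_inv C (w \<bullet>\<^sub>o y) c (w \<bullet>\<^sub>o (y \<otimes>\<^sub>o c))
      (cinv C (bassoc C w (y \<otimes>\<^sub>o c) (dobj C c)) \<cdot> (iden C w \<bullet>\<^sub>a ihom_coev C c y))"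
  for C (structure)

end

(* The object x \<bullet> y carries two evaluations, evl : G x \<otimes> (x \<bullet> y) \<rightarrow> y and
   evr : (x \<bullet> y) \<otimes> G\<inverse> y \<rightarrow> x, which induce the same pairing G x \<otimes> (x \<bullet> y) \<otimes> G\<inverse> y \<rightarrow> K.
   Each of them is universal, so a morphism into x \<bullet> y is determined by its composite with
   either one. The left distributor is the morphism whose composite with evr is
   id \<otimes> evr, and the right distributor the one whose composite with evl is evl \<otimes> id; the
   identification of x \<bullet> y with G (G\<inverse> y \<otimes> G\<inverse> x) through the monoidal structure of G\<^sup>2 is exactly
   what makes evl and evr compatible. After composing with the evaluations, each of the eight
   identities becomes naturality together with the pentagon or a unit coherence of \<otimes>. *)
theory Submission
  imports Defs
begin

section \<open>Typing of morphisms\<close>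

text \<open>Compatibility of the two evaluations costs nothing. Write \<open>P\<close> for the
  quasi-inverse \<open>pobj C\<close>; since \<open>x \<bullet> y\<close> is
  \<open>P (G y \<otimes> G x)\<close>, the pairing \<open>rho\<close> yields \<open>evl\<close> by
  stripping off \<open>G y\<close>, and \<open>evr\<close> is defined from \<open>evl\<close> by
  transposing the resulting threefold pairing. The cost lies in showing that this \<open>evr\<close>
  is the counit of the internal Hom adjunction. That adjunction passes through
  \<open>bobj_ident\<close>, hence through \<open>double_dual_mult\<close>, which is given only by a
  Yoneda description; the calculation has to follow two rotations of a pairing, and
  \<open>evr_bobj_ident\<close> is its outcome. A second obstacle is that the right distributor is
  defined as a mate under the same adjunction, with an inverse of \<open>bassoc\<close>, and nothing
  in this definition mentions \<open>evl\<close>. The bridge is \<open>evr_evl_bassoc\<close>: a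
  threefold product can be evaluated from the left and from the right in either order. Identities
  whose target is a nested product \<open>x \<bullet> (y \<bullet> z)\<close> are tested by two
  evaluations in succession, which is why the left distributor is also computed under
  \<open>evl\<close>.\<close>

context category
begin

text \<open>Disjoint hom-sets make source and target functions of the morphism. Typing conditions
  then become equations between objects instead of memberships with unknown endpoints, so that
  conditional rewriting can discharge them inside long composites.\<close>

definition arr :: "'m \<Rightarrow> bool" where
  "arr f \<longleftrightarrow> (\<exists>x\<in>Ob C. \<exists>y\<in>Ob C. f \<in> Hom C x y)"

definition src :: "'m \<Rightarrow> 'o" where
  "src f = (THE x. x \<in> Ob C \<and> (\<exists>y\<in>Ob C. f \<in> Hom C x y))"

definition trg :: "'m \<Rightarrow> 'o" where
  "trg f = (THE y. y \<in> Ob C \<and> (\<exists>x\<in>Ob C. f \<in> Hom C x y))"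

lemma Hom_typing:
  assumes "x \<in> Ob C" "y \<in> Ob C" "f \<in> Hom C x y"
  shows "arr f" "src f = x" "trg f = y"
proof -
  show "arr f" using assms by (auto simp: arr_def)
  show "src f = x" unfolding src_def using assms Hom_disjoint by blast
  show "trg f = y" unfolding trg_def using assms Hom_disjoint by blast
qed

lemma arr_typing:
  assumes "arr f"
  shows "src f \<in> Ob C" "trg f \<in> Ob C" "f \<in> Hom C (src f) (trg f)"
  using assms Hom_typing unfolding arr_def by metis+

lemmas arr_Ob [simp] = arr_typing(1,2)

lemma in_Hom_iff:
  assumes "x \<in> Ob C" "y \<in> Ob C"
  shows "f \<in> Hom C x y \<longleftrightarrow> arr f \<and> src f = x \<and> trg f = y"
  using assms Hom_typing arr_typing by metis

lemma iden_typing [simp]: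
  assumes "x \<in> Ob C"
  shows "arr (iden C x)" "src (iden C x) = x" "trg (iden C x) = x"
  using Hom_typing[OF assms assms iden_in_Hom[OF assms]] by auto

lemma cmp_typing [simp]:
  assumes "arr f" "arr g" "trg f = src g"
  shows "arr (g \<cdot> f)" "src (g \<cdot> f) = src f" "trg (g \<cdot> f) = trg g"
proof -
  have "g \<cdot> f \<in> Hom C (src f) (trg g)"
    using assms cmp_in_Hom[of "src f" "src g" "trg g" f g] arr_typing by metis
  then show "arr (g \<cdot> f)" "src (g \<cdot> f) = src f" "trg (g \<cdot> f) = trg g"
    using assms Hom_typing arr_Ob by metis+
qed

text \<open>Composites are normalised to right-nested form. Rewrite rules for a composite therefore
  often come with a variant that carries a tail \<open>k\<close>, and the calculations below display
  parentheses to isolate the block that a step rewrites.\<close>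

lemma cmp_assoc' [simp]:
  assumes "arr f" "arr g" "arr h" "trg f = src g" "trg g = src h"
  shows "(h \<cdot> g) \<cdot> f = h \<cdot> (g \<cdot> f)"
  using assms cmp_assoc[of "src f" "src g" "src h" "trg h" f g h] arr_typing by metis

lemma cmp_iden [simp]:
  shows "\<lbrakk>arr f; trg f = y\<rbrakk> \<Longrightarrow> iden C y \<cdot> f = f"
    and "\<lbrakk>arr f; src f = x\<rbrakk> \<Longrightarrow> f \<cdot> iden C x = f"
  using iden_left iden_right arr_typing by metis+

definition iso :: "'m \<Rightarrow> bool" where
  "iso f \<longleftrightarrow> arr f \<and> is_iso C (src f) (trg f) f"

lemma is_iso_typing:
  assumes "x \<in> Ob C" "y \<in> Ob C" "is_iso C x y f"
  shows "iso f" "arr f" "src f = x" "trg f = y"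
proof -
  have "f \<in> Hom C x y" using assms(3) by (auto simp: is_iso_def inverse_pair_def)
  from Hom_typing[OF assms(1,2) this] assms(3)
  show "iso f" "arr f" "src f = x" "trg f = y" by (auto simp: iso_def)
qed

text \<open>The description in \<open>cinv\<close> ranges over all endpoints, but \<open>f\<close>
  has only one pair of them; among inverses with these endpoints,
  \<open>h = (g \<cdot> f) \<cdot> h = g\<close>.\<close>

lemma cinv_inverse_pair:
  assumes "iso f"
  shows "inverse_pair C (src f) (trg f) f (cinv C f)"
proof -
  from assms obtain g where g: "inverse_pair C (src f) (trg f) f g"
    by (auto simp: iso_def is_iso_def)
  from assms have f: "arr f" by (simp add: iso_def)
  have "h = g" if h: "x \<in> Ob C" "y \<in> Ob C" "inverse_pair C x y f h" for h x y
  proof -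
    from h have [simp]: "x = src f" "y = trg f"
      using Hom_typing[of x y f] by (auto simp: inverse_pair_def)
    have ty: "arr g" "src g = trg f" "trg g = src f" "arr h" "src h = trg f" "trg h = src f"
      using g h f by (auto simp: inverse_pair_def in_Hom_iff)
    have "h = (g \<cdot> f) \<cdot> h" using g ty f by (simp add: inverse_pair_def)
    also have "\<dots> = g" using h ty f by (simp add: inverse_pair_def)
    finally show ?thesis .
  qed
  with g f have "cinv C f = g"
    unfolding cinv_def by (intro the_equality) (use arr_Ob in blast)+
  with g show ?thesis by (simp only:)
qed

lemma cinv_typing [simp]:
  assumes "iso f"
  shows "arr (cinv C f)" "src (cinv C f) = trg f" "trg (cinv C f) = src f"
    and "cinv C f \<cdot> f = iden C (src f)" "f \<cdot> cinv C f = iden C (trg f)"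
proof -
  have f: "arr f" using assms unfolding iso_def ..
  have "cinv C f \<in> Hom C (trg f) (src f)"
    using cinv_inverse_pair[OF assms] unfolding inverse_pair_def by blast
  from Hom_typing[OF arr_Ob(2)[OF f] arr_Ob(1)[OF f] this]
  show "arr (cinv C f)" "src (cinv C f) = trg f" "trg (cinv C f) = src f" .
  show "cinv C f \<cdot> f = iden C (src f)" "f \<cdot> cinv C f = iden C (trg f)"
    using cinv_inverse_pair[OF assms] unfolding inverse_pair_def by blast+
qed

lemma iso_arr [simp]: "iso f \<Longrightarrow> arr f"
  by (simp add: iso_def)

lemma cinv_cmp_cancel [simp]:
  assumes "iso f" "arr g"
  shows "trg g = src f \<Longrightarrow> cinv C f \<cdot> (f \<cdot> g) = g"
    and "trg g = trg f \<Longrightarrow> f \<cdot> (cinv C f \<cdot> g) = g"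
proof -
  show "cinv C f \<cdot> (f \<cdot> g) = g" if "trg g = src f"
    using that assms by (simp flip: cmp_assoc')
  show "f \<cdot> (cinv C f \<cdot> g) = g" if "trg g = trg f"
    using that assms by (simp flip: cmp_assoc')
qed

lemma isoI:
  assumes "arr f" "arr g" "src g = trg f" "trg g = src f"
    and "g \<cdot> f = iden C (src f)" "f \<cdot> g = iden C (trg f)"
  shows "iso f"
  unfolding iso_def is_iso_def inverse_pair_def
  using assms by (auto simp: in_Hom_iff intro!: exI[of _ g])

lemma iso_cancel_left:
  assumes "f \<cdot> g = f \<cdot> h" "iso f" "arr g" "arr h" "trg g = src f" "trg h = src f"
  shows "g = h"
  using assms cinv_cmp_cancel(1)[of f] by metis

lemma iso_cancel_right:
  assumes "g \<cdot> f = h \<cdot> f" "iso f" "arr g" "arr h" "src g = trg f" "src h = trg f"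
  shows "g = h"
proof -
  have "(g \<cdot> f) \<cdot> cinv C f = (h \<cdot> f) \<cdot> cinv C f" using assms(1) by simp
  then show ?thesis using assms(2-) by simp
qed

lemma iso_cinv [simp]: "iso f \<Longrightarrow> iso (cinv C f)"
  by (rule isoI[of _ f]) simp_all

lemma iso_iden [simp]: "x \<in> Ob C \<Longrightarrow> iso (iden C x)"
  by (rule isoI[of _ "iden C x"]) simp_all

lemma iso_cmp:
  assumes [simp]: "iso f" "iso g" "trg f = src g"
  shows "iso (g \<cdot> f)"
  by (rule isoI[of _ "cinv C f \<cdot> cinv C g"]) simp_all

end

context contravariant_functor
begin

lemma functor_typing [simp]:
  assumes "arr f"
  shows "arr (Fa f)" "src (Fa f) = Fo (trg f)" "trg (Fa f) = Fo (src f)"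
  using Hom_typing[OF Fo_Ob Fo_Ob Fa_Hom[of "src f" "trg f" f]]
    assms arr_typing by auto

lemma functor_iden [simp]: "x \<in> Ob C \<Longrightarrow> Fa (iden C x) = iden C (Fo x)"
  by (rule Fa_iden)

lemma functor_cmp:
  assumes "arr f" "arr g" "trg f = src g"
  shows "Fa (g \<cdot> f) = Fa f \<cdot> Fa g"
  using assms Fa_cmp[of "src f" "src g" "trg g" f g] arr_typing by metis

end

section \<open>Monoidal categories\<close>

context monoidal_category
begin

lemmas objects [simp] = tobj_Ob tunit_Ob

lemma tarr_typing [simp]:
  assumes "arr f" "arr g"
  shows "arr (f \<otimes>\<^sub>a g)" "src (f \<otimes>\<^sub>a g) = src f \<otimes>\<^sub>o src g" "trg (f \<otimes>\<^sub>a g) = trg f \<otimes>\<^sub>o trg g"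
  using Hom_typing[OF _ _ tarr_Hom[of "src f" "trg f" "src g" "trg g" f g]]
    assms arr_typing by auto

lemma interchange [simp]:
  assumes "arr f" "arr f'" "trg f = src f'" "arr g" "arr g'" "trg g = src g'"
  shows "(f' \<otimes>\<^sub>a g') \<cdot> (f \<otimes>\<^sub>a g) = (f' \<cdot> f) \<otimes>\<^sub>a (g' \<cdot> g)"
  using assms arr_typing
    tarr_cmp[of "src f" "src f'" "trg f'" "src g" "src g'" "trg g'" f f' g g'] by metis

lemma interchange' [simp]:
  assumes "arr f" "arr f'" "trg f = src f'" "arr g" "arr g'" "trg g = src g'"
    and "arr k" "trg k = src f \<otimes>\<^sub>o src g"
  shows "(f' \<otimes>\<^sub>a g') \<cdot> ((f \<otimes>\<^sub>a g) \<cdot> k) = ((f' \<cdot> f) \<otimes>\<^sub>a (g' \<cdot> g)) \<cdot> k"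
  using assms cmp_assoc'[of k "f \<otimes>\<^sub>a g" "f' \<otimes>\<^sub>a g'"] by simp

lemma assoc_typing [simp]:
  assumes "x \<in> Ob C" "y \<in> Ob C" "z \<in> Ob C"
  shows "iso (assoc C x y z)" "arr (assoc C x y z)"
    "src (assoc C x y z) = (x \<otimes>\<^sub>o y) \<otimes>\<^sub>o z" "trg (assoc C x y z) = x \<otimes>\<^sub>o (y \<otimes>\<^sub>o z)"
  using is_iso_typing[OF _ _ assoc_iso] assms by auto

lemma lunit_typing [simp]:
  assumes "x \<in> Ob C"
  shows "iso (lunit C x)" "arr (lunit C x)" "src (lunit C x) = tunit C \<otimes>\<^sub>o x" "trg (lunit C x) = x"
  using is_iso_typing[OF _ _ lunit_iso] assms by auto

lemma runit_typing [simp]: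
  assumes "x \<in> Ob C"
  shows "iso (runit C x)" "arr (runit C x)" "src (runit C x) = x \<otimes>\<^sub>o tunit C" "trg (runit C x) = x"
  using is_iso_typing[OF _ _ runit_iso] assms by auto

lemmas tensor_iden [simp] = tarr_iden

lemma iso_tarr [simp]:
  assumes "iso f" "iso g"
  shows "iso (f \<otimes>\<^sub>a g)"
  by (rule isoI[of _ "cinv C f \<otimes>\<^sub>a cinv C g"]) (use assms in simp_all)

lemma assoc_nat:
  assumes "arr f" "arr g" "arr h" "trg f = x" "trg g = y" "trg h = z"
  shows "assoc C x y z \<cdot> ((f \<otimes>\<^sub>a g) \<otimes>\<^sub>a h)
       = (f \<otimes>\<^sub>a (g \<otimes>\<^sub>a h)) \<cdot> assoc C (src f) (src g) (src h)"
  unfolding assms(4-6)[symmetric]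
  by (rule assoc_natural) (use assms(1-3) arr_typing in auto)

lemma assoc_nat':
  assumes "arr f" "arr g" "arr h" "trg f = x" "trg g = y" "trg h = z"
    and "arr k" "trg k = (src f \<otimes>\<^sub>o src g) \<otimes>\<^sub>o src h"
  shows "assoc C x y z \<cdot> ((f \<otimes>\<^sub>a g) \<otimes>\<^sub>a h) \<cdot> k
       = (f \<otimes>\<^sub>a (g \<otimes>\<^sub>a h)) \<cdot> assoc C (src f) (src g) (src h) \<cdot> k"
proof -
  have "x \<in> Ob C" "y \<in> Ob C" "z \<in> Ob C" using assms(1-6) by auto
  then have "assoc C x y z \<cdot> ((f \<otimes>\<^sub>a g) \<otimes>\<^sub>a h) \<cdot> k = (assoc C x y z \<cdot> ((f \<otimes>\<^sub>a g) \<otimes>\<^sub>a h)) \<cdot> k"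
    using assms by simp
  also have "\<dots> = ((f \<otimes>\<^sub>a (g \<otimes>\<^sub>a h)) \<cdot> assoc C (src f) (src g) (src h)) \<cdot> k"
    by (simp only: assoc_nat assms(1-6))
  finally show ?thesis using assms by simp
qed

lemma assoc_inv_nat:
  assumes "arr f" "arr g" "arr h" "trg f = x" "trg g = y" "trg h = z"
  shows "cinv C (assoc C x y z) \<cdot> (f \<otimes>\<^sub>a (g \<otimes>\<^sub>a h))
       = ((f \<otimes>\<^sub>a g) \<otimes>\<^sub>a h) \<cdot> cinv C (assoc C (src f) (src g) (src h))"
proof -
  have ob: "x \<in> Ob C" "y \<in> Ob C" "z \<in> Ob C" using assms(1-6) by auto
  have "assoc C x y z \<cdot> ((f \<otimes>\<^sub>a g) \<otimes>\<^sub>a h) \<cdot> cinv C (assoc C (src f) (src g) (src h))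
      = f \<otimes>\<^sub>a (g \<otimes>\<^sub>a h)"
    using assms by (simp add: assoc_nat')
  then have "cinv C (assoc C x y z) \<cdot> (f \<otimes>\<^sub>a (g \<otimes>\<^sub>a h)) = cinv C (assoc C x y z) \<cdot>
      assoc C x y z \<cdot> ((f \<otimes>\<^sub>a g) \<otimes>\<^sub>a h) \<cdot> cinv C (assoc C (src f) (src g) (src h))"
    by (simp only:)
  also have "\<dots> = ((f \<otimes>\<^sub>a g) \<otimes>\<^sub>a h) \<cdot> cinv C (assoc C (src f) (src g) (src h))"
    by (rule cinv_cmp_cancel) (use assms ob in simp_all)
  finally show ?thesis .
qed

lemma assoc_inv_nat':
  assumes "arr f" "arr g" "arr h" "trg f = x" "trg g = y" "trg h = z"
    and "arr k" "trg k = src f \<otimes>\<^sub>o (src g \<otimes>\<^sub>o src h)"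
  shows "cinv C (assoc C x y z) \<cdot> (f \<otimes>\<^sub>a (g \<otimes>\<^sub>a h)) \<cdot> k
       = ((f \<otimes>\<^sub>a g) \<otimes>\<^sub>a h) \<cdot> cinv C (assoc C (src f) (src g) (src h)) \<cdot> k"
proof -
  have "x \<in> Ob C" "y \<in> Ob C" "z \<in> Ob C" using assms(1-6) by auto
  then have "cinv C (assoc C x y z) \<cdot> (f \<otimes>\<^sub>a (g \<otimes>\<^sub>a h)) \<cdot> k
      = (cinv C (assoc C x y z) \<cdot> (f \<otimes>\<^sub>a (g \<otimes>\<^sub>a h))) \<cdot> k"
    using assms by simp
  also have "\<dots> = (((f \<otimes>\<^sub>a g) \<otimes>\<^sub>a h) \<cdot> cinv C (assoc C (src f) (src g) (src h))) \<cdot> k"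
    by (simp only: assoc_inv_nat assms(1-6))
  finally show ?thesis using assms by simp
qed

text \<open>Identities of tensor products are normalised to identities, so that naturality of the
  associator has to be restated for them.\<close>

lemma assoc_nat_iden:
  assumes "x \<in> Ob C" "y \<in> Ob C" "arr h" "trg h = z"
  shows "assoc C x y z \<cdot> (iden C (x \<otimes>\<^sub>o y) \<otimes>\<^sub>a h) = (iden C x \<otimes>\<^sub>a (iden C y \<otimes>\<^sub>a h)) \<cdot> assoc C x y (src h)"
    and "\<lbrakk>arr k; trg k = (x \<otimes>\<^sub>o y) \<otimes>\<^sub>o src h\<rbrakk> \<Longrightarrow> assoc C x y z \<cdot> (iden C (x \<otimes>\<^sub>o y) \<otimes>\<^sub>a h) \<cdot> k
      = (iden C x \<otimes>\<^sub>a (iden C y \<otimes>\<^sub>a h)) \<cdot> assoc C x y (src h) \<cdot> k"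
  using assms assoc_nat[of "iden C x" "iden C y" h x y z] assoc_nat'[of "iden C x" "iden C y" h x y z] by simp_all

lemma assoc_inv_nat_iden:
  assumes "y \<in> Ob C" "z \<in> Ob C" "arr f" "trg f = x"
  shows "cinv C (assoc C x y z) \<cdot> (f \<otimes>\<^sub>a iden C (y \<otimes>\<^sub>o z))
      = ((f \<otimes>\<^sub>a iden C y) \<otimes>\<^sub>a iden C z) \<cdot> cinv C (assoc C (src f) y z)"
    and "\<lbrakk>arr k; trg k = src f \<otimes>\<^sub>o (y \<otimes>\<^sub>o z)\<rbrakk> \<Longrightarrow> cinv C (assoc C x y z) \<cdot> (f \<otimes>\<^sub>a iden C (y \<otimes>\<^sub>o z)) \<cdot> k
      = ((f \<otimes>\<^sub>a iden C y) \<otimes>\<^sub>a iden C z) \<cdot> cinv C (assoc C (src f) y z) \<cdot> k"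
  using assms assoc_inv_nat[of f "iden C y" "iden C z" x y z] assoc_inv_nat'[of f "iden C y" "iden C z" x y z]
  by simp_all

lemmas assoc_slide = assoc_nat assoc_nat' assoc_inv_nat assoc_inv_nat'
  assoc_nat_iden assoc_inv_nat_iden

section \<open>Unit coherence and the pentagon with inverted associators\<close>

lemma lunit_nat:
  assumes "arr f" "trg f = y"
  shows "lunit C y \<cdot> (iden C (tunit C) \<otimes>\<^sub>a f) = f \<cdot> lunit C (src f)"
  unfolding assms(2)[symmetric] by (rule lunit_natural) (use assms(1) arr_typing in auto)

lemma runit_nat:
  assumes "arr f" "trg f = y"
  shows "runit C y \<cdot> (f \<otimes>\<^sub>a iden C (tunit C)) = f \<cdot> runit C (src f)"
  unfolding assms(2)[symmetric] by (rule runit_natural) (use assms(1) arr_typing in auto)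

text \<open>Tensoring with the unit object is faithful, because \<open>lunit\<close> is a natural
  isomorphism from this functor to the identity.\<close>

lemma lunit_cancel:
  assumes "iden C (tunit C) \<otimes>\<^sub>a f = iden C (tunit C) \<otimes>\<^sub>a g"
    and "arr f" "arr g" "src f = src g" "trg f = trg g"
  shows "f = g"
proof (rule iso_cancel_right)
  show "f \<cdot> lunit C (src f) = g \<cdot> lunit C (src f)"
    using assms lunit_nat[of f "trg f"] lunit_nat[of g "trg f"] by metis
qed (use assms in simp_all)

lemma runit_cancel:
  assumes "f \<otimes>\<^sub>a iden C (tunit C) = g \<otimes>\<^sub>a iden C (tunit C)"
    and "arr f" "arr g" "src f = src g" "trg f = trg g"
  shows "f = g"
proof (rule iso_cancel_right)
  show "f \<cdot> runit C (src f) = g \<cdot> runit C (src f)"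
    using assms runit_nat[of f "trg f"] runit_nat[of g "trg f"] by metis
qed (use assms in simp_all)

text \<open>Kelly's argument: this coherence is not among the axioms, whose triangle has the unit in
  the middle. After tensoring with one more unit on the left, the pentagon brings the triangle into
  play, once at \<open>x \<otimes> y\<close> and once at \<open>x\<close>, and
  \<open>lunit_cancel\<close> removes the extra unit.\<close>

lemma lunit_tensor:
  assumes [simp]: "x \<in> Ob C" "y \<in> Ob C"
  shows "lunit C (x \<otimes>\<^sub>o y) \<cdot> assoc C (tunit C) x y = lunit C x \<otimes>\<^sub>a iden C y"
proof -
  let ?i = "tunit C"
  have tri: "(iden C ?i \<otimes>\<^sub>a lunit C z) \<cdot> assoc C ?i ?i z = runit C ?i \<otimes>\<^sub>a iden C z" if "z \<in> Ob C" for z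
    using that triangle[of ?i z] by simp
  have "(iden C ?i \<otimes>\<^sub>a (lunit C (x \<otimes>\<^sub>o y) \<cdot> assoc C ?i x y)) \<cdot>
        (assoc C ?i (?i \<otimes>\<^sub>o x) y \<cdot> (assoc C ?i ?i x \<otimes>\<^sub>a iden C y))
     = (iden C ?i \<otimes>\<^sub>a lunit C (x \<otimes>\<^sub>o y)) \<cdot> ((iden C ?i \<otimes>\<^sub>a assoc C ?i x y) \<cdot>
        assoc C ?i (?i \<otimes>\<^sub>o x) y \<cdot> (assoc C ?i ?i x \<otimes>\<^sub>a iden C y))" by simp
  also have "\<dots> = (iden C ?i \<otimes>\<^sub>a lunit C (x \<otimes>\<^sub>o y)) \<cdot> (assoc C ?i ?i (x \<otimes>\<^sub>o y) \<cdot> assoc C (?i \<otimes>\<^sub>o ?i) x y)"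
    by (simp only: pentagon assms objects)
  also have "\<dots> = ((iden C ?i \<otimes>\<^sub>a lunit C (x \<otimes>\<^sub>o y)) \<cdot> assoc C ?i ?i (x \<otimes>\<^sub>o y)) \<cdot> assoc C (?i \<otimes>\<^sub>o ?i) x y"
    by simp
  also have "\<dots> = (runit C ?i \<otimes>\<^sub>a iden C (x \<otimes>\<^sub>o y)) \<cdot> assoc C (?i \<otimes>\<^sub>o ?i) x y"
    by (simp only: tri objects assms)
  also have "\<dots> = assoc C ?i x y \<cdot> ((runit C ?i \<otimes>\<^sub>a iden C x) \<otimes>\<^sub>a iden C y)"
    by (simp add: assoc_slide)
  also have "\<dots> = assoc C ?i x y \<cdot> (((iden C ?i \<otimes>\<^sub>a lunit C x) \<cdot> assoc C ?i ?i x) \<otimes>\<^sub>a iden C y)"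
    by (simp only: tri assms)
  also have "\<dots> = assoc C ?i x y \<cdot> ((iden C ?i \<otimes>\<^sub>a lunit C x) \<otimes>\<^sub>a iden C y) \<cdot> (assoc C ?i ?i x \<otimes>\<^sub>a iden C y)"
    by simp
  also have "\<dots> = (iden C ?i \<otimes>\<^sub>a (lunit C x \<otimes>\<^sub>a iden C y)) \<cdot>
        (assoc C ?i (?i \<otimes>\<^sub>o x) y \<cdot> (assoc C ?i ?i x \<otimes>\<^sub>a iden C y))"
    by (subst assoc_nat') simp_all
  finally have "iden C ?i \<otimes>\<^sub>a (lunit C (x \<otimes>\<^sub>o y) \<cdot> assoc C ?i x y) = iden C ?i \<otimes>\<^sub>a (lunit C x \<otimes>\<^sub>a iden C y)"
    by (rule iso_cancel_right) (simp_all add: iso_cmp)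
  then show ?thesis
    by (rule lunit_cancel) simp_all
qed

text \<open>The mirror image of \<open>lunit_tensor\<close>: an extra unit on the right, the
  pentagon, and the triangle at \<open>y\<close> and at \<open>x \<otimes> y\<close>.\<close>

lemma runit_tensor:
  assumes [simp]: "x \<in> Ob C" "y \<in> Ob C"
  shows "(iden C x \<otimes>\<^sub>a runit C y) \<cdot> assoc C x y (tunit C) = runit C (x \<otimes>\<^sub>o y)"
proof -
  let ?i = "tunit C"
  have tri: "runit C z \<otimes>\<^sub>a iden C ?i = (iden C z \<otimes>\<^sub>a lunit C ?i) \<cdot> assoc C z ?i ?i" if "z \<in> Ob C" for z
    using that triangle[of z ?i] by simp
  have "assoc C x y ?i \<cdot> (((iden C x \<otimes>\<^sub>a runit C y) \<cdot> assoc C x y ?i) \<otimes>\<^sub>a iden C ?i)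
     = assoc C x y ?i \<cdot> ((iden C x \<otimes>\<^sub>a runit C y) \<otimes>\<^sub>a iden C ?i) \<cdot> (assoc C x y ?i \<otimes>\<^sub>a iden C ?i)"
    by simp
  also have "\<dots> = (iden C x \<otimes>\<^sub>a (runit C y \<otimes>\<^sub>a iden C ?i)) \<cdot> assoc C x (y \<otimes>\<^sub>o ?i) ?i \<cdot> (assoc C x y ?i \<otimes>\<^sub>a iden C ?i)"
    by (subst assoc_nat') simp_all
  also have "\<dots> = (iden C x \<otimes>\<^sub>a (iden C y \<otimes>\<^sub>a lunit C ?i)) \<cdot>
      ((iden C x \<otimes>\<^sub>a assoc C y ?i ?i) \<cdot> assoc C x (y \<otimes>\<^sub>o ?i) ?i \<cdot> (assoc C x y ?i \<otimes>\<^sub>a iden C ?i))"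
    by (simp add: tri)
  also have "\<dots> = (iden C x \<otimes>\<^sub>a (iden C y \<otimes>\<^sub>a lunit C ?i)) \<cdot> (assoc C x y (?i \<otimes>\<^sub>o ?i) \<cdot> assoc C (x \<otimes>\<^sub>o y) ?i ?i)"
    by (simp only: pentagon assms objects)
  also have "\<dots> = assoc C x y ?i \<cdot> ((iden C (x \<otimes>\<^sub>o y) \<otimes>\<^sub>a lunit C ?i) \<cdot> assoc C (x \<otimes>\<^sub>o y) ?i ?i)"
    by (simp add: assoc_slide)
  also have "\<dots> = assoc C x y ?i \<cdot> (runit C (x \<otimes>\<^sub>o y) \<otimes>\<^sub>a iden C ?i)"
    by (simp only: tri objects assms)
  finally have "((iden C x \<otimes>\<^sub>a runit C y) \<cdot> assoc C x y ?i) \<otimes>\<^sub>a iden C ?i = runit C (x \<otimes>\<^sub>o y) \<otimes>\<^sub>a iden C ?i"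
    by (rule iso_cancel_left) simp_all
  then show ?thesis
    by (rule runit_cancel) simp_all
qed

text \<open>Each left-hand side is a block of associators that is left over when an identity is
  tested against evaluations: the first shape serves \<open>evr_evl_bassoc\<close> and
  \<open>evl_distL\<close>, the second \<open>evl_bassoc\<close> and \<open>distR_bassoc\<close>,
  the third \<open>distL_bassoc\<close>, the fourth \<open>distR_assoc\<close>. The last three
  result from the first by composing with associators.\<close>

lemma pentagon_inv:
  assumes [simp]: "w \<in> Ob C" "x \<in> Ob C" "y \<in> Ob C" "z \<in> Ob C"
  shows pentagon_inv1: "(cinv C (assoc C w x y) \<otimes>\<^sub>a iden C z) \<cdot> cinv C (assoc C w (x \<otimes>\<^sub>o y) z)
      = cinv C (assoc C (w \<otimes>\<^sub>o x) y z) \<cdot> cinv C (assoc C w x (y \<otimes>\<^sub>o z)) \<cdot> (iden C w \<otimes>\<^sub>a assoc C x y z)"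
    and pentagon_inv2: "(assoc C w x y \<otimes>\<^sub>a iden C z) \<cdot> cinv C (assoc C (w \<otimes>\<^sub>o x) y z) \<cdot> cinv C (assoc C w x (y \<otimes>\<^sub>o z))
      = cinv C (assoc C w (x \<otimes>\<^sub>o y) z) \<cdot> (iden C w \<otimes>\<^sub>a cinv C (assoc C x y z))"
    and pentagon_inv3: "cinv C (assoc C w x (y \<otimes>\<^sub>o z)) \<cdot> (iden C w \<otimes>\<^sub>a assoc C x y z) \<cdot> assoc C w (x \<otimes>\<^sub>o y) z
      = assoc C (w \<otimes>\<^sub>o x) y z \<cdot> (cinv C (assoc C w x y) \<otimes>\<^sub>a iden C z)"
    and pentagon_inv4: "assoc C (w \<otimes>\<^sub>o x) y z \<cdot> (cinv C (assoc C w x y) \<otimes>\<^sub>a iden C z) \<cdot> cinv C (assoc C w (x \<otimes>\<^sub>o y) z)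
      = cinv C (assoc C w x (y \<otimes>\<^sub>o z)) \<cdot> (iden C w \<otimes>\<^sub>a assoc C x y z)"
proof -
  let ?l = "(cinv C (assoc C w x y) \<otimes>\<^sub>a iden C z) \<cdot> cinv C (assoc C w (x \<otimes>\<^sub>o y) z)"
  let ?r = "cinv C (assoc C (w \<otimes>\<^sub>o x) y z) \<cdot> cinv C (assoc C w x (y \<otimes>\<^sub>o z)) \<cdot> (iden C w \<otimes>\<^sub>a assoc C x y z)"
  let ?p = "assoc C w x (y \<otimes>\<^sub>o z) \<cdot> assoc C (w \<otimes>\<^sub>o x) y z"
  show 1: "?l = ?r"
  proof (rule iso_cancel_left)
    have "?p \<cdot> ?l = ((iden C w \<otimes>\<^sub>a assoc C x y z) \<cdot> assoc C w (x \<otimes>\<^sub>o y) z \<cdot> (assoc C w x y \<otimes>\<^sub>a iden C z)) \<cdot> ?l"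
      by (simp only: pentagon assms)
    also have "\<dots> = ?p \<cdot> ?r" by simp
    finally show "?p \<cdot> ?l = ?p \<cdot> ?r" .
  qed (simp_all add: iso_cmp)
  have "(assoc C w x y \<otimes>\<^sub>a iden C z) \<cdot> cinv C (assoc C (w \<otimes>\<^sub>o x) y z) \<cdot> cinv C (assoc C w x (y \<otimes>\<^sub>o z))
    = (assoc C w x y \<otimes>\<^sub>a iden C z) \<cdot> ?r \<cdot> (iden C w \<otimes>\<^sub>a cinv C (assoc C x y z))" by simp
  also have "\<dots> = (assoc C w x y \<otimes>\<^sub>a iden C z) \<cdot> ?l \<cdot> (iden C w \<otimes>\<^sub>a cinv C (assoc C x y z))"
    by (simp only: 1)
  also have "\<dots> = cinv C (assoc C w (x \<otimes>\<^sub>o y) z) \<cdot> (iden C w \<otimes>\<^sub>a cinv C (assoc C x y z))" by simp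
  finally show "(assoc C w x y \<otimes>\<^sub>a iden C z) \<cdot> cinv C (assoc C (w \<otimes>\<^sub>o x) y z) \<cdot> cinv C (assoc C w x (y \<otimes>\<^sub>o z))
    = cinv C (assoc C w (x \<otimes>\<^sub>o y) z) \<cdot> (iden C w \<otimes>\<^sub>a cinv C (assoc C x y z))" .
  have "cinv C (assoc C w x (y \<otimes>\<^sub>o z)) \<cdot> (iden C w \<otimes>\<^sub>a assoc C x y z) \<cdot> assoc C w (x \<otimes>\<^sub>o y) z
      = assoc C (w \<otimes>\<^sub>o x) y z \<cdot> ?r \<cdot> assoc C w (x \<otimes>\<^sub>o y) z" by simp
  also have "\<dots> = assoc C (w \<otimes>\<^sub>o x) y z \<cdot> ?l \<cdot> assoc C w (x \<otimes>\<^sub>o y) z" by (simp only: 1)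
  also have "\<dots> = assoc C (w \<otimes>\<^sub>o x) y z \<cdot> (cinv C (assoc C w x y) \<otimes>\<^sub>a iden C z)" by simp
  finally show "cinv C (assoc C w x (y \<otimes>\<^sub>o z)) \<cdot> (iden C w \<otimes>\<^sub>a assoc C x y z) \<cdot> assoc C w (x \<otimes>\<^sub>o y) z
      = assoc C (w \<otimes>\<^sub>o x) y z \<cdot> (cinv C (assoc C w x y) \<otimes>\<^sub>a iden C z)" .
  show "assoc C (w \<otimes>\<^sub>o x) y z \<cdot> (cinv C (assoc C w x y) \<otimes>\<^sub>a iden C z) \<cdot> cinv C (assoc C w (x \<otimes>\<^sub>o y) z)
      = cinv C (assoc C w x (y \<otimes>\<^sub>o z)) \<cdot> (iden C w \<otimes>\<^sub>a assoc C x y z)"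
    unfolding 1 by simp
qed

end

section \<open>Evaluations in a Grothendieck-Verdier category\<close>

context gv_category
begin

abbreviation I where "I \<equiv> iden C"
abbreviation K where "K \<equiv> dualizing C"
abbreviation G where "G \<equiv> dobj C"
abbreviation Ga where "Ga \<equiv> darr C"
abbreviation P where "P \<equiv> pobj C"
abbreviation Pa where "Pa \<equiv> parr C"
abbreviation \<alpha> where "\<alpha> \<equiv> assoc C"
abbreviation \<alpha>' where "\<alpha>' x y z \<equiv> cinv C (assoc C x y z)"

lemmas dual_objects [simp] = F.Fo_Ob H.Fo_Ob dualizing_Ob

lemma dp_typing [simp]:
  assumes "x \<in> Ob C"
  shows "iso (dp C x)" "arr (dp C x)" "src (dp C x) = x" "trg (dp C x) = G (P x)"
  using is_iso_typing[OF _ _ e_iso] assms by auto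

lemma pd_typing [simp]:
  assumes "x \<in> Ob C"
  shows "iso (pd C x)" "arr (pd C x)" "src (pd C x) = x" "trg (pd C x) = P (G x)"
  using is_iso_typing[OF _ _ e'_iso] assms by auto

lemma dp_nat:
  assumes "arr f" "trg f = y"
  shows "dp C y \<cdot> f = Ga (Pa f) \<cdot> dp C (src f)"
  unfolding assms(2)[symmetric] by (rule e_natural) (use assms(1) arr_typing in auto)

lemma pd_nat:
  assumes "arr f" "trg f = y"
  shows "pd C y \<cdot> f = Pa (Ga f) \<cdot> pd C (src f)"
  unfolding assms(2)[symmetric] by (rule e'_natural) (use assms(1) arr_typing in auto)

text \<open>Naturality of \<open>pd\<close> recovers \<open>f\<close> from
  \<open>Pa (Ga f)\<close>.\<close>

lemma Ga_faithful:
  assumes "Ga f = Ga g" "arr f" "arr g" "src f = src g" "trg f = trg g"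
  shows "f = g"
proof (rule iso_cancel_left)
  show "pd C (trg f) \<cdot> f = pd C (trg f) \<cdot> g"
    using assms pd_nat[of f "trg f"] pd_nat[of g "trg f"] by metis
qed (use assms in simp_all)

section \<open>Representability expressed by the universal pairings \<open>lam\<close> and
  \<open>rho\<close>\<close>

lemma rep_typing [simp]:
  assumes "x \<in> Ob C" "y \<in> Ob C" "arr t" "src t = x \<otimes>\<^sub>o y" "trg t = K"
  shows "arr (rep C x y t)" "src (rep C x y t) = x" "trg (rep C x y t) = G y"
proof -
  have "t \<in> Hom C (x \<otimes>\<^sub>o y) K" using assms by (simp add: in_Hom_iff)
  then have "rep C x y t \<in> Hom C x (G y)"
    using rep_bij[OF assms(1,2)] by (auto dest: bij_betwE)
  then show "arr (rep C x y t)" "src (rep C x y t) = x" "trg (rep C x y t) = G y"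
    using assms(1,2) by (simp_all add: in_Hom_iff)
qed

lemma rep_inj:
  assumes "rep C x y t = rep C x y t'" "x \<in> Ob C" "y \<in> Ob C" "arr t" "src t = x \<otimes>\<^sub>o y" "trg t = K"
    "arr t'" "src t' = x \<otimes>\<^sub>o y" "trg t' = K"
  shows "t = t'"
proof -
  have "t \<in> Hom C (x \<otimes>\<^sub>o y) K" "t' \<in> Hom C (x \<otimes>\<^sub>o y) K" using assms by (simp_all add: in_Hom_iff)
  then show ?thesis using rep_bij[OF assms(2,3)] assms(1) by (auto simp: bij_betw_def inj_on_def)
qed

lemma rep_inv_typing:
  assumes "x \<in> Ob C" "y \<in> Ob C" "arr f" "src f = x" "trg f = G y"
  shows "arr (rep_inv C x y f)" "src (rep_inv C x y f) = x \<otimes>\<^sub>o y" "trg (rep_inv C x y f) = K"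
    and "rep C x y (rep_inv C x y f) = f"
proof -
  have "f \<in> Hom C x (G y)" using assms by (simp add: in_Hom_iff)
  then have f: "f \<in> rep C x y ` Hom C (x \<otimes>\<^sub>o y) K"
    using rep_bij[OF assms(1,2)] by (simp add: bij_betw_def)
  then have "rep_inv C x y f \<in> Hom C (x \<otimes>\<^sub>o y) K"
    unfolding rep_inv_def by (rule inv_into_into)
  then show "arr (rep_inv C x y f)" "src (rep_inv C x y f) = x \<otimes>\<^sub>o y" "trg (rep_inv C x y f) = K"
    using assms(1,2) by (simp_all add: in_Hom_iff)
  show "rep C x y (rep_inv C x y f) = f"
    unfolding rep_inv_def using f by (rule f_inv_into_f)
qed

text \<open>The universal pairing \<open>G y \<otimes> y \<rightarrow> K\<close>, which corresponds
  to the identity of \<open>G y\<close>. By Yoneda every \<open>rep\<close> is transposition along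
  it, so that \<open>rep\<close> and \<open>rep_inv\<close> can be traded for composition with
  \<open>lam\<close>.\<close>

definition lam :: "'o \<Rightarrow> 'm" where
  "lam y = rep_inv C (G y) y (I (G y))"

lemma lam_typing [simp]:
  assumes "y \<in> Ob C"
  shows "arr (lam y)" "src (lam y) = G y \<otimes>\<^sub>o y" "trg (lam y) = K"
  using assms rep_inv_typing[of "G y" y "I (G y)"] by (simp_all add: lam_def)

lemma rep_lam:
  assumes "y \<in> Ob C"
  shows "rep C (G y) y (lam y) = I (G y)"
  using assms rep_inv_typing[of "G y" y "I (G y)"] by (simp add: lam_def)

lemma rep_lam_cmp:
  assumes "y \<in> Ob C" "arr f" "src f = x" "trg f = G y"
  shows "rep C x y (lam y \<cdot> (f \<otimes>\<^sub>a I y)) = f"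
proof -
  have "x \<in> Ob C" using assms by auto
  then have "rep C x y (lam y \<cdot> (f \<otimes>\<^sub>a I y)) = rep C (G y) y (lam y) \<cdot> f"
    using assms by (intro rep_natural_left) (simp_all add: in_Hom_iff)
  then show ?thesis using assms by (simp add: rep_lam)
qed

lemma lam_rep:
  assumes "x \<in> Ob C" "y \<in> Ob C" "arr t" "src t = x \<otimes>\<^sub>o y" "trg t = K"
  shows "lam y \<cdot> (rep C x y t \<otimes>\<^sub>a I y) = t"
  by (rule rep_inj[of x y]) (use assms in \<open>simp_all add: rep_lam_cmp\<close>)

lemma rep_inv_eq:
  assumes "y \<in> Ob C" "arr f" "src f = x" "trg f = G y"
  shows "rep_inv C x y f = lam y \<cdot> (f \<otimes>\<^sub>a I y)"
proof -
  have x: "x \<in> Ob C" using assms by auto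
  show ?thesis
    by (rule rep_inj[of x y])
      (use x assms rep_inv_typing[OF x assms(1,2)] in \<open>simp_all add: rep_lam_cmp\<close>)
qed

lemma lam_cancel_left:
  assumes "lam y \<cdot> (f \<otimes>\<^sub>a I y) = lam y \<cdot> (g \<otimes>\<^sub>a I y)"
    and "arr f" "arr g" "src f = src g" "trg f = G y" "trg g = G y" "y \<in> Ob C"
  shows "f = g"
  using assms rep_lam_cmp[of y f "src f"] rep_lam_cmp[of y g "src f"] by metis

text \<open>This is naturality of \<open>rep\<close> in its second argument, evaluated on the
  universal pairing: \<open>Ga g\<close> is the adjoint of \<open>g\<close> with respect to
  \<open>lam\<close>.\<close>

lemma lam_dinat:
  assumes "arr g" "src g = y" "trg g = y'"
  shows "lam y \<cdot> (Ga g \<otimes>\<^sub>a I y) = lam y' \<cdot> (I (G y') \<otimes>\<^sub>a g)"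
proof -
  have ob: "y \<in> Ob C" "y' \<in> Ob C" using assms by auto
  have "rep C (G y') y (lam y' \<cdot> (I (G y') \<otimes>\<^sub>a g)) = Ga g \<cdot> rep C (G y') y' (lam y')"
    using assms ob by (intro rep_natural_right) (simp_all add: in_Hom_iff)
  also have "\<dots> = rep C (G y') y (lam y \<cdot> (Ga g \<otimes>\<^sub>a I y))"
    using assms ob by (simp add: rep_lam rep_lam_cmp)
  finally show ?thesis
    by (rule rep_inj[symmetric]) (use assms ob in simp_all)
qed

text \<open>Representability gives cancellation in the first factor only. In the second factor,
  \<open>lam_dinat\<close> turns \<open>f\<close> into \<open>Ga f\<close> acting on the first one,
  and faithfulness of \<open>G\<close> finishes.\<close>

lemma lam_cancel_right:
  assumes "lam y \<cdot> (I (G y) \<otimes>\<^sub>a f) = lam y \<cdot> (I (G y) \<otimes>\<^sub>a g)"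
    and "arr f" "arr g" "src f = src g" "trg f = y" "trg g = y"
  shows "f = g"
proof (rule Ga_faithful)
  show "Ga f = Ga g"
  proof (rule lam_cancel_left)
    show "lam (src f) \<cdot> (Ga f \<otimes>\<^sub>a I (src f)) = lam (src f) \<cdot> (Ga g \<otimes>\<^sub>a I (src f))"
      using assms lam_dinat[of f "src f" y] lam_dinat[of g "src f" y] by metis
  qed (use assms in simp_all)
qed (use assms in simp_all)

text \<open>The pairing for the dual on the other side: \<open>dp\<close> identifies
  \<open>y\<close> with \<open>G (P y)\<close>, so \<open>P y\<close> pairs with \<open>y\<close>
  from the right as \<open>G y\<close> does from the left.\<close>

definition rho :: "'o \<Rightarrow> 'm" where
  "rho y = lam (P y) \<cdot> (dp C y \<otimes>\<^sub>a I (P y))"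

lemma rho_typing [simp]:
  assumes "y \<in> Ob C"
  shows "arr (rho y)" "src (rho y) = y \<otimes>\<^sub>o P y" "trg (rho y) = K"
  using assms by (simp_all add: rho_def)

lemma rho_cancel_left:
  assumes "rho y \<cdot> (f \<otimes>\<^sub>a I (P y)) = rho y \<cdot> (g \<otimes>\<^sub>a I (P y))"
    and "arr f" "arr g" "src f = src g" "trg f = y" "trg g = y"
  shows "f = g"
proof (rule iso_cancel_left)
  have y: "y \<in> Ob C" using assms by auto
  show "dp C y \<cdot> f = dp C y \<cdot> g"
    by (rule lam_cancel_left[of "P y"]) (use y assms in \<open>simp_all add: rho_def\<close>)
qed (use assms in auto)

lemma rho_cancel_right:
  assumes "rho y \<cdot> (I y \<otimes>\<^sub>a f) = rho y \<cdot> (I y \<otimes>\<^sub>a g)"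
    and "arr f" "arr g" "src f = src g" "trg f = P y" "trg g = P y" "y \<in> Ob C"
  shows "f = g"
proof (rule lam_cancel_right)
  show "lam (P y) \<cdot> (I (G (P y)) \<otimes>\<^sub>a f) = lam (P y) \<cdot> (I (G (P y)) \<otimes>\<^sub>a g)"
  proof (rule iso_cancel_right)
    show "(lam (P y) \<cdot> (I (G (P y)) \<otimes>\<^sub>a f)) \<cdot> (dp C y \<otimes>\<^sub>a I (src f)) =
      (lam (P y) \<cdot> (I (G (P y)) \<otimes>\<^sub>a g)) \<cdot> (dp C y \<otimes>\<^sub>a I (src f))"
      using assms by (simp add: rho_def)
  qed (use assms in simp_all)
qed (use assms in simp_all)

lemma rho_dinat:
  assumes "arr g" "src g = y" "trg g = y'"
  shows "rho y' \<cdot> (g \<otimes>\<^sub>a I (P y')) = rho y \<cdot> (I y \<otimes>\<^sub>a Pa g)"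
proof -
  have ob: "y \<in> Ob C" "y' \<in> Ob C" using assms by auto
  have "rho y' \<cdot> (g \<otimes>\<^sub>a I (P y')) = lam (P y') \<cdot> ((dp C y' \<cdot> g) \<otimes>\<^sub>a I (P y'))"
    using assms ob by (simp add: rho_def)
  also have "\<dots> = (lam (P y') \<cdot> (Ga (Pa g) \<otimes>\<^sub>a I (P y'))) \<cdot> (dp C y \<otimes>\<^sub>a I (P y'))"
    using assms ob by (simp add: dp_nat)
  also have "\<dots> = (lam (P y) \<cdot> (I (G (P y)) \<otimes>\<^sub>a Pa g)) \<cdot> (dp C y \<otimes>\<^sub>a I (P y'))"
    by (subst lam_dinat[of "Pa g" "P y'" "P y"]) (use assms ob in simp_all)
  also have "\<dots> = rho y \<cdot> (I y \<otimes>\<^sub>a Pa g)"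
    using assms ob by (simp add: rho_def)
  finally show ?thesis .
qed

text \<open>The object \<open>G x\<close> is paired with \<open>x\<close> by \<open>lam\<close> and
  with \<open>P (G x)\<close> by \<open>rho\<close>. The normalisation \<open>triangle_F\<close> is
  what makes the two pairings agree along \<open>pd\<close>.\<close>

lemma rho_G:
  assumes "x \<in> Ob C"
  shows "rho (G x) \<cdot> (I (G x) \<otimes>\<^sub>a pd C x) = lam x"
proof -
  have "rho (G x) \<cdot> (I (G x) \<otimes>\<^sub>a pd C x) = (lam (P (G x)) \<cdot> (I (G (P (G x))) \<otimes>\<^sub>a pd C x)) \<cdot> (dp C (G x) \<otimes>\<^sub>a I x)"
    using assms by (simp add: rho_def)
  also have "\<dots> = (lam x \<cdot> (Ga (pd C x) \<otimes>\<^sub>a I x)) \<cdot> (dp C (G x) \<otimes>\<^sub>a I x)"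
    by (subst lam_dinat[of "pd C x" x "P (G x)"]) (use assms in simp_all)
  also have "\<dots> = lam x" using assms by (simp add: triangle_F)
  finally show ?thesis .
qed

text \<open>Transposes in the second factor exist: \<open>rep C x y t\<close> goes to
  \<open>G y\<close>, so \<open>Pa\<close> of it goes from \<open>P (G y)\<close> to
  \<open>P x\<close>, and \<open>pd\<close> replaces its source by \<open>y\<close>. That it induces
  \<open>t\<close> again is \<open>rho_dinat\<close> followed by \<open>rho_G\<close>.\<close>

lemma rho_transpose:
  assumes "x \<in> Ob C" "y \<in> Ob C" "arr t" "src t = x \<otimes>\<^sub>o y" "trg t = K"
  shows "rho x \<cdot> (I x \<otimes>\<^sub>a (Pa (rep C x y t) \<cdot> pd C y)) = t"
proof -
  have "rho x \<cdot> (I x \<otimes>\<^sub>a (Pa (rep C x y t) \<cdot> pd C y))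
      = (rho x \<cdot> (I x \<otimes>\<^sub>a Pa (rep C x y t))) \<cdot> (I x \<otimes>\<^sub>a pd C y)"
    using assms by simp
  also have "\<dots> = (rho (G y) \<cdot> (rep C x y t \<otimes>\<^sub>a I (P (G y)))) \<cdot> (I x \<otimes>\<^sub>a pd C y)"
    by (subst rho_dinat[of _ x "G y"]) (use assms in simp_all)
  also have "\<dots> = (rho (G y) \<cdot> (I (G y) \<otimes>\<^sub>a pd C y)) \<cdot> (rep C x y t \<otimes>\<^sub>a I y)"
    using assms by simp
  also have "\<dots> = t" using assms by (simp only: rho_G lam_rep)
  finally show ?thesis .
qed

text \<open>The morphism \<open>x \<rightarrow> z\<close> that induces a given pairing
  \<open>t : G z \<otimes> x \<rightarrow> K\<close> along \<open>lam\<close>. It is the transpose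
  \<open>x \<rightarrow> P (G z)\<close> along \<open>rho\<close>, brought back to \<open>z\<close>
  by the inverse of \<open>pd\<close>; by \<open>lam_cancel_right\<close> no other morphism induces
  \<open>t\<close>.\<close>

definition lam_transpose :: "'o \<Rightarrow> 'o \<Rightarrow> 'm \<Rightarrow> 'm" where
  "lam_transpose z x t = cinv C (pd C z) \<cdot> Pa (rep C (G z) x t) \<cdot> pd C x"

lemma lam_transpose:
  assumes "z \<in> Ob C" "x \<in> Ob C" "arr t" "src t = G z \<otimes>\<^sub>o x" "trg t = K"
  shows "arr (lam_transpose z x t)" "src (lam_transpose z x t) = x" "trg (lam_transpose z x t) = z"
    and "lam z \<cdot> (I (G z) \<otimes>\<^sub>a lam_transpose z x t) = t"
proof -
  show ty: "arr (lam_transpose z x t)" "src (lam_transpose z x t) = x" "trg (lam_transpose z x t) = z"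
    using assms by (simp_all add: lam_transpose_def)
  have "lam z \<cdot> (I (G z) \<otimes>\<^sub>a lam_transpose z x t)
      = (rho (G z) \<cdot> (I (G z) \<otimes>\<^sub>a pd C z)) \<cdot> (I (G z) \<otimes>\<^sub>a lam_transpose z x t)"
    using assms(1) by (simp only: rho_G)
  also have "\<dots> = rho (G z) \<cdot> (I (G z) \<otimes>\<^sub>a (Pa (rep C (G z) x t) \<cdot> pd C x))"
    using assms ty by simp (simp add: lam_transpose_def)
  also have "\<dots> = t" by (rule rho_transpose) (use assms in simp_all)
  finally show "lam z \<cdot> (I (G z) \<otimes>\<^sub>a lam_transpose z x t) = t" .
qed

section \<open>The two evaluations, their universal property and their naturality\<close>

lemma bobj_Ob [simp]: "\<lbrakk>x \<in> Ob C; y \<in> Ob C\<rbrakk> \<Longrightarrow> x \<bullet>\<^sub>o y \<in> Ob C"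
  by (simp add: bobj_def)

lemma barr_typing [simp]:
  assumes "arr f" "arr g"
  shows "arr (f \<bullet>\<^sub>a g)" "src (f \<bullet>\<^sub>a g) = src f \<bullet>\<^sub>o src g" "trg (f \<bullet>\<^sub>a g) = trg f \<bullet>\<^sub>o trg g"
  using assms by (simp_all add: barr_def bobj_def)

definition evl :: "'o \<Rightarrow> 'o \<Rightarrow> 'm" where
  "evl x y = lam_transpose y (G x \<otimes>\<^sub>o (x \<bullet>\<^sub>o y))
     (rho (G y \<otimes>\<^sub>o G x) \<cdot> \<alpha>' (G y) (G x) (x \<bullet>\<^sub>o y))"

definition evr :: "'o \<Rightarrow> 'o \<Rightarrow> 'm" where
  "evr x y = lam_transpose x ((x \<bullet>\<^sub>o y) \<otimes>\<^sub>o P y)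
     (rho y \<cdot> (evl x y \<otimes>\<^sub>a I (P y)) \<cdot> \<alpha>' (G x) (x \<bullet>\<^sub>o y) (P y))"

lemma evl_typing [simp]:
  assumes "x \<in> Ob C" "y \<in> Ob C"
  shows "arr (evl x y)" "src (evl x y) = G x \<otimes>\<^sub>o (x \<bullet>\<^sub>o y)" "trg (evl x y) = y"
  unfolding evl_def by (subst lam_transpose; use assms in \<open>simp add: bobj_def\<close>)+

lemma lam_evl:
  assumes "x \<in> Ob C" "y \<in> Ob C"
  shows "lam y \<cdot> (I (G y) \<otimes>\<^sub>a evl x y) = rho (G y \<otimes>\<^sub>o G x) \<cdot> \<alpha>' (G y) (G x) (x \<bullet>\<^sub>o y)"
  unfolding evl_def by (rule lam_transpose) (use assms in \<open>simp_all add: bobj_def\<close>)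

lemma evr_typing [simp]:
  assumes "x \<in> Ob C" "y \<in> Ob C"
  shows "arr (evr x y)" "src (evr x y) = (x \<bullet>\<^sub>o y) \<otimes>\<^sub>o P y" "trg (evr x y) = x"
  unfolding evr_def by (subst lam_transpose; use assms in simp)+

lemma lam_evr:
  assumes "x \<in> Ob C" "y \<in> Ob C"
  shows "lam x \<cdot> (I (G x) \<otimes>\<^sub>a evr x y) = rho y \<cdot> (evl x y \<otimes>\<^sub>a I (P y)) \<cdot> \<alpha>' (G x) (x \<bullet>\<^sub>o y) (P y)"
  unfolding evr_def by (rule lam_transpose) (use assms in simp_all)

text \<open>Pairing \<open>evl x y \<cdot> (I (G x) \<otimes>\<^sub>a h)\<close> with
  \<open>G y\<close> returns, up to an associator, the composite of \<open>h\<close> with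
  \<open>rho (G y \<otimes>\<^sub>o G x)\<close>, and this composite determines
  \<open>h\<close>.\<close>

lemma evl_cancel:
  assumes "evl x y \<cdot> (I (G x) \<otimes>\<^sub>a f) = evl x y \<cdot> (I (G x) \<otimes>\<^sub>a g)"
    and "arr f" "arr g" "src f = src g" "trg f = x \<bullet>\<^sub>o y" "trg g = x \<bullet>\<^sub>o y" "x \<in> Ob C" "y \<in> Ob C"
  shows "f = g"
proof -
  have *: "(rho (G y \<otimes>\<^sub>o G x) \<cdot> (I (G y \<otimes>\<^sub>o G x) \<otimes>\<^sub>a h)) \<cdot> \<alpha>' (G y) (G x) (src h)
     = lam y \<cdot> (I (G y) \<otimes>\<^sub>a (evl x y \<cdot> (I (G x) \<otimes>\<^sub>a h)))" if h: "arr h" "trg h = x \<bullet>\<^sub>o y" for h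
  proof -
    have "lam y \<cdot> (I (G y) \<otimes>\<^sub>a (evl x y \<cdot> (I (G x) \<otimes>\<^sub>a h)))
      = (lam y \<cdot> (I (G y) \<otimes>\<^sub>a evl x y)) \<cdot> (I (G y) \<otimes>\<^sub>a (I (G x) \<otimes>\<^sub>a h))"
      using assms(7-) h by simp
    also have "\<dots> = (rho (G y \<otimes>\<^sub>o G x) \<cdot> \<alpha>' (G y) (G x) (x \<bullet>\<^sub>o y)) \<cdot> (I (G y) \<otimes>\<^sub>a (I (G x) \<otimes>\<^sub>a h))"
      using assms(7-) by (simp only: lam_evl)
    also have "\<dots> = (rho (G y \<otimes>\<^sub>o G x) \<cdot> (I (G y \<otimes>\<^sub>o G x) \<otimes>\<^sub>a h)) \<cdot> \<alpha>' (G y) (G x) (src h)"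
      using assms(7-) h by (simp add: assoc_slide flip: bobj_def)
    finally show ?thesis by (rule sym)
  qed
  have "rho (G y \<otimes>\<^sub>o G x) \<cdot> (I (G y \<otimes>\<^sub>o G x) \<otimes>\<^sub>a f) = rho (G y \<otimes>\<^sub>o G x) \<cdot> (I (G y \<otimes>\<^sub>o G x) \<otimes>\<^sub>a g)"
  proof (rule iso_cancel_right)
    show "(rho (G y \<otimes>\<^sub>o G x) \<cdot> (I (G y \<otimes>\<^sub>o G x) \<otimes>\<^sub>a f)) \<cdot> \<alpha>' (G y) (G x) (src f)
      = (rho (G y \<otimes>\<^sub>o G x) \<cdot> (I (G y \<otimes>\<^sub>o G x) \<otimes>\<^sub>a g)) \<cdot> \<alpha>' (G y) (G x) (src f)"
      using *[of f] *[of g] assms(1-6) by metis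
  qed (use assms(2-) in \<open>simp_all add: bobj_def\<close>)
  then show ?thesis
    by (rule rho_cancel_right) (use assms(2-) in \<open>simp_all add: bobj_def\<close>)
qed

text \<open>The threefold pairing transfers the claim to \<open>evl_cancel\<close>: paired with
  \<open>G x\<close>, the hypothesis becomes an equation under \<open>rho y\<close>, from which
  \<open>P y\<close> is cancelled.\<close>

lemma evr_cancel:
  assumes "evr x y \<cdot> (f \<otimes>\<^sub>a I (P y)) = evr x y \<cdot> (g \<otimes>\<^sub>a I (P y))"
    and "arr f" "arr g" "src f = src g" "trg f = x \<bullet>\<^sub>o y" "trg g = x \<bullet>\<^sub>o y" "x \<in> Ob C" "y \<in> Ob C"
  shows "f = g"
proof -
  have *: "(rho y \<cdot> ((evl x y \<cdot> (I (G x) \<otimes>\<^sub>a h)) \<otimes>\<^sub>a I (P y))) \<cdot> \<alpha>' (G x) (src h) (P y)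
     = lam x \<cdot> (I (G x) \<otimes>\<^sub>a (evr x y \<cdot> (h \<otimes>\<^sub>a I (P y))))" if h: "arr h" "trg h = x \<bullet>\<^sub>o y" for h
  proof -
    have "lam x \<cdot> (I (G x) \<otimes>\<^sub>a (evr x y \<cdot> (h \<otimes>\<^sub>a I (P y))))
      = (lam x \<cdot> (I (G x) \<otimes>\<^sub>a evr x y)) \<cdot> (I (G x) \<otimes>\<^sub>a (h \<otimes>\<^sub>a I (P y)))"
      using assms(7-) h by simp
    also have "\<dots> = (rho y \<cdot> (evl x y \<otimes>\<^sub>a I (P y)) \<cdot> \<alpha>' (G x) (x \<bullet>\<^sub>o y) (P y)) \<cdot> (I (G x) \<otimes>\<^sub>a (h \<otimes>\<^sub>a I (P y)))"
      using assms(7-) by (simp only: lam_evr)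
    also have "\<dots> = (rho y \<cdot> ((evl x y \<cdot> (I (G x) \<otimes>\<^sub>a h)) \<otimes>\<^sub>a I (P y))) \<cdot> \<alpha>' (G x) (src h) (P y)"
      using assms(7-) h by (simp add: assoc_slide)
    finally show ?thesis by (rule sym)
  qed
  have "rho y \<cdot> ((evl x y \<cdot> (I (G x) \<otimes>\<^sub>a f)) \<otimes>\<^sub>a I (P y)) = rho y \<cdot> ((evl x y \<cdot> (I (G x) \<otimes>\<^sub>a g)) \<otimes>\<^sub>a I (P y))"
  proof (rule iso_cancel_right)
    show "(rho y \<cdot> ((evl x y \<cdot> (I (G x) \<otimes>\<^sub>a f)) \<otimes>\<^sub>a I (P y))) \<cdot> \<alpha>' (G x) (src f) (P y)
      = (rho y \<cdot> ((evl x y \<cdot> (I (G x) \<otimes>\<^sub>a g)) \<otimes>\<^sub>a I (P y))) \<cdot> \<alpha>' (G x) (src f) (P y)"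
      using *[of f] *[of g] assms(1-6) by metis
  qed (use assms(2-) in simp_all)
  then have "evl x y \<cdot> (I (G x) \<otimes>\<^sub>a f) = evl x y \<cdot> (I (G x) \<otimes>\<^sub>a g)"
    by (rule rho_cancel_left) (use assms(2-) in simp_all)
  then show ?thesis
    by (rule evl_cancel) (use assms(2-) in simp_all)
qed

text \<open>By definition \<open>f \<bullet>\<^sub>a g\<close> is
  \<open>Pa (Ga g \<otimes>\<^sub>a Ga f)\<close>, so \<open>rho_dinat\<close> carries it to the
  dual side of the pairing. There \<open>lam_dinat\<close> turns \<open>Ga g\<close> into
  \<open>g\<close>, whereas \<open>Ga f\<close> remains in the source.\<close>

lemma evl_nat:
  assumes [simp]: "arr f" "src f = x" "trg f = x'" "arr g" "src g = y" "trg g = y'"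
  shows "evl x' y' \<cdot> (I (G x') \<otimes>\<^sub>a (f \<bullet>\<^sub>a g)) = g \<cdot> evl x y \<cdot> (Ga f \<otimes>\<^sub>a I (x \<bullet>\<^sub>o y))"
proof -
  have [simp]: "x \<in> Ob C" "x' \<in> Ob C" "y \<in> Ob C" "y' \<in> Ob C"
    using arr_Ob[of f] arr_Ob[of g] by simp_all
  have "lam y' \<cdot> (I (G y') \<otimes>\<^sub>a (evl x' y' \<cdot> (I (G x') \<otimes>\<^sub>a (f \<bullet>\<^sub>a g))))
     = (lam y' \<cdot> (I (G y') \<otimes>\<^sub>a evl x' y')) \<cdot> (I (G y') \<otimes>\<^sub>a (I (G x') \<otimes>\<^sub>a (f \<bullet>\<^sub>a g)))" by simp
  also have "\<dots> = (rho (G y' \<otimes>\<^sub>o G x') \<cdot> \<alpha>' (G y') (G x') (x' \<bullet>\<^sub>o y')) \<cdot> (I (G y') \<otimes>\<^sub>a (I (G x') \<otimes>\<^sub>a (f \<bullet>\<^sub>a g)))"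
    by (simp only: lam_evl \<open>x' \<in> Ob C\<close> \<open>y' \<in> Ob C\<close>)
  also have "\<dots> = (rho (G y' \<otimes>\<^sub>o G x') \<cdot> (I (G y' \<otimes>\<^sub>o G x') \<otimes>\<^sub>a Pa (Ga g \<otimes>\<^sub>a Ga f))) \<cdot> \<alpha>' (G y') (G x') (x \<bullet>\<^sub>o y)"
    by (simp add: assoc_slide bobj_def barr_def)
  also have "\<dots> = (rho (G y \<otimes>\<^sub>o G x) \<cdot> ((Ga g \<otimes>\<^sub>a Ga f) \<otimes>\<^sub>a I (x \<bullet>\<^sub>o y))) \<cdot> \<alpha>' (G y') (G x') (x \<bullet>\<^sub>o y)"
    by (subst rho_dinat[symmetric, of _ _ "G y \<otimes>\<^sub>o G x"]) (simp_all add: bobj_def)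
  also have "\<dots> = (rho (G y \<otimes>\<^sub>o G x) \<cdot> \<alpha>' (G y) (G x) (x \<bullet>\<^sub>o y)) \<cdot> (Ga g \<otimes>\<^sub>a (Ga f \<otimes>\<^sub>a I (x \<bullet>\<^sub>o y)))"
    by (simp add: assoc_slide bobj_def)
  also have "\<dots> = (lam y \<cdot> (I (G y) \<otimes>\<^sub>a evl x y)) \<cdot> (Ga g \<otimes>\<^sub>a (Ga f \<otimes>\<^sub>a I (x \<bullet>\<^sub>o y)))"
    by (simp only: lam_evl \<open>x \<in> Ob C\<close> \<open>y \<in> Ob C\<close>)
  also have "\<dots> = (lam y \<cdot> (Ga g \<otimes>\<^sub>a I y)) \<cdot> (I (G y') \<otimes>\<^sub>a (evl x y \<cdot> (Ga f \<otimes>\<^sub>a I (x \<bullet>\<^sub>o y))))"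
    by simp
  also have "\<dots> = (lam y' \<cdot> (I (G y') \<otimes>\<^sub>a g)) \<cdot> (I (G y') \<otimes>\<^sub>a (evl x y \<cdot> (Ga f \<otimes>\<^sub>a I (x \<bullet>\<^sub>o y))))"
    by (simp only: lam_dinat assms)
  also have "\<dots> = lam y' \<cdot> (I (G y') \<otimes>\<^sub>a (g \<cdot> evl x y \<cdot> (Ga f \<otimes>\<^sub>a I (x \<bullet>\<^sub>o y))))" by simp
  finally show ?thesis by (rule lam_cancel_right) simp_all
qed

lemma evr_nat:
  assumes [simp]: "arr f" "src f = x" "trg f = x'" "arr g" "src g = y" "trg g = y'"
  shows "evr x' y' \<cdot> ((f \<bullet>\<^sub>a g) \<otimes>\<^sub>a I (P y')) = f \<cdot> evr x y \<cdot> (I (x \<bullet>\<^sub>o y) \<otimes>\<^sub>a Pa g)"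
proof -
  have ob [simp]: "x \<in> Ob C" "x' \<in> Ob C" "y \<in> Ob C" "y' \<in> Ob C"
    using arr_Ob[of f] arr_Ob[of g] by simp_all
  have "lam x' \<cdot> (I (G x') \<otimes>\<^sub>a (evr x' y' \<cdot> ((f \<bullet>\<^sub>a g) \<otimes>\<^sub>a I (P y'))))
     = (lam x' \<cdot> (I (G x') \<otimes>\<^sub>a evr x' y')) \<cdot> (I (G x') \<otimes>\<^sub>a ((f \<bullet>\<^sub>a g) \<otimes>\<^sub>a I (P y')))" by simp
  also have "\<dots> = (rho y' \<cdot> (evl x' y' \<otimes>\<^sub>a I (P y')) \<cdot> \<alpha>' (G x') (x' \<bullet>\<^sub>o y') (P y')) \<cdot>
      (I (G x') \<otimes>\<^sub>a ((f \<bullet>\<^sub>a g) \<otimes>\<^sub>a I (P y')))"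
    by (simp only: lam_evr ob)
  also have "\<dots> = (rho y' \<cdot> ((evl x' y' \<cdot> (I (G x') \<otimes>\<^sub>a (f \<bullet>\<^sub>a g))) \<otimes>\<^sub>a I (P y'))) \<cdot> \<alpha>' (G x') (x \<bullet>\<^sub>o y) (P y')"
    by (simp add: assoc_slide)
  also have "\<dots> = (rho y' \<cdot> ((g \<cdot> evl x y \<cdot> (Ga f \<otimes>\<^sub>a I (x \<bullet>\<^sub>o y))) \<otimes>\<^sub>a I (P y'))) \<cdot> \<alpha>' (G x') (x \<bullet>\<^sub>o y) (P y')"
    by (simp only: evl_nat assms)
  also have "\<dots> = (rho y' \<cdot> (g \<otimes>\<^sub>a I (P y'))) \<cdot> ((evl x y \<cdot> (Ga f \<otimes>\<^sub>a I (x \<bullet>\<^sub>o y))) \<otimes>\<^sub>a I (P y')) \<cdot> \<alpha>' (G x') (x \<bullet>\<^sub>o y) (P y')"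
    by simp
  also have "\<dots> = (rho y \<cdot> (I y \<otimes>\<^sub>a Pa g)) \<cdot> ((evl x y \<cdot> (Ga f \<otimes>\<^sub>a I (x \<bullet>\<^sub>o y))) \<otimes>\<^sub>a I (P y')) \<cdot> \<alpha>' (G x') (x \<bullet>\<^sub>o y) (P y')"
    by (simp only: rho_dinat assms)
  also have "\<dots> = (rho y \<cdot> (evl x y \<otimes>\<^sub>a I (P y)) \<cdot> \<alpha>' (G x) (x \<bullet>\<^sub>o y) (P y)) \<cdot> (Ga f \<otimes>\<^sub>a (I (x \<bullet>\<^sub>o y) \<otimes>\<^sub>a Pa g))"
    by (simp add: assoc_slide)
  also have "\<dots> = (lam x \<cdot> (I (G x) \<otimes>\<^sub>a evr x y)) \<cdot> (Ga f \<otimes>\<^sub>a (I (x \<bullet>\<^sub>o y) \<otimes>\<^sub>a Pa g))"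
    by (simp only: lam_evr ob)
  also have "\<dots> = (lam x \<cdot> (Ga f \<otimes>\<^sub>a I x)) \<cdot> (I (G x') \<otimes>\<^sub>a (evr x y \<cdot> (I (x \<bullet>\<^sub>o y) \<otimes>\<^sub>a Pa g)))" by simp
  also have "\<dots> = (lam x' \<cdot> (I (G x') \<otimes>\<^sub>a f)) \<cdot> (I (G x') \<otimes>\<^sub>a (evr x y \<cdot> (I (x \<bullet>\<^sub>o y) \<otimes>\<^sub>a Pa g)))"
    by (simp only: lam_dinat assms)
  also have "\<dots> = lam x' \<cdot> (I (G x') \<otimes>\<^sub>a (f \<cdot> evr x y \<cdot> (I (x \<bullet>\<^sub>o y) \<otimes>\<^sub>a Pa g)))" by simp
  finally show ?thesis by (rule lam_cancel_right) simp_all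
qed

lemma evl_barr_id:
  assumes [simp]: "arr g" "trg g = y" "w \<in> Ob C"
  shows "evl w y \<cdot> (I (G w) \<otimes>\<^sub>a (I w \<bullet>\<^sub>a g)) = g \<cdot> evl w (src g)"
proof -
  have [simp]: "y \<in> Ob C" using arr_Ob[of g] by simp
  show ?thesis by (subst evl_nat[of "I w" w w g "src g" y]) simp_all
qed

lemma evr_barr_id:
  assumes [simp]: "arr f" "trg f = x" "z \<in> Ob C"
  shows "evr x z \<cdot> ((f \<bullet>\<^sub>a I z) \<otimes>\<^sub>a I (P z)) = f \<cdot> evr (src f) z"
proof -
  have [simp]: "x \<in> Ob C" using arr_Ob[of f] by simp
  show ?thesis by (subst evr_nat[of f "src f" x "I z" z z]) simp_all
qed

end

section \<open>The canonical identification and the internal Hom\<close>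

context gv_category
begin

text \<open>Every pairing on \<open>x \<otimes> y\<close> has the form on the left, with
  \<open>g\<close> its \<open>rep\<close>. This therefore describes \<open>rotate_K\<close>
  completely: \<open>g\<close> stays, and its target \<open>G y\<close> is paired with
  \<open>G (G y)\<close> from the left instead of with \<open>y\<close> from the right.\<close>

lemma rotate_lam:
  assumes "y \<in> Ob C" "arr g" "src g = x" "trg g = G y"
  shows "rotate_K C x y (lam y \<cdot> (g \<otimes>\<^sub>a I y)) = lam (G y) \<cdot> (I (G (G y)) \<otimes>\<^sub>a g)"
  using assms arr_Ob(1)[of g]
  by (simp add: rotate_K_def rep_lam_cmp rep_inv_eq lam_dinat[of g x "G y"])

lemma rotate_nat:
  assumes "arr h" "src h = u" "trg h = x" "y \<in> Ob C" "arr f" "src f = x \<otimes>\<^sub>o y" "trg f = K"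
  shows "rotate_K C u y (f \<cdot> (h \<otimes>\<^sub>a I y)) = rotate_K C x y f \<cdot> (I (G (G y)) \<otimes>\<^sub>a h)"
proof -
  have ob: "u \<in> Ob C" "x \<in> Ob C" using assms by auto
  let ?g = "rep C x y f"
  have f: "f = lam y \<cdot> (?g \<otimes>\<^sub>a I y)" using lam_rep[of x y f] ob assms by simp
  have "rotate_K C u y (f \<cdot> (h \<otimes>\<^sub>a I y)) = rotate_K C u y (lam y \<cdot> ((?g \<cdot> h) \<otimes>\<^sub>a I y))"
    by (subst f) (use ob assms in simp)
  also have "\<dots> = (lam (G y) \<cdot> (I (G (G y)) \<otimes>\<^sub>a ?g)) \<cdot> (I (G (G y)) \<otimes>\<^sub>a h)"
    by (subst rotate_lam) (use ob assms in simp_all)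
  also have "lam (G y) \<cdot> (I (G (G y)) \<otimes>\<^sub>a ?g) = rotate_K C x y (lam y \<cdot> (?g \<otimes>\<^sub>a I y))"
    by (subst rotate_lam) (use ob assms in simp_all)
  finally show ?thesis by (simp only: flip: f)
qed

lemma rotate_typing [simp]:
  assumes "x \<in> Ob C" "y \<in> Ob C" "arr f" "src f = x \<otimes>\<^sub>o y" "trg f = K"
  shows "arr (rotate_K C x y f)" "src (rotate_K C x y f) = G (G y) \<otimes>\<^sub>o x" "trg (rotate_K C x y f) = K"
  using assms by (simp_all add: rotate_K_def rep_inv_eq)

text \<open>Once \<open>G (G (P z))\<close> is identified with \<open>G z\<close> through
  \<open>dp\<close>, a rotation exchanges the two pairings of \<open>z\<close>: \<open>rho z\<close>
  against \<open>P z\<close> becomes \<open>lam z\<close> against \<open>G z\<close>.\<close>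

lemma rotate_rho:
  assumes "arr h" "src h = x" "trg h = z"
  shows "rotate_K C x (P z) (rho z \<cdot> (h \<otimes>\<^sub>a I (P z))) \<cdot> (Ga (cinv C (dp C z)) \<otimes>\<^sub>a I x)
    = lam z \<cdot> (I (G z) \<otimes>\<^sub>a h)"
proof -
  have ob: "x \<in> Ob C" "z \<in> Ob C" using assms by auto
  have "rotate_K C x (P z) (rho z \<cdot> (h \<otimes>\<^sub>a I (P z))) = rotate_K C x (P z) (lam (P z) \<cdot> ((dp C z \<cdot> h) \<otimes>\<^sub>a I (P z)))"
    using assms ob by (simp add: rho_def)
  also have "\<dots> = lam (G (P z)) \<cdot> (I (G (G (P z))) \<otimes>\<^sub>a (dp C z \<cdot> h))"
    by (rule rotate_lam) (use assms ob in simp_all)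
  finally have "rotate_K C x (P z) (rho z \<cdot> (h \<otimes>\<^sub>a I (P z))) \<cdot> (Ga (cinv C (dp C z)) \<otimes>\<^sub>a I x)
    = (lam (G (P z)) \<cdot> (Ga (cinv C (dp C z)) \<otimes>\<^sub>a I (G (P z)))) \<cdot> (I (G z) \<otimes>\<^sub>a (dp C z \<cdot> h))"
    using assms ob by simp
  also have "\<dots> = (lam z \<cdot> (I (G z) \<otimes>\<^sub>a cinv C (dp C z))) \<cdot> (I (G z) \<otimes>\<^sub>a (dp C z \<cdot> h))"
    by (subst lam_dinat[of _ _ z]) (use ob in simp_all)
  also have "\<dots> = lam z \<cdot> (I (G z) \<otimes>\<^sub>a h)" using assms ob by simp
  finally show ?thesis .
qed

text \<open>The right-hand side of the property that defines \<open>double_dual_mult\<close>,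
  isolated as an operation on pairings: \<open>y\<close> and then \<open>x\<close> is carried to the
  front.\<close>

definition rotate_twice :: "'o \<Rightarrow> 'o \<Rightarrow> 'o \<Rightarrow> 'm \<Rightarrow> 'm" where
  "rotate_twice w x y f =
     rotate_K C (G (G y) \<otimes>\<^sub>o w) x (rotate_K C (w \<otimes>\<^sub>o x) y (f \<cdot> \<alpha> w x y) \<cdot> \<alpha> (G (G y)) w x) \<cdot>
     \<alpha> (G (G x)) (G (G y)) w"

lemma rotate_twice_typing [simp]:
  assumes "w \<in> Ob C" "x \<in> Ob C" "y \<in> Ob C" "arr f" "src f = w \<otimes>\<^sub>o (x \<otimes>\<^sub>o y)" "trg f = K"
  shows "arr (rotate_twice w x y f)" "src (rotate_twice w x y f) = (G (G x) \<otimes>\<^sub>o G (G y)) \<otimes>\<^sub>o w"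
    "trg (rotate_twice w x y f) = K"
  using assms by (simp_all add: rotate_twice_def)

text \<open>Naturality in \<open>w\<close> is what Yoneda requires: it determines
  \<open>rotate_twice\<close> by its value on the universal pairing
  \<open>lam (x \<otimes>\<^sub>o y)\<close>.\<close>

lemma rotate_twice_nat:
  assumes [simp]: "arr h" "src h = u" "trg h = w" "x \<in> Ob C" "y \<in> Ob C"
    "arr f" "src f = w \<otimes>\<^sub>o (x \<otimes>\<^sub>o y)" "trg f = K"
  shows "rotate_twice u x y (f \<cdot> (h \<otimes>\<^sub>a I (x \<otimes>\<^sub>o y)))
    = rotate_twice w x y f \<cdot> (I (G (G x) \<otimes>\<^sub>o G (G y)) \<otimes>\<^sub>a h)"
proof -
  have ob [simp]: "u \<in> Ob C" "w \<in> Ob C" using arr_Ob[of h] by simp_all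
  let ?r = "rotate_K C (w \<otimes>\<^sub>o x) y (f \<cdot> \<alpha> w x y)"
  have "rotate_K C (u \<otimes>\<^sub>o x) y ((f \<cdot> (h \<otimes>\<^sub>a I (x \<otimes>\<^sub>o y))) \<cdot> \<alpha> u x y)
    = rotate_K C (u \<otimes>\<^sub>o x) y ((f \<cdot> \<alpha> w x y) \<cdot> ((h \<otimes>\<^sub>a I x) \<otimes>\<^sub>a I y))"
    by (simp add: assoc_slide)
  also have "\<dots> = ?r \<cdot> (I (G (G y)) \<otimes>\<^sub>a (h \<otimes>\<^sub>a I x))"
    by (rule rotate_nat) simp_all
  finally have 1: "rotate_K C (u \<otimes>\<^sub>o x) y ((f \<cdot> (h \<otimes>\<^sub>a I (x \<otimes>\<^sub>o y))) \<cdot> \<alpha> u x y) = \<dots>" .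
  have "rotate_K C (G (G y) \<otimes>\<^sub>o u) x ((?r \<cdot> (I (G (G y)) \<otimes>\<^sub>a (h \<otimes>\<^sub>a I x))) \<cdot> \<alpha> (G (G y)) u x)
    = rotate_K C (G (G y) \<otimes>\<^sub>o u) x ((?r \<cdot> \<alpha> (G (G y)) w x) \<cdot> ((I (G (G y)) \<otimes>\<^sub>a h) \<otimes>\<^sub>a I x))"
    by (simp add: assoc_slide)
  also have "\<dots> = rotate_K C (G (G y) \<otimes>\<^sub>o w) x (?r \<cdot> \<alpha> (G (G y)) w x) \<cdot> (I (G (G x)) \<otimes>\<^sub>a (I (G (G y)) \<otimes>\<^sub>a h))"
    by (rule rotate_nat) simp_all
  finally show ?thesis
    unfolding rotate_twice_def 1 by (simp add: assoc_slide)
qed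

text \<open>Yoneda with the universal instance \<open>w = G (x \<otimes>\<^sub>o y)\<close> and
  \<open>f = lam (x \<otimes>\<^sub>o y)\<close>. Representability supplies a solution of this one
  instance, naturality extends it to all \<open>w\<close> and \<open>f\<close>, and the one instance
  already forces uniqueness, so the definite description is meaningful.\<close>

lemma double_dual_mult:
  assumes [simp]: "x \<in> Ob C" "y \<in> Ob C"
  defines "m \<equiv> double_dual_mult C x y"
  shows "arr m" "src m = G (G x) \<otimes>\<^sub>o G (G y)" "trg m = G (G (x \<otimes>\<^sub>o y))"
    and "lam (G (x \<otimes>\<^sub>o y)) \<cdot> (m \<otimes>\<^sub>a I (G (x \<otimes>\<^sub>o y))) = rotate_twice (G (x \<otimes>\<^sub>o y)) x y (lam (x \<otimes>\<^sub>o y))"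
proof -
  let ?g = "G (x \<otimes>\<^sub>o y)"
  let ?Q = "\<lambda>m. \<forall>w\<in>Ob C. \<forall>f\<in>Hom C (w \<otimes>\<^sub>o (x \<otimes>\<^sub>o y)) K.
     rotate_K C w (x \<otimes>\<^sub>o y) f \<cdot> (m \<otimes>\<^sub>a I w) = rotate_twice w x y f"
  let ?D = "Hom C (G (G x) \<otimes>\<^sub>o G (G y)) (G ?g)"
  \<comment> \<open>The rotated universal pairing is again universal, now for \<open>?g\<close>;
    hence the defining property at this instance says exactly which pairing the multiplication is
    the transpose of.\<close>
  have rot: "rotate_K C ?g (x \<otimes>\<^sub>o y) (lam (x \<otimes>\<^sub>o y)) = lam ?g"
    using rotate_lam[of "x \<otimes>\<^sub>o y" "I ?g" ?g] by simp
  have char: "lam ?g \<cdot> (n \<otimes>\<^sub>a I ?g) = rotate_twice ?g x y (lam (x \<otimes>\<^sub>o y))" if "?Q n" for n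
  proof -
    have "lam (x \<otimes>\<^sub>o y) \<in> Hom C (?g \<otimes>\<^sub>o (x \<otimes>\<^sub>o y)) K" by (simp add: in_Hom_iff)
    with that have "rotate_K C ?g (x \<otimes>\<^sub>o y) (lam (x \<otimes>\<^sub>o y)) \<cdot> (n \<otimes>\<^sub>a I ?g) = rotate_twice ?g x y (lam (x \<otimes>\<^sub>o y))"
      using dual_objects(1)[OF objects(1)[OF assms(1,2)]] by blast
    then show ?thesis by (simp only: rot)
  qed
  define n where "n = rep C (G (G x) \<otimes>\<^sub>o G (G y)) ?g (rotate_twice ?g x y (lam (x \<otimes>\<^sub>o y)))"
  have n [simp]: "arr n" "src n = G (G x) \<otimes>\<^sub>o G (G y)" "trg n = G ?g"
    by (simp_all add: n_def)
  have lam_n: "lam ?g \<cdot> (n \<otimes>\<^sub>a I ?g) = rotate_twice ?g x y (lam (x \<otimes>\<^sub>o y))"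
    unfolding n_def by (rule lam_rep) simp_all
  have "?Q n"
  proof (intro ballI)
    fix w f assume w [simp]: "w \<in> Ob C" and "f \<in> Hom C (w \<otimes>\<^sub>o (x \<otimes>\<^sub>o y)) K"
    then have [simp]: "arr f" "src f = w \<otimes>\<^sub>o (x \<otimes>\<^sub>o y)" "trg f = K" by (simp_all add: in_Hom_iff)
    let ?h = "rep C w (x \<otimes>\<^sub>o y) f"
    \<comment> \<open>Any \<open>f\<close> is the universal pairing pulled back along its
      \<open>rep\<close>, so both sides of the property can be computed from the universal
      instance.\<close>
    have f: "lam (x \<otimes>\<^sub>o y) \<cdot> (?h \<otimes>\<^sub>a I (x \<otimes>\<^sub>o y)) = f" by (rule lam_rep) simp_all
    have "rotate_K C w (x \<otimes>\<^sub>o y) (lam (x \<otimes>\<^sub>o y) \<cdot> (?h \<otimes>\<^sub>a I (x \<otimes>\<^sub>o y))) \<cdot> (n \<otimes>\<^sub>a I w)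
        = (lam ?g \<cdot> (I (G ?g) \<otimes>\<^sub>a ?h)) \<cdot> (n \<otimes>\<^sub>a I w)"
      by (subst rotate_lam) simp_all
    also have "\<dots> = (lam ?g \<cdot> (n \<otimes>\<^sub>a I ?g)) \<cdot> (I (G (G x) \<otimes>\<^sub>o G (G y)) \<otimes>\<^sub>a ?h)" by simp
    also have "\<dots> = rotate_twice ?g x y (lam (x \<otimes>\<^sub>o y)) \<cdot> (I (G (G x) \<otimes>\<^sub>o G (G y)) \<otimes>\<^sub>a ?h)"
      by (simp only: lam_n)
    also have "\<dots> = rotate_twice w x y (lam (x \<otimes>\<^sub>o y) \<cdot> (?h \<otimes>\<^sub>a I (x \<otimes>\<^sub>o y)))"
      by (rule rotate_twice_nat[symmetric]) simp_all
    finally show "rotate_K C w (x \<otimes>\<^sub>o y) f \<cdot> (n \<otimes>\<^sub>a I w) = rotate_twice w x y f"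
      by (simp only: f)
  qed
  moreover have "n' = n" if "n' \<in> ?D" "?Q n'" for n'
  proof (rule lam_cancel_left)
    show "lam ?g \<cdot> (n' \<otimes>\<^sub>a I ?g) = lam ?g \<cdot> (n \<otimes>\<^sub>a I ?g)"
      by (simp only: char[OF that(2)] lam_n)
  qed (use that(1) in \<open>simp_all add: in_Hom_iff\<close>)
  moreover have "n \<in> ?D" by (simp add: in_Hom_iff)
  ultimately have "(THE m. m \<in> ?D \<and> ?Q m) = n" by (intro the_equality) blast+
  then have "m = n" by (simp add: m_def double_dual_mult_def rotate_twice_def Let_def)
  then show "arr m" "src m = G (G x) \<otimes>\<^sub>o G (G y)" "trg m = G ?g"
    "lam ?g \<cdot> (m \<otimes>\<^sub>a I ?g) = rotate_twice ?g x y (lam (x \<otimes>\<^sub>o y))"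
    using lam_n by simp_all
qed

section \<open>The identification of the two models of the product, and the internal Hom adjunction
  in terms of \<open>evr\<close>\<close>

lemma rho_transpose_left:
  assumes "u \<in> Ob C" "z \<in> Ob C" "arr t" "src t = u \<otimes>\<^sub>o P z" "trg t = K"
  obtains h where "arr h" "src h = u" "trg h = z" "rho z \<cdot> (h \<otimes>\<^sub>a I (P z)) = t"
proof
  let ?h = "cinv C (dp C z) \<cdot> rep C u (P z) t"
  show "arr ?h" "src ?h = u" "trg ?h = z" using assms by simp_all
  have "rho z \<cdot> (?h \<otimes>\<^sub>a I (P z)) = lam (P z) \<cdot> (rep C u (P z) t \<otimes>\<^sub>a I (P z))"
    using assms by (simp add: rho_def)
  then show "rho z \<cdot> (?h \<otimes>\<^sub>a I (P z)) = t" using assms by (simp only: lam_rep dual_objects)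
qed

lemma bobj_ident_typing [simp]:
  assumes "x \<in> Ob C" "y \<in> Ob C"
  shows "arr (bobj_ident C x y)" "src (bobj_ident C x y) = G (P y \<otimes>\<^sub>o P x)"
    "trg (bobj_ident C x y) = x \<bullet>\<^sub>o y"
  using assms double_dual_mult[of "P y" "P x"] by (simp_all add: bobj_ident_def bobj_def)

text \<open>\<^term>\<open>double_dual_mult\<close> turns the pairing \<open>(x \<bullet> y) \<otimes> (P y \<otimes> P x) \<rightarrow> K\<close> into the pairing
  \<open>(G y \<otimes> G x) \<otimes> (x \<bullet> y) \<rightarrow> K\<close> by two rotations, and \<^term>\<open>evl\<close> is the stage after the first.\<close>

lemma evr_bobj_ident:
  assumes [simp]: "x \<in> Ob C" "y \<in> Ob C"
  shows "rho x \<cdot> ((evr x y \<cdot> (bobj_ident C x y \<otimes>\<^sub>a I (P y))) \<otimes>\<^sub>a I (P x))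
    = lam (P y \<otimes>\<^sub>o P x) \<cdot> \<alpha> (G (P y \<otimes>\<^sub>o P x)) (P y) (P x)"
proof -
  let ?Q = "P y \<otimes>\<^sub>o P x" and ?W = "G y \<otimes>\<^sub>o G x" and ?B = "bobj_ident C x y"
  let ?m = "double_dual_mult C (P y) (P x)"
  let ?gx = "Ga (cinv C (dp C x))" and ?gy = "Ga (cinv C (dp C y))"
  note dd [simp] = double_dual_mult(1-3)[of "P y" "P x", simplified]
  note lam_dd = double_dual_mult(4)[of "P y" "P x", simplified]
  \<comment> \<open>This \<open>h\<close> is the expected value of
    \<open>evr x y \<cdot> (?B \<otimes>\<^sub>a I (P y))\<close>: the tautological pairing of
    \<open>G ?Q\<close> with \<open>?Q\<close>, with the last factor \<open>P x\<close> stripped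
    off.\<close>
  obtain h where h [simp]: "arr h" "src h = G ?Q \<otimes>\<^sub>o P y" "trg h = x"
    and rho_h: "rho x \<cdot> (h \<otimes>\<^sub>a I (P x)) = lam ?Q \<cdot> \<alpha> (G ?Q) (P y) (P x)"
    by (rule rho_transpose_left[of "G ?Q \<otimes>\<^sub>o P y" x "lam ?Q \<cdot> \<alpha> (G ?Q) (P y) (P x)"]) auto
  \<comment> \<open>Likewise \<open>k\<close> is the expected value of
    \<open>evl x y \<cdot> (I (G x) \<otimes>\<^sub>a ?B)\<close>. It is obtained from
    \<open>h\<close> by the same passage, through the threefold pairing, that connects
    \<open>evr\<close> with \<open>evl\<close>.\<close>
  obtain k where k [simp]: "arr k" "src k = G x \<otimes>\<^sub>o G ?Q" "trg k = y"
    and rho_k: "rho y \<cdot> (k \<otimes>\<^sub>a I (P y)) = (lam x \<cdot> (I (G x) \<otimes>\<^sub>a h)) \<cdot> \<alpha> (G x) (G ?Q) (P y)"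
    by (rule rho_transpose_left[of "G x \<otimes>\<^sub>o G ?Q" y "(lam x \<cdot> (I (G x) \<otimes>\<^sub>a h)) \<cdot> \<alpha> (G x) (G ?Q) (P y)"]) auto
  \<comment> \<open>The pairings after one and after two rotations, before the double duals of
    \<open>P x\<close> and \<open>P y\<close> are identified with \<open>G x\<close> and
    \<open>G y\<close>. By \<open>rotate_rho\<close> these identifications turn them into the
    pairings of \<open>h\<close> under \<open>lam x\<close> and of \<open>k\<close> under
    \<open>lam y\<close>.\<close>
  define r1 where "r1 = rotate_K C (G ?Q \<otimes>\<^sub>o P y) (P x) (rho x \<cdot> (h \<otimes>\<^sub>a I (P x)))"
  define r2 where "r2 = rotate_K C (G (G (P x)) \<otimes>\<^sub>o G ?Q) (P y) (r1 \<cdot> \<alpha> (G (G (P x))) (G ?Q) (P y))"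
  have r1 [simp]: "arr r1" "src r1 = G (G (P x)) \<otimes>\<^sub>o (G ?Q \<otimes>\<^sub>o P y)" "trg r1 = K"
    by (simp_all add: r1_def)
  have r2 [simp]: "arr r2" "src r2 = G (G (P y)) \<otimes>\<^sub>o (G (G (P x)) \<otimes>\<^sub>o G ?Q)" "trg r2 = K"
    by (simp_all add: r2_def)
  have r1_rot: "r1 \<cdot> (?gx \<otimes>\<^sub>a I (G ?Q \<otimes>\<^sub>o P y)) = lam x \<cdot> (I (G x) \<otimes>\<^sub>a h)"
    unfolding r1_def by (rule rotate_rho) simp_all
  have "r2 \<cdot> (I (G (G (P y))) \<otimes>\<^sub>a (?gx \<otimes>\<^sub>a I (G ?Q)))
    = rotate_K C (G x \<otimes>\<^sub>o G ?Q) (P y) ((r1 \<cdot> \<alpha> (G (G (P x))) (G ?Q) (P y)) \<cdot> ((?gx \<otimes>\<^sub>a I (G ?Q)) \<otimes>\<^sub>a I (P y)))"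
    unfolding r2_def by (rule rotate_nat[symmetric]) simp_all
  also have "(r1 \<cdot> \<alpha> (G (G (P x))) (G ?Q) (P y)) \<cdot> ((?gx \<otimes>\<^sub>a I (G ?Q)) \<otimes>\<^sub>a I (P y))
    = (r1 \<cdot> (?gx \<otimes>\<^sub>a I (G ?Q \<otimes>\<^sub>o P y))) \<cdot> \<alpha> (G x) (G ?Q) (P y)"
    by (simp add: assoc_slide)
  also have "\<dots> = rho y \<cdot> (k \<otimes>\<^sub>a I (P y))" by (simp only: r1_rot rho_k)
  finally have r2_rot: "r2 \<cdot> (I (G (G (P y))) \<otimes>\<^sub>a (?gx \<otimes>\<^sub>a I (G ?Q)))
    = rotate_K C (G x \<otimes>\<^sub>o G ?Q) (P y) (rho y \<cdot> (k \<otimes>\<^sub>a I (P y)))" .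
  have rt: "rotate_twice (G ?Q) (P y) (P x) (lam ?Q) = r2 \<cdot> \<alpha> (G (G (P y))) (G (G (P x))) (G ?Q)"
    by (simp add: rotate_twice_def r2_def r1_def rho_h)
  let ?mu = "?m \<cdot> (?gy \<otimes>\<^sub>a ?gx)"
  \<comment> \<open>Here \<open>rho_dinat\<close> turns \<open>Pa ?mu\<close> into
    \<open>?mu\<close> on the dual side and \<open>rho_G\<close> absorbs \<open>pd\<close>. What
    remains is \<open>lam (G ?Q)\<close> composed with the multiplication, to which its Yoneda
    characterisation applies.\<close>
  have "rho ?W \<cdot> (I ?W \<otimes>\<^sub>a ?B) = (rho ?W \<cdot> (I ?W \<otimes>\<^sub>a Pa ?mu)) \<cdot> (I ?W \<otimes>\<^sub>a pd C (G ?Q))"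
    by (simp add: bobj_ident_def)
  also have "\<dots> = (rho (G (G ?Q)) \<cdot> (?mu \<otimes>\<^sub>a I (P (G (G ?Q))))) \<cdot> (I ?W \<otimes>\<^sub>a pd C (G ?Q))"
    by (subst rho_dinat[of ?mu ?W "G (G ?Q)"]) simp_all
  also have "\<dots> = (rho (G (G ?Q)) \<cdot> (I (G (G ?Q)) \<otimes>\<^sub>a pd C (G ?Q))) \<cdot> (?mu \<otimes>\<^sub>a I (G ?Q))"
    by simp
  also have "\<dots> = lam (G ?Q) \<cdot> (?mu \<otimes>\<^sub>a I (G ?Q))"
    by (subst rho_G) simp_all
  also have "\<dots> = (lam (G ?Q) \<cdot> (?m \<otimes>\<^sub>a I (G ?Q))) \<cdot> ((?gy \<otimes>\<^sub>a ?gx) \<otimes>\<^sub>a I (G ?Q))" by simp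
  also have "\<dots> = (r2 \<cdot> \<alpha> (G (G (P y))) (G (G (P x))) (G ?Q)) \<cdot> ((?gy \<otimes>\<^sub>a ?gx) \<otimes>\<^sub>a I (G ?Q))"
    by (simp only: lam_dd rt)
  also have "\<dots> = ((r2 \<cdot> (I (G (G (P y))) \<otimes>\<^sub>a (?gx \<otimes>\<^sub>a I (G ?Q)))) \<cdot> (?gy \<otimes>\<^sub>a I (G x \<otimes>\<^sub>o G ?Q))) \<cdot> \<alpha> (G y) (G x) (G ?Q)"
    by (simp add: assoc_slide)
  also have "\<dots> = (lam y \<cdot> (I (G y) \<otimes>\<^sub>a k)) \<cdot> \<alpha> (G y) (G x) (G ?Q)"
    by (subst r2_rot, subst rotate_rho) simp_all
  finally have L: "rho ?W \<cdot> (I ?W \<otimes>\<^sub>a ?B) = (lam y \<cdot> (I (G y) \<otimes>\<^sub>a k)) \<cdot> \<alpha> (G y) (G x) (G ?Q)" .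
  have evl_B: "evl x y \<cdot> (I (G x) \<otimes>\<^sub>a ?B) = k"
  proof (rule lam_cancel_right)
    have "lam y \<cdot> (I (G y) \<otimes>\<^sub>a (evl x y \<cdot> (I (G x) \<otimes>\<^sub>a ?B)))
      = (lam y \<cdot> (I (G y) \<otimes>\<^sub>a evl x y)) \<cdot> (I (G y) \<otimes>\<^sub>a (I (G x) \<otimes>\<^sub>a ?B))" by simp
    also have "\<dots> = (rho ?W \<cdot> \<alpha>' (G y) (G x) (x \<bullet>\<^sub>o y)) \<cdot> (I (G y) \<otimes>\<^sub>a (I (G x) \<otimes>\<^sub>a ?B))"
      by (simp only: lam_evl assms)
    also have "\<dots> = (rho ?W \<cdot> (I ?W \<otimes>\<^sub>a ?B)) \<cdot> \<alpha>' (G y) (G x) (G ?Q)"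
      by (simp add: assoc_slide flip: bobj_def)
    also have "\<dots> = lam y \<cdot> (I (G y) \<otimes>\<^sub>a k)" unfolding L by simp
    finally show "lam y \<cdot> (I (G y) \<otimes>\<^sub>a (evl x y \<cdot> (I (G x) \<otimes>\<^sub>a ?B))) = lam y \<cdot> (I (G y) \<otimes>\<^sub>a k)" .
  qed simp_all
  \<comment> \<open>The defining relation between \<open>evr\<close> and \<open>evl\<close> has the
    same form as the one between \<open>h\<close> and \<open>k\<close>, so the value just found for
    \<open>evl\<close> forces this one.\<close>
  have "evr x y \<cdot> (?B \<otimes>\<^sub>a I (P y)) = h"
  proof (rule lam_cancel_right)
    have "lam x \<cdot> (I (G x) \<otimes>\<^sub>a (evr x y \<cdot> (?B \<otimes>\<^sub>a I (P y))))
      = (lam x \<cdot> (I (G x) \<otimes>\<^sub>a evr x y)) \<cdot> (I (G x) \<otimes>\<^sub>a (?B \<otimes>\<^sub>a I (P y)))" by simp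
    also have "\<dots> = (rho y \<cdot> (evl x y \<otimes>\<^sub>a I (P y)) \<cdot> \<alpha>' (G x) (x \<bullet>\<^sub>o y) (P y)) \<cdot> (I (G x) \<otimes>\<^sub>a (?B \<otimes>\<^sub>a I (P y)))"
      by (simp only: lam_evr assms)
    also have "\<dots> = (rho y \<cdot> ((evl x y \<cdot> (I (G x) \<otimes>\<^sub>a ?B)) \<otimes>\<^sub>a I (P y))) \<cdot> \<alpha>' (G x) (G ?Q) (P y)"
      by (simp add: assoc_slide)
    also have "\<dots> = ((lam x \<cdot> (I (G x) \<otimes>\<^sub>a h)) \<cdot> \<alpha> (G x) (G ?Q) (P y)) \<cdot> \<alpha>' (G x) (G ?Q) (P y)"
      by (simp only: evl_B rho_k)
    also have "\<dots> = lam x \<cdot> (I (G x) \<otimes>\<^sub>a h)" by simp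
    finally show "lam x \<cdot> (I (G x) \<otimes>\<^sub>a (evr x y \<cdot> (?B \<otimes>\<^sub>a I (P y)))) = lam x \<cdot> (I (G x) \<otimes>\<^sub>a h)" .
  qed simp_all
  then show ?thesis by (simp only: rho_h)
qed

text \<open>The long chain of bijections amounts to transposition along \<open>evr\<close>, with
  \<open>pd\<close> identifying \<open>x\<close> with \<open>P (G x)\<close>. With this,
  \<open>rep\<close>, \<open>rep_inv\<close> and \<open>bobj_ident\<close> disappear from the
  treatment of the distributors.\<close>

lemma ihom_adj:
  assumes [simp]: "c \<in> Ob C" "x \<in> Ob C" "y \<in> Ob C" "arr f" "src f = c \<otimes>\<^sub>o x" "trg f = y"
  defines "j \<equiv> ihom_adj C c x y f"
  shows "arr j" "src j = c" "trg j = y \<bullet>\<^sub>o G x" "evr y (G x) \<cdot> (j \<otimes>\<^sub>a pd C x) = f"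
proof -
  let ?B = "bobj_ident C y (G x)" and ?Q = "P (G x) \<otimes>\<^sub>o P y" and ?R = "x \<otimes>\<^sub>o P y"
  let ?q = "cinv C (pd C x) \<otimes>\<^sub>a I (P y)"
  define t where "t = rep_inv C (c \<otimes>\<^sub>o x) (P y) (dp C y \<cdot> f) \<cdot> \<alpha>' c x (P y)"
  have t: "t = (rho y \<cdot> (f \<otimes>\<^sub>a I (P y))) \<cdot> \<alpha>' c x (P y)"
    by (simp add: t_def rep_inv_eq rho_def)
  then have t_typing [simp]: "arr t" "src t = c \<otimes>\<^sub>o ?R" "trg t = K" by simp_all
  let ?r = "rep C c ?R t"
  have j: "j = ?B \<cdot> Ga ?q \<cdot> ?r" by (simp add: j_def ihom_adj_def t_def)
  show jt [simp]: "arr j" "src j = c" "trg j = y \<bullet>\<^sub>o G x" by (simp_all add: j)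
  show "evr y (G x) \<cdot> (j \<otimes>\<^sub>a pd C x) = f"
  proof (rule rho_cancel_left)
    have "rho y \<cdot> ((evr y (G x) \<cdot> (j \<otimes>\<^sub>a pd C x)) \<otimes>\<^sub>a I (P y))
      = (rho y \<cdot> ((evr y (G x) \<cdot> (?B \<otimes>\<^sub>a I (P (G x)))) \<otimes>\<^sub>a I (P y))) \<cdot> (((Ga ?q \<cdot> ?r) \<otimes>\<^sub>a pd C x) \<otimes>\<^sub>a I (P y))"
      by (simp add: j)
    also have "\<dots> = (lam ?Q \<cdot> \<alpha> (G ?Q) (P (G x)) (P y)) \<cdot> (((Ga ?q \<cdot> ?r) \<otimes>\<^sub>a pd C x) \<otimes>\<^sub>a I (P y))"
      by (subst evr_bobj_ident) simp_all
    also have "\<dots> = (lam ?Q \<cdot> (Ga ?q \<otimes>\<^sub>a I ?Q)) \<cdot> (?r \<otimes>\<^sub>a (pd C x \<otimes>\<^sub>a I (P y))) \<cdot> \<alpha> c x (P y)"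
      by (simp add: assoc_slide)
    \<comment> \<open>Moved to the other factor, \<open>?q\<close> meets \<open>pd C x\<close>,
      which its inverse \<open>pd\<close> cancels.\<close>
    also have "\<dots> = (lam ?R \<cdot> (I (G ?R) \<otimes>\<^sub>a ?q)) \<cdot> (?r \<otimes>\<^sub>a (pd C x \<otimes>\<^sub>a I (P y))) \<cdot> \<alpha> c x (P y)"
      by (subst lam_dinat[of ?q ?Q ?R]) simp_all
    also have "\<dots> = (lam ?R \<cdot> (?r \<otimes>\<^sub>a I ?R)) \<cdot> \<alpha> c x (P y)" by simp
    also have "\<dots> = t \<cdot> \<alpha> c x (P y)" by (subst lam_rep) simp_all
    also have "\<dots> = rho y \<cdot> (f \<otimes>\<^sub>a I (P y))" by (simp add: t)
    finally show "rho y \<cdot> ((evr y (G x) \<cdot> (j \<otimes>\<^sub>a pd C x)) \<otimes>\<^sub>a I (P y)) = rho y \<cdot> (f \<otimes>\<^sub>a I (P y))" .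
  qed simp_all
qed

lemma evr_pd_cancel:
  assumes "evr y (G x) \<cdot> (f \<otimes>\<^sub>a pd C x) = evr y (G x) \<cdot> (g \<otimes>\<^sub>a pd C x)"
    and "arr f" "arr g" "src f = src g" "trg f = y \<bullet>\<^sub>o G x" "trg g = y \<bullet>\<^sub>o G x" "x \<in> Ob C" "y \<in> Ob C"
  shows "f = g"
proof (rule evr_cancel)
  show "evr y (G x) \<cdot> (f \<otimes>\<^sub>a I (P (G x))) = evr y (G x) \<cdot> (g \<otimes>\<^sub>a I (P (G x)))"
  proof (rule iso_cancel_right)
    show "(evr y (G x) \<cdot> (f \<otimes>\<^sub>a I (P (G x)))) \<cdot> (I (src f) \<otimes>\<^sub>a pd C x)
      = (evr y (G x) \<cdot> (g \<otimes>\<^sub>a I (P (G x)))) \<cdot> (I (src f) \<otimes>\<^sub>a pd C x)"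
      using assms by simp
  qed (use assms in simp_all)
qed (use assms in simp_all)

text \<open>Composition with \<open>evr\<close> is a left inverse of \<open>ihom_adj\<close>, which
  is therefore injective. The candidate is a preimage of \<open>g\<close> because its transpose and
  \<open>g\<close> have the same composite with \<open>evr\<close>.\<close>

lemma ihom_adj_inv:
  assumes [simp]: "x \<in> Ob C" "y \<in> Ob C" "arr g" "src g = c" "trg g = y \<bullet>\<^sub>o G x"
  shows "ihom_adj_inv C c x y g = evr y (G x) \<cdot> (g \<otimes>\<^sub>a pd C x)"
proof -
  have [simp]: "c \<in> Ob C" using arr_Ob[of g] by simp
  let ?f = "evr y (G x) \<cdot> (g \<otimes>\<^sub>a pd C x)"
  have "inj_on (ihom_adj C c x y) (Hom C (c \<otimes>\<^sub>o x) y)"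
  proof (rule inj_onI)
    fix f f' assume *: "f \<in> Hom C (c \<otimes>\<^sub>o x) y" "f' \<in> Hom C (c \<otimes>\<^sub>o x) y" "ihom_adj C c x y f = ihom_adj C c x y f'"
    have "evr y (G x) \<cdot> (ihom_adj C c x y h \<otimes>\<^sub>a pd C x) = h" if "h \<in> Hom C (c \<otimes>\<^sub>o x) y" for h
      by (rule ihom_adj(4)) (use that in \<open>simp_all add: in_Hom_iff\<close>)
    then show "f = f'" using * by metis
  qed
  moreover have "?f \<in> Hom C (c \<otimes>\<^sub>o x) y" by (simp add: in_Hom_iff)
  moreover have "ihom_adj C c x y ?f = g"
    by (rule evr_pd_cancel[of y x]) (simp_all add: ihom_adj)
  ultimately show ?thesis
    unfolding ihom_adj_inv_def by (metis inv_into_f_f)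
qed

end

section \<open>Associator and unitors of the second tensor product\<close>

context gv_category
begin

text \<open>Oriented so as to fold the definition: rewriting then keeps the product in the form that
  the typing rules and the evaluations mention.\<close>

lemma P_dual_tensor [simp]: "P (G y \<otimes>\<^sub>o G x) = x \<bullet>\<^sub>o y"
  by (simp add: bobj_def)

lemma rho_dual_tensor:
  assumes "x \<in> Ob C" "y \<in> Ob C"
  shows "rho (G y \<otimes>\<^sub>o G x) = (lam y \<cdot> (I (G y) \<otimes>\<^sub>a evl x y)) \<cdot> \<alpha> (G y) (G x) (x \<bullet>\<^sub>o y)"
  unfolding lam_evl[OF assms] using assms by simp

lemma bassoc_typing [simp]:
  assumes "x \<in> Ob C" "y \<in> Ob C" "z \<in> Ob C"
  shows "arr (bassoc C x y z)" "src (bassoc C x y z) = (x \<bullet>\<^sub>o y) \<bullet>\<^sub>o z"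
    "trg (bassoc C x y z) = x \<bullet>\<^sub>o (y \<bullet>\<^sub>o z)"
  using assms by (simp_all add: bassoc_def)

text \<open>Evaluating against \<open>G x\<close> and then against \<open>G y\<close> is one
  evaluation against \<open>G (x \<bullet>\<^sub>o y)\<close>, which \<open>dp\<close> identifies
  with \<open>G y \<otimes>\<^sub>o G x\<close>. Since \<open>bassoc\<close> is \<open>Pa\<close> of
  an associator conjugated by \<open>dp\<close>, the pentagon on the dual side proves this.\<close>

lemma evl_bassoc:
  assumes [simp]: "x \<in> Ob C" "y \<in> Ob C" "z \<in> Ob C"
  shows "evl y z \<cdot> (I (G y) \<otimes>\<^sub>a (evl x (y \<bullet>\<^sub>o z) \<cdot> (I (G x) \<otimes>\<^sub>a bassoc C x y z)))
    = evl (x \<bullet>\<^sub>o y) z \<cdot> (dp C (G y \<otimes>\<^sub>o G x) \<otimes>\<^sub>a I ((x \<bullet>\<^sub>o y) \<bullet>\<^sub>o z)) \<cdot> \<alpha>' (G y) (G x) ((x \<bullet>\<^sub>o y) \<bullet>\<^sub>o z)"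
proof (rule lam_cancel_right)
  let ?W = "G z \<otimes>\<^sub>o G y" and ?V = "G y \<otimes>\<^sub>o G x" and ?T = "(x \<bullet>\<^sub>o y) \<bullet>\<^sub>o z"
  let ?b = "bassoc C x y z"
  let ?X = "evl x (y \<bullet>\<^sub>o z) \<cdot> (I (G x) \<otimes>\<^sub>a ?b)"
  define \<beta> where "\<beta> = (I (G z) \<otimes>\<^sub>a dp C ?V) \<cdot> \<alpha> (G z) (G y) (G x) \<cdot> (cinv C (dp C ?W) \<otimes>\<^sub>a I (G x))"
  have b: "?b = Pa \<beta>" by (simp add: bassoc_def \<beta>_def)
  have \<beta> [simp]: "arr \<beta>" "src \<beta> = G (y \<bullet>\<^sub>o z) \<otimes>\<^sub>o G x" "trg \<beta> = G z \<otimes>\<^sub>o G (x \<bullet>\<^sub>o y)"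
    by (simp_all add: \<beta>_def)
  have "lam z \<cdot> (I (G z) \<otimes>\<^sub>a (evl y z \<cdot> (I (G y) \<otimes>\<^sub>a ?X)))
    = (lam z \<cdot> (I (G z) \<otimes>\<^sub>a evl y z)) \<cdot> (I (G z) \<otimes>\<^sub>a (I (G y) \<otimes>\<^sub>a ?X))" by simp
  also have "\<dots> = (rho ?W \<cdot> \<alpha>' (G z) (G y) (y \<bullet>\<^sub>o z)) \<cdot> (I (G z) \<otimes>\<^sub>a (I (G y) \<otimes>\<^sub>a ?X))"
    by (simp only: lam_evl assms)
  also have "\<dots> = (lam (y \<bullet>\<^sub>o z) \<cdot> (I (G (y \<bullet>\<^sub>o z)) \<otimes>\<^sub>a evl x (y \<bullet>\<^sub>o z))) \<cdot>
      (dp C ?W \<otimes>\<^sub>a (I (G x) \<otimes>\<^sub>a ?b)) \<cdot> \<alpha>' (G z) (G y) (G x \<otimes>\<^sub>o ?T)"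
    by (simp add: assoc_slide rho_def)
  also have "\<dots> = (rho (G (y \<bullet>\<^sub>o z) \<otimes>\<^sub>o G x) \<cdot> \<alpha>' (G (y \<bullet>\<^sub>o z)) (G x) (x \<bullet>\<^sub>o (y \<bullet>\<^sub>o z))) \<cdot>
      (dp C ?W \<otimes>\<^sub>a (I (G x) \<otimes>\<^sub>a ?b)) \<cdot> \<alpha>' (G z) (G y) (G x \<otimes>\<^sub>o ?T)"
    by (simp only: lam_evl bobj_Ob assms)
  also have "\<dots> = (rho (G (y \<bullet>\<^sub>o z) \<otimes>\<^sub>o G x) \<cdot> (I (G (y \<bullet>\<^sub>o z) \<otimes>\<^sub>o G x) \<otimes>\<^sub>a Pa \<beta>)) \<cdot>
      ((dp C ?W \<otimes>\<^sub>a I (G x)) \<otimes>\<^sub>a I ?T) \<cdot> \<alpha>' ?W (G x) ?T \<cdot> \<alpha>' (G z) (G y) (G x \<otimes>\<^sub>o ?T)"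
    by (simp add: assoc_slide b)
  \<comment> \<open>On the dual side the inverse \<open>dp\<close> inside \<open>\<beta>\<close>
    meets \<open>dp C ?W\<close> and cancels; only an associator and \<open>dp C ?V\<close>
    survive.\<close>
  also have "\<dots> = (rho (G z \<otimes>\<^sub>o G (x \<bullet>\<^sub>o y)) \<cdot> (\<beta> \<otimes>\<^sub>a I ?T)) \<cdot>
      ((dp C ?W \<otimes>\<^sub>a I (G x)) \<otimes>\<^sub>a I ?T) \<cdot> \<alpha>' ?W (G x) ?T \<cdot> \<alpha>' (G z) (G y) (G x \<otimes>\<^sub>o ?T)"
    by (subst rho_dinat[symmetric, of \<beta> _ "G z \<otimes>\<^sub>o G (x \<bullet>\<^sub>o y)"]) simp_all
  also have "\<dots> = rho (G z \<otimes>\<^sub>o G (x \<bullet>\<^sub>o y)) \<cdot> ((I (G z) \<otimes>\<^sub>a dp C ?V) \<otimes>\<^sub>a I ?T) \<cdot>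
      ((\<alpha> (G z) (G y) (G x) \<otimes>\<^sub>a I ?T) \<cdot> \<alpha>' ?W (G x) ?T \<cdot> \<alpha>' (G z) (G y) (G x \<otimes>\<^sub>o ?T))"
    by (simp add: \<beta>_def)
  also have "\<dots> = rho (G z \<otimes>\<^sub>o G (x \<bullet>\<^sub>o y)) \<cdot> ((I (G z) \<otimes>\<^sub>a dp C ?V) \<otimes>\<^sub>a I ?T) \<cdot>
      (\<alpha>' (G z) ?V ?T \<cdot> (I (G z) \<otimes>\<^sub>a \<alpha>' (G y) (G x) ?T))"
    by (simp only: pentagon_inv2 dual_objects bobj_Ob assms)
  also have "\<dots> = rho (G z \<otimes>\<^sub>o G (x \<bullet>\<^sub>o y)) \<cdot> (\<alpha>' (G z) (G (x \<bullet>\<^sub>o y)) ?T \<cdot>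
      (I (G z) \<otimes>\<^sub>a (dp C ?V \<otimes>\<^sub>a I ?T))) \<cdot> (I (G z) \<otimes>\<^sub>a \<alpha>' (G y) (G x) ?T)"
    by (simp add: assoc_slide)
  also have "\<dots> = (rho (G z \<otimes>\<^sub>o G (x \<bullet>\<^sub>o y)) \<cdot> \<alpha>' (G z) (G (x \<bullet>\<^sub>o y)) ?T) \<cdot>
      (I (G z) \<otimes>\<^sub>a ((dp C ?V \<otimes>\<^sub>a I ?T) \<cdot> \<alpha>' (G y) (G x) ?T))"
    by simp
  also have "\<dots> = (lam z \<cdot> (I (G z) \<otimes>\<^sub>a evl (x \<bullet>\<^sub>o y) z)) \<cdot>
      (I (G z) \<otimes>\<^sub>a ((dp C ?V \<otimes>\<^sub>a I ?T) \<cdot> \<alpha>' (G y) (G x) ?T))"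
    by (simp only: lam_evl bobj_Ob assms)
  also have "\<dots> = lam z \<cdot> (I (G z) \<otimes>\<^sub>a (evl (x \<bullet>\<^sub>o y) z \<cdot> (dp C ?V \<otimes>\<^sub>a I ?T) \<cdot> \<alpha>' (G y) (G x) ?T))"
    by simp
  finally show "lam z \<cdot> (I (G z) \<otimes>\<^sub>a (evl y z \<cdot> (I (G y) \<otimes>\<^sub>a ?X)))
    = lam z \<cdot> (I (G z) \<otimes>\<^sub>a (evl (x \<bullet>\<^sub>o y) z \<cdot> (dp C ?V \<otimes>\<^sub>a I ?T) \<cdot> \<alpha>' (G y) (G x) ?T))" .
qed simp_all

text \<open>Both sides are the canonical map \<open>G x \<otimes> ((x \<bullet> y) \<bullet> z) \<otimes> P z \<rightarrow> y\<close>.\<close>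

lemma evr_evl_bassoc:
  assumes [simp]: "x \<in> Ob C" "y \<in> Ob C" "z \<in> Ob C"
  shows "evr y z \<cdot> ((evl x (y \<bullet>\<^sub>o z) \<cdot> (I (G x) \<otimes>\<^sub>a bassoc C x y z)) \<otimes>\<^sub>a I (P z))
    = evl x y \<cdot> (I (G x) \<otimes>\<^sub>a evr (x \<bullet>\<^sub>o y) z) \<cdot> \<alpha> (G x) ((x \<bullet>\<^sub>o y) \<bullet>\<^sub>o z) (P z)"
proof (rule lam_cancel_right)
  let ?V = "G y \<otimes>\<^sub>o G x" and ?T = "(x \<bullet>\<^sub>o y) \<bullet>\<^sub>o z"
  let ?X = "evl x (y \<bullet>\<^sub>o z) \<cdot> (I (G x) \<otimes>\<^sub>a bassoc C x y z)"
  have "lam y \<cdot> (I (G y) \<otimes>\<^sub>a (evr y z \<cdot> (?X \<otimes>\<^sub>a I (P z))))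
    = (lam y \<cdot> (I (G y) \<otimes>\<^sub>a evr y z)) \<cdot> (I (G y) \<otimes>\<^sub>a (?X \<otimes>\<^sub>a I (P z)))" by simp
  also have "\<dots> = (rho z \<cdot> (evl y z \<otimes>\<^sub>a I (P z)) \<cdot> \<alpha>' (G y) (y \<bullet>\<^sub>o z) (P z)) \<cdot> (I (G y) \<otimes>\<^sub>a (?X \<otimes>\<^sub>a I (P z)))"
    by (simp only: lam_evr assms)
  also have "\<dots> = rho z \<cdot> ((evl y z \<cdot> (I (G y) \<otimes>\<^sub>a ?X)) \<otimes>\<^sub>a I (P z)) \<cdot> \<alpha>' (G y) (G x \<otimes>\<^sub>o ?T) (P z)"
    by (simp add: assoc_slide)
  also have "\<dots> = rho z \<cdot> ((evl (x \<bullet>\<^sub>o y) z \<cdot> (dp C ?V \<otimes>\<^sub>a I ?T) \<cdot> \<alpha>' (G y) (G x) ?T) \<otimes>\<^sub>a I (P z)) \<cdot> \<alpha>' (G y) (G x \<otimes>\<^sub>o ?T) (P z)"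
    by (simp only: evl_bassoc assms)
  also have "\<dots> = rho z \<cdot> ((evl (x \<bullet>\<^sub>o y) z \<cdot> (dp C ?V \<otimes>\<^sub>a I ?T)) \<otimes>\<^sub>a I (P z)) \<cdot>
      ((\<alpha>' (G y) (G x) ?T \<otimes>\<^sub>a I (P z)) \<cdot> \<alpha>' (G y) (G x \<otimes>\<^sub>o ?T) (P z))"
    by simp
  also have "\<dots> = rho z \<cdot> ((evl (x \<bullet>\<^sub>o y) z \<cdot> (dp C ?V \<otimes>\<^sub>a I ?T)) \<otimes>\<^sub>a I (P z)) \<cdot>
      (\<alpha>' ?V ?T (P z) \<cdot> \<alpha>' (G y) (G x) (?T \<otimes>\<^sub>o P z) \<cdot> (I (G y) \<otimes>\<^sub>a \<alpha> (G x) ?T (P z)))"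
    by (simp only: pentagon_inv1 dual_objects bobj_Ob assms)
  also have "\<dots> = (rho z \<cdot> (evl (x \<bullet>\<^sub>o y) z \<otimes>\<^sub>a I (P z)) \<cdot> \<alpha>' (G (x \<bullet>\<^sub>o y)) ?T (P z)) \<cdot>
      (dp C ?V \<otimes>\<^sub>a I (?T \<otimes>\<^sub>o P z)) \<cdot> \<alpha>' (G y) (G x) (?T \<otimes>\<^sub>o P z) \<cdot> (I (G y) \<otimes>\<^sub>a \<alpha> (G x) ?T (P z))"
    by (simp add: assoc_slide)
  also have "\<dots> = (lam (x \<bullet>\<^sub>o y) \<cdot> (I (G (x \<bullet>\<^sub>o y)) \<otimes>\<^sub>a evr (x \<bullet>\<^sub>o y) z)) \<cdot>
      (dp C ?V \<otimes>\<^sub>a I (?T \<otimes>\<^sub>o P z)) \<cdot> \<alpha>' (G y) (G x) (?T \<otimes>\<^sub>o P z) \<cdot> (I (G y) \<otimes>\<^sub>a \<alpha> (G x) ?T (P z))"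
    by (simp only: lam_evr bobj_Ob assms)
  \<comment> \<open>As \<open>P ?V\<close> is \<open>x \<bullet>\<^sub>o y\<close>, composing
    \<open>lam (x \<bullet>\<^sub>o y)\<close> with \<open>dp C ?V\<close> gives
    \<open>rho ?V\<close>, the pairing from which \<open>evl x y\<close> was made.\<close>
  also have "\<dots> = rho ?V \<cdot> (\<alpha>' (G y) (G x) (x \<bullet>\<^sub>o y) \<cdot>
      (I (G y) \<otimes>\<^sub>a (I (G x) \<otimes>\<^sub>a evr (x \<bullet>\<^sub>o y) z))) \<cdot> (I (G y) \<otimes>\<^sub>a \<alpha> (G x) ?T (P z))"
    by (simp add: assoc_slide rho_def)
  also have "\<dots> = (rho ?V \<cdot> \<alpha>' (G y) (G x) (x \<bullet>\<^sub>o y)) \<cdot>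
      (I (G y) \<otimes>\<^sub>a ((I (G x) \<otimes>\<^sub>a evr (x \<bullet>\<^sub>o y) z) \<cdot> \<alpha> (G x) ?T (P z)))"
    by simp
  also have "\<dots> = (lam y \<cdot> (I (G y) \<otimes>\<^sub>a evl x y)) \<cdot>
      (I (G y) \<otimes>\<^sub>a ((I (G x) \<otimes>\<^sub>a evr (x \<bullet>\<^sub>o y) z) \<cdot> \<alpha> (G x) ?T (P z)))"
    by (simp only: lam_evl assms)
  also have "\<dots> = lam y \<cdot> (I (G y) \<otimes>\<^sub>a (evl x y \<cdot> (I (G x) \<otimes>\<^sub>a evr (x \<bullet>\<^sub>o y) z) \<cdot> \<alpha> (G x) ?T (P z)))"
    by simp
  finally show "lam y \<cdot> (I (G y) \<otimes>\<^sub>a (evr y z \<cdot> (?X \<otimes>\<^sub>a I (P z))))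
    = lam y \<cdot> (I (G y) \<otimes>\<^sub>a (evl x y \<cdot> (I (G x) \<otimes>\<^sub>a evr (x \<bullet>\<^sub>o y) z) \<cdot> \<alpha> (G x) ?T (P z)))" .
qed simp_all

section \<open>The unitors of the second product under the evaluations\<close>

abbreviation \<upsilon> where "\<upsilon> \<equiv> unit_to_dual C"

lemma unit_to_dual_typing [simp]: "arr \<upsilon>" "src \<upsilon> = tunit C" "trg \<upsilon> = G K"
  by (simp_all add: unit_to_dual_def)

lemma lam_unit_to_dual: "lam K \<cdot> (\<upsilon> \<otimes>\<^sub>a I K) = lunit C K"
  unfolding unit_to_dual_def by (rule lam_rep) simp_all

lemma brunit_typing [simp]:
  assumes "x \<in> Ob C"
  shows "arr (brunit C x)" "src (brunit C x) = x \<bullet>\<^sub>o K" "trg (brunit C x) = x"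
  using assms by (simp_all add: brunit_def)

lemma blunit_typing [simp]:
  assumes "x \<in> Ob C"
  shows "arr (blunit C x)" "src (blunit C x) = K \<bullet>\<^sub>o x" "trg (blunit C x) = x"
  using assms by (simp_all add: blunit_def)

text \<open>Both unitors are an inverse \<open>pd\<close> after some \<open>Pa \<nu>\<close>. Paired
  with \<open>G x\<close>, such a morphism becomes \<open>\<nu>\<close> acting on the dual
  side.\<close>

lemma lam_pd_inv_Pa:
  assumes "x \<in> Ob C" "arr \<nu>" "src \<nu> = G x" "trg \<nu> = w"
  shows "lam x \<cdot> (I (G x) \<otimes>\<^sub>a (cinv C (pd C x) \<cdot> Pa \<nu>)) = rho w \<cdot> (\<nu> \<otimes>\<^sub>a I (P w))"
proof -
  have w: "w \<in> Ob C" using assms by auto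
  have "lam x \<cdot> (I (G x) \<otimes>\<^sub>a (cinv C (pd C x) \<cdot> Pa \<nu>))
    = (rho (G x) \<cdot> (I (G x) \<otimes>\<^sub>a pd C x)) \<cdot> (I (G x) \<otimes>\<^sub>a (cinv C (pd C x) \<cdot> Pa \<nu>))"
    by (simp only: rho_G assms(1))
  also have "\<dots> = rho (G x) \<cdot> (I (G x) \<otimes>\<^sub>a Pa \<nu>)" using assms w by simp
  also have "\<dots> = rho w \<cdot> (\<nu> \<otimes>\<^sub>a I (P w))" using assms by (simp only: rho_dinat)
  finally show ?thesis .
qed

text \<open>With second factor \<open>K\<close>, the evaluation already takes values in
  \<open>K\<close> and so is itself a pairing; the right unitor is its transpose. The isomorphism
  \<open>\<upsilon>\<close> is absorbed by \<open>lunit C K\<close>, and unit coherence cancels the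
  rest.\<close>

lemma lam_brunit:
  assumes [simp]: "x \<in> Ob C"
  shows "lam x \<cdot> (I (G x) \<otimes>\<^sub>a brunit C x) = evl x K"
proof -
  let ?\<nu> = "(\<upsilon> \<otimes>\<^sub>a I (G x)) \<cdot> cinv C (lunit C (G x))" and ?b = "x \<bullet>\<^sub>o K" and ?i = "tunit C"
  have "lam x \<cdot> (I (G x) \<otimes>\<^sub>a brunit C x) = rho (G K \<otimes>\<^sub>o G x) \<cdot> (?\<nu> \<otimes>\<^sub>a I (P (G K \<otimes>\<^sub>o G x)))"
    unfolding brunit_def by (rule lam_pd_inv_Pa) simp_all
  also have "\<dots> = (lam K \<cdot> (I (G K) \<otimes>\<^sub>a evl x K)) \<cdot> (\<alpha> (G K) (G x) ?b \<cdot> ((\<upsilon> \<otimes>\<^sub>a I (G x)) \<otimes>\<^sub>a I ?b)) \<cdot>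
      (cinv C (lunit C (G x)) \<otimes>\<^sub>a I ?b)"
    by (simp add: rho_dual_tensor)
  also have "\<dots> = (lam K \<cdot> (\<upsilon> \<otimes>\<^sub>a I K)) \<cdot> (I ?i \<otimes>\<^sub>a evl x K) \<cdot> \<alpha> ?i (G x) ?b \<cdot> (cinv C (lunit C (G x)) \<otimes>\<^sub>a I ?b)"
    by (simp add: assoc_slide)
  also have "\<dots> = (lunit C K \<cdot> (I ?i \<otimes>\<^sub>a evl x K)) \<cdot> \<alpha> ?i (G x) ?b \<cdot> (cinv C (lunit C (G x)) \<otimes>\<^sub>a I ?b)"
    by (simp add: lam_unit_to_dual)
  also have "\<dots> = evl x K \<cdot> (lunit C (G x \<otimes>\<^sub>o ?b) \<cdot> \<alpha> ?i (G x) ?b) \<cdot> (cinv C (lunit C (G x)) \<otimes>\<^sub>a I ?b)"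
    by (simp add: lunit_nat)
  also have "\<dots> = evl x K" by (subst lunit_tensor) simp_all
  finally show ?thesis .
qed

text \<open>The left distributor is known under \<open>evr\<close>, so the right unitor has to be
  expressed by \<open>evr\<close> too. The morphism \<open>u\<close> is the counterpart of
  \<open>\<upsilon>\<close> for the dual \<open>P\<close>, namely the transpose of
  \<open>runit C K\<close> along \<open>rho K\<close>; one \<open>u\<close> serves all
  \<open>x\<close>.\<close>

lemma brunit_evr:
  obtains u where "arr u" "src u = tunit C" "trg u = P K"
    "\<And>x. x \<in> Ob C \<Longrightarrow> brunit C x \<cdot> runit C (x \<bullet>\<^sub>o K) = evr x K \<cdot> (I (x \<bullet>\<^sub>o K) \<otimes>\<^sub>a u)"
proof
  let ?i = "tunit C"
  let ?u = "Pa (rep C K ?i (runit C K)) \<cdot> pd C ?i"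
  show u [simp]: "arr ?u" "src ?u = ?i" "trg ?u = P K" by simp_all
  have rho_u: "rho K \<cdot> (I K \<otimes>\<^sub>a ?u) = runit C K" by (rule rho_transpose) simp_all
  fix x assume [simp]: "x \<in> Ob C"
  show "brunit C x \<cdot> runit C (x \<bullet>\<^sub>o K) = evr x K \<cdot> (I (x \<bullet>\<^sub>o K) \<otimes>\<^sub>a ?u)"
  proof (rule lam_cancel_right)
    let ?b = "x \<bullet>\<^sub>o K"
    have "lam x \<cdot> (I (G x) \<otimes>\<^sub>a (evr x K \<cdot> (I ?b \<otimes>\<^sub>a ?u)))
      = (lam x \<cdot> (I (G x) \<otimes>\<^sub>a evr x K)) \<cdot> (I (G x) \<otimes>\<^sub>a (I ?b \<otimes>\<^sub>a ?u))"
      by (simp del: tensor_iden)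
    also have "\<dots> = (rho K \<cdot> (evl x K \<otimes>\<^sub>a I (P K)) \<cdot> \<alpha>' (G x) ?b (P K)) \<cdot> (I (G x) \<otimes>\<^sub>a (I ?b \<otimes>\<^sub>a ?u))"
      by (simp only: lam_evr dualizing_Ob \<open>x \<in> Ob C\<close>)
    also have "\<dots> = (rho K \<cdot> (I K \<otimes>\<^sub>a ?u)) \<cdot> (evl x K \<otimes>\<^sub>a I ?i) \<cdot> \<alpha>' (G x) ?b ?i"
      by (simp add: assoc_slide)
    also have "\<dots> = (runit C K \<cdot> (evl x K \<otimes>\<^sub>a I ?i)) \<cdot> \<alpha>' (G x) ?b ?i"
      unfolding rho_u by simp
    also have "\<dots> = evl x K \<cdot> runit C (G x \<otimes>\<^sub>o ?b) \<cdot> \<alpha>' (G x) ?b ?i"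
      by (simp add: runit_nat)
    also have "\<dots> = evl x K \<cdot> ((I (G x) \<otimes>\<^sub>a runit C ?b) \<cdot> \<alpha> (G x) ?b ?i) \<cdot> \<alpha>' (G x) ?b ?i"
      by (subst runit_tensor) simp_all
    also have "\<dots> = (lam x \<cdot> (I (G x) \<otimes>\<^sub>a brunit C x)) \<cdot> (I (G x) \<otimes>\<^sub>a runit C ?b)"
      by (subst lam_brunit) simp_all
    also have "\<dots> = lam x \<cdot> (I (G x) \<otimes>\<^sub>a (brunit C x \<cdot> runit C ?b))" by simp
    finally show "lam x \<cdot> (I (G x) \<otimes>\<^sub>a (brunit C x \<cdot> runit C ?b))
      = lam x \<cdot> (I (G x) \<otimes>\<^sub>a (evr x K \<cdot> (I ?b \<otimes>\<^sub>a ?u)))" by (rule sym)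
  qed simp_all
qed

text \<open>After pairing with \<open>G x\<close>, the inverse \<open>runit\<close> in
  \<open>blunit\<close> and the \<open>lunit\<close> composed with it sit on the two sides of a unit
  in the middle, and the triangle axiom cancels them.\<close>

lemma blunit_evl:
  assumes [simp]: "x \<in> Ob C"
  shows "blunit C x \<cdot> lunit C (K \<bullet>\<^sub>o x) = evl K x \<cdot> (\<upsilon> \<otimes>\<^sub>a I (K \<bullet>\<^sub>o x))"
proof (rule lam_cancel_right)
  let ?\<nu> = "(I (G x) \<otimes>\<^sub>a \<upsilon>) \<cdot> cinv C (runit C (G x))" and ?b = "K \<bullet>\<^sub>o x" and ?i = "tunit C"
  have "lam x \<cdot> (I (G x) \<otimes>\<^sub>a blunit C x) = rho (G x \<otimes>\<^sub>o G K) \<cdot> (?\<nu> \<otimes>\<^sub>a I (P (G x \<otimes>\<^sub>o G K)))"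
    unfolding blunit_def by (rule lam_pd_inv_Pa) simp_all
  also have "\<dots> = (lam x \<cdot> (I (G x) \<otimes>\<^sub>a evl K x)) \<cdot> (\<alpha> (G x) (G K) ?b \<cdot> ((I (G x) \<otimes>\<^sub>a \<upsilon>) \<otimes>\<^sub>a I ?b)) \<cdot>
      (cinv C (runit C (G x)) \<otimes>\<^sub>a I ?b)"
    by (simp add: rho_dual_tensor)
  also have "\<dots> = lam x \<cdot> (I (G x) \<otimes>\<^sub>a (evl K x \<cdot> (\<upsilon> \<otimes>\<^sub>a I ?b))) \<cdot> \<alpha> (G x) ?i ?b \<cdot> (cinv C (runit C (G x)) \<otimes>\<^sub>a I ?b)"
    by (simp add: assoc_slide)
  finally have 1: "lam x \<cdot> (I (G x) \<otimes>\<^sub>a blunit C x) = \<dots>" .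
  have "lam x \<cdot> (I (G x) \<otimes>\<^sub>a (blunit C x \<cdot> lunit C ?b))
    = (lam x \<cdot> (I (G x) \<otimes>\<^sub>a blunit C x)) \<cdot> (I (G x) \<otimes>\<^sub>a lunit C ?b)" by simp
  also have "\<dots> = (lam x \<cdot> (I (G x) \<otimes>\<^sub>a (evl K x \<cdot> (\<upsilon> \<otimes>\<^sub>a I ?b)))) \<cdot> \<alpha> (G x) ?i ?b \<cdot>
      (cinv C (runit C (G x)) \<otimes>\<^sub>a I ?b) \<cdot> ((I (G x) \<otimes>\<^sub>a lunit C ?b) \<cdot> \<alpha> (G x) ?i ?b) \<cdot> \<alpha>' (G x) ?i ?b"
    unfolding 1 by simp
  also have "\<dots> = lam x \<cdot> (I (G x) \<otimes>\<^sub>a (evl K x \<cdot> (\<upsilon> \<otimes>\<^sub>a I ?b)))"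
    by (subst triangle) simp_all
  finally show "lam x \<cdot> (I (G x) \<otimes>\<^sub>a (blunit C x \<cdot> lunit C ?b))
    = lam x \<cdot> (I (G x) \<otimes>\<^sub>a (evl K x \<cdot> (\<upsilon> \<otimes>\<^sub>a I ?b)))" .
qed simp_all

end

section \<open>The distributors\<close>

context gv_category
begin

text \<open>The existence half of the universal property of \<open>evl\<close>, needed to produce a
  candidate for the right distributor.\<close>

lemma evl_transpose:
  assumes [simp]: "x \<in> Ob C" "y \<in> Ob C" "u \<in> Ob C" "arr k" "src k = G x \<otimes>\<^sub>o u" "trg k = y"
  obtains h where "arr h" "src h = u" "trg h = x \<bullet>\<^sub>o y" "evl x y \<cdot> (I (G x) \<otimes>\<^sub>a h) = k"
proof
  let ?W = "G y \<otimes>\<^sub>o G x"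
  define t where "t = (lam y \<cdot> (I (G y) \<otimes>\<^sub>a k)) \<cdot> \<alpha> (G y) (G x) u"
  have [simp]: "arr t" "src t = ?W \<otimes>\<^sub>o u" "trg t = K" by (simp_all add: t_def)
  define h where "h = Pa (rep C ?W u t) \<cdot> pd C u"
  show h [simp]: "arr h" "src h = u" "trg h = x \<bullet>\<^sub>o y" by (simp_all add: h_def)
  have rho_h: "rho ?W \<cdot> (I ?W \<otimes>\<^sub>a h) = t" unfolding h_def by (rule rho_transpose) simp_all
  show "evl x y \<cdot> (I (G x) \<otimes>\<^sub>a h) = k"
  proof (rule lam_cancel_right)
    have "lam y \<cdot> (I (G y) \<otimes>\<^sub>a (evl x y \<cdot> (I (G x) \<otimes>\<^sub>a h)))
      = (lam y \<cdot> (I (G y) \<otimes>\<^sub>a evl x y)) \<cdot> (I (G y) \<otimes>\<^sub>a (I (G x) \<otimes>\<^sub>a h))" by simp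
    also have "\<dots> = (rho ?W \<cdot> \<alpha>' (G y) (G x) (x \<bullet>\<^sub>o y)) \<cdot> (I (G y) \<otimes>\<^sub>a (I (G x) \<otimes>\<^sub>a h))"
      by (simp only: lam_evl assms)
    also have "\<dots> = (rho ?W \<cdot> (I ?W \<otimes>\<^sub>a h)) \<cdot> \<alpha>' (G y) (G x) u"
      by (simp add: assoc_slide)
    also have "\<dots> = lam y \<cdot> (I (G y) \<otimes>\<^sub>a k)" unfolding rho_h by (simp add: t_def)
    finally show "lam y \<cdot> (I (G y) \<otimes>\<^sub>a (evl x y \<cdot> (I (G x) \<otimes>\<^sub>a h))) = lam y \<cdot> (I (G y) \<otimes>\<^sub>a k)" .
  qed simp_all
qed

section \<open>The left distributor under both evaluations\<close>

lemma ihom_ev_eq: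
  assumes "x \<in> Ob C" "y \<in> Ob C"
  shows "ihom_ev C x y = evr y (G x) \<cdot> (I (y \<bullet>\<^sub>o G x) \<otimes>\<^sub>a pd C x)"
  unfolding ihom_ev_def by (rule ihom_adj_inv) (use assms in simp_all)

lemma Pa_dp_inv:
  assumes "z \<in> Ob C"
  shows "Pa (cinv C (dp C z)) = pd C (P z)"
proof -
  have "Pa (cinv C (dp C z)) = Pa (cinv C (dp C z)) \<cdot> (Pa (dp C z) \<cdot> pd C (P z))"
    using assms by (simp add: triangle_H)
  also have "\<dots> = Pa (dp C z \<cdot> cinv C (dp C z)) \<cdot> pd C (P z)"
    using assms H.functor_cmp[of "cinv C (dp C z)" "dp C z"] by (simp flip: cmp_assoc' del: cinv_typing(5))
  also have "\<dots> = pd C (P z)" using assms by simp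
  finally show ?thesis .
qed

lemma distL_dual:
  assumes [simp]: "c \<in> Ob C" "y \<in> Ob C" "x \<in> Ob C"
  defines "\<delta> \<equiv> distL_dual C c y x"
  shows "arr \<delta>" "src \<delta> = c \<otimes>\<^sub>o (y \<bullet>\<^sub>o G x)" "trg \<delta> = (c \<otimes>\<^sub>o y) \<bullet>\<^sub>o G x"
    and "evr (c \<otimes>\<^sub>o y) (G x) \<cdot> (\<delta> \<otimes>\<^sub>a pd C x)
      = (I c \<otimes>\<^sub>a (evr y (G x) \<cdot> (I (y \<bullet>\<^sub>o G x) \<otimes>\<^sub>a pd C x))) \<cdot> \<alpha> c (y \<bullet>\<^sub>o G x) x"
  unfolding \<delta>_def distL_dual_def by (subst ihom_adj; simp add: ihom_ev_eq)+

lemma distL_typing [simp]: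
  assumes "c \<in> Ob C" "y \<in> Ob C" "z \<in> Ob C"
  shows "arr (distL C c y z)" "src (distL C c y z) = c \<otimes>\<^sub>o (y \<bullet>\<^sub>o z)"
    "trg (distL C c y z) = (c \<otimes>\<^sub>o y) \<bullet>\<^sub>o z"
  using assms by (simp_all add: distL_def distL_dual)

text \<open>At a dual object \<open>G x\<close> this is the definition as a mate, up to
  \<open>pd\<close>. For general \<open>z\<close>, naturality of \<open>evr\<close> turns the two
  transports along \<open>dp\<close> into \<open>pd C (P z)\<close> and \<open>Pa (dp C z)\<close>,
  which cancel by \<open>triangle_H\<close>.\<close>

lemma evr_distL:
  assumes [simp]: "c \<in> Ob C" "y \<in> Ob C" "z \<in> Ob C"
  shows "evr (c \<otimes>\<^sub>o y) z \<cdot> (distL C c y z \<otimes>\<^sub>a I (P z)) = (I c \<otimes>\<^sub>a evr y z) \<cdot> \<alpha> c (y \<bullet>\<^sub>o z) (P z)"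
proof -
  let ?D = "distL_dual C c y (P z)" and ?d = "dp C z" and ?z = "G (P z)"
  note [simp] = distL_dual(1-3)
  have 1: "evr (c \<otimes>\<^sub>o y) z \<cdot> ((I (c \<otimes>\<^sub>o y) \<bullet>\<^sub>a cinv C ?d) \<otimes>\<^sub>a I (P z))
    = evr (c \<otimes>\<^sub>o y) ?z \<cdot> (I ((c \<otimes>\<^sub>o y) \<bullet>\<^sub>o ?z) \<otimes>\<^sub>a pd C (P z))"
    by (subst evr_nat[of "I (c \<otimes>\<^sub>o y)" "c \<otimes>\<^sub>o y" _ _ ?z]) (simp_all add: Pa_dp_inv)
  have 2: "evr y ?z \<cdot> ((I y \<bullet>\<^sub>a ?d) \<otimes>\<^sub>a I (P ?z)) = evr y z \<cdot> (I (y \<bullet>\<^sub>o z) \<otimes>\<^sub>a Pa ?d)"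
    by (subst evr_nat[of "I y" y _ _ z]) simp_all
  have "evr (c \<otimes>\<^sub>o y) z \<cdot> (distL C c y z \<otimes>\<^sub>a I (P z))
    = (evr (c \<otimes>\<^sub>o y) z \<cdot> ((I (c \<otimes>\<^sub>o y) \<bullet>\<^sub>a cinv C ?d) \<otimes>\<^sub>a I (P z))) \<cdot> ((?D \<cdot> (I c \<otimes>\<^sub>a (I y \<bullet>\<^sub>a ?d))) \<otimes>\<^sub>a I (P z))"
    by (simp add: distL_def)
  also have "\<dots> = (evr (c \<otimes>\<^sub>o y) ?z \<cdot> (?D \<otimes>\<^sub>a pd C (P z))) \<cdot> ((I c \<otimes>\<^sub>a (I y \<bullet>\<^sub>a ?d)) \<otimes>\<^sub>a I (P z))"
    unfolding 1 by simp
  also have "\<dots> = ((I c \<otimes>\<^sub>a (evr y ?z \<cdot> (I (y \<bullet>\<^sub>o ?z) \<otimes>\<^sub>a pd C (P z)))) \<cdot> \<alpha> c (y \<bullet>\<^sub>o ?z) (P z)) \<cdot>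
      ((I c \<otimes>\<^sub>a (I y \<bullet>\<^sub>a ?d)) \<otimes>\<^sub>a I (P z))"
    by (subst distL_dual(4)) simp_all
  also have "\<dots> = (I c \<otimes>\<^sub>a ((evr y ?z \<cdot> ((I y \<bullet>\<^sub>a ?d) \<otimes>\<^sub>a I (P ?z))) \<cdot> (I (y \<bullet>\<^sub>o z) \<otimes>\<^sub>a pd C (P z)))) \<cdot> \<alpha> c (y \<bullet>\<^sub>o z) (P z)"
    by (simp add: assoc_slide)
  also have "\<dots> = (I c \<otimes>\<^sub>a evr y z) \<cdot> \<alpha> c (y \<bullet>\<^sub>o z) (P z)"
    unfolding 2 by (simp add: triangle_H)
  finally show ?thesis .
qed

text \<open>The canonical contraction
  \<open>G (c \<otimes> y) \<otimes> c \<rightarrow> G y\<close>. It lets a functional on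
  \<open>c \<otimes> y\<close> absorb \<open>c\<close>, and so relates evaluation of
  \<open>(c \<otimes> y) \<bullet> z\<close> against \<open>G (c \<otimes> y)\<close> to evaluation
  of \<open>y \<bullet> z\<close> against \<open>G y\<close>.\<close>

definition dual_tensor_eval :: "'o \<Rightarrow> 'o \<Rightarrow> 'm" where
  "dual_tensor_eval c y = rep C (G (c \<otimes>\<^sub>o y) \<otimes>\<^sub>o c) y (lam (c \<otimes>\<^sub>o y) \<cdot> \<alpha> (G (c \<otimes>\<^sub>o y)) c y)"

lemma dual_tensor_eval [simp]:
  assumes "c \<in> Ob C" "y \<in> Ob C"
  shows "arr (dual_tensor_eval c y)" "src (dual_tensor_eval c y) = G (c \<otimes>\<^sub>o y) \<otimes>\<^sub>o c"
    "trg (dual_tensor_eval c y) = G y"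
  using assms by (simp_all add: dual_tensor_eval_def)

lemma lam_dual_tensor_eval:
  assumes "c \<in> Ob C" "y \<in> Ob C"
  shows "lam y \<cdot> (dual_tensor_eval c y \<otimes>\<^sub>a I y) = lam (c \<otimes>\<^sub>o y) \<cdot> \<alpha> (G (c \<otimes>\<^sub>o y)) c y"
  unfolding dual_tensor_eval_def by (rule lam_rep) (use assms in simp_all)

text \<open>The threefold pairing translates \<open>evr_distL\<close> into a statement on
  \<open>evl\<close>. It is needed where \<open>bassoc\<close> forces the outermost evaluation of a
  nested product to be \<open>evl\<close>.\<close>

lemma evl_distL:
  assumes [simp]: "c \<in> Ob C" "y \<in> Ob C" "z \<in> Ob C"
  shows "evl (c \<otimes>\<^sub>o y) z \<cdot> (I (G (c \<otimes>\<^sub>o y)) \<otimes>\<^sub>a distL C c y z)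
    = evl y z \<cdot> (dual_tensor_eval c y \<otimes>\<^sub>a I (y \<bullet>\<^sub>o z)) \<cdot> \<alpha>' (G (c \<otimes>\<^sub>o y)) c (y \<bullet>\<^sub>o z)"
proof (rule rho_cancel_left)
  let ?g = "G (c \<otimes>\<^sub>o y)" and ?b = "y \<bullet>\<^sub>o z" and ?k = "dual_tensor_eval c y" and ?d = "distL C c y z"
  show "rho z \<cdot> ((evl (c \<otimes>\<^sub>o y) z \<cdot> (I ?g \<otimes>\<^sub>a ?d)) \<otimes>\<^sub>a I (P z))
    = rho z \<cdot> ((evl y z \<cdot> (?k \<otimes>\<^sub>a I ?b) \<cdot> \<alpha>' ?g c ?b) \<otimes>\<^sub>a I (P z))"
  proof (rule iso_cancel_right)
    have lam_cy: "lam (c \<otimes>\<^sub>o y) = (lam y \<cdot> (?k \<otimes>\<^sub>a I y)) \<cdot> \<alpha>' ?g c y"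
      by (simp add: lam_dual_tensor_eval)
    have "(rho z \<cdot> ((evl (c \<otimes>\<^sub>o y) z \<cdot> (I ?g \<otimes>\<^sub>a ?d)) \<otimes>\<^sub>a I (P z))) \<cdot> \<alpha>' ?g (c \<otimes>\<^sub>o ?b) (P z)
      = (rho z \<cdot> (evl (c \<otimes>\<^sub>o y) z \<otimes>\<^sub>a I (P z)) \<cdot> \<alpha>' ?g ((c \<otimes>\<^sub>o y) \<bullet>\<^sub>o z) (P z)) \<cdot> (I ?g \<otimes>\<^sub>a (?d \<otimes>\<^sub>a I (P z)))"
      by (simp add: assoc_slide)
    also have "\<dots> = (lam (c \<otimes>\<^sub>o y) \<cdot> (I ?g \<otimes>\<^sub>a evr (c \<otimes>\<^sub>o y) z)) \<cdot> (I ?g \<otimes>\<^sub>a (?d \<otimes>\<^sub>a I (P z)))"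
      by (simp only: lam_evr objects assms)
    also have "\<dots> = lam (c \<otimes>\<^sub>o y) \<cdot> (I ?g \<otimes>\<^sub>a (evr (c \<otimes>\<^sub>o y) z \<cdot> (?d \<otimes>\<^sub>a I (P z))))"
      by simp
    also have "\<dots> = (lam y \<cdot> (?k \<otimes>\<^sub>a I y)) \<cdot> (\<alpha>' ?g c y \<cdot> (I ?g \<otimes>\<^sub>a (I c \<otimes>\<^sub>a evr y z))) \<cdot> (I ?g \<otimes>\<^sub>a \<alpha> c ?b (P z))"
      unfolding evr_distL[OF assms] lam_cy by simp
    also have "\<dots> = (lam y \<cdot> (I (G y) \<otimes>\<^sub>a evr y z)) \<cdot> (?k \<otimes>\<^sub>a I (?b \<otimes>\<^sub>o P z)) \<cdot>
        \<alpha>' ?g c (?b \<otimes>\<^sub>o P z) \<cdot> (I ?g \<otimes>\<^sub>a \<alpha> c ?b (P z))"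
      by (simp add: assoc_slide)
    also have "\<dots> = (rho z \<cdot> (evl y z \<otimes>\<^sub>a I (P z)) \<cdot> \<alpha>' (G y) ?b (P z)) \<cdot> (?k \<otimes>\<^sub>a I (?b \<otimes>\<^sub>o P z)) \<cdot>
        \<alpha>' ?g c (?b \<otimes>\<^sub>o P z) \<cdot> (I ?g \<otimes>\<^sub>a \<alpha> c ?b (P z))"
      by (simp only: lam_evr assms)
    also have "\<dots> = rho z \<cdot> ((evl y z \<cdot> (?k \<otimes>\<^sub>a I ?b)) \<otimes>\<^sub>a I (P z)) \<cdot>
        (\<alpha>' (?g \<otimes>\<^sub>o c) ?b (P z) \<cdot> \<alpha>' ?g c (?b \<otimes>\<^sub>o P z) \<cdot> (I ?g \<otimes>\<^sub>a \<alpha> c ?b (P z)))"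
      by (simp add: assoc_slide)
    also have "\<dots> = rho z \<cdot> ((evl y z \<cdot> (?k \<otimes>\<^sub>a I ?b)) \<otimes>\<^sub>a I (P z)) \<cdot>
        ((\<alpha>' ?g c ?b \<otimes>\<^sub>a I (P z)) \<cdot> \<alpha>' ?g (c \<otimes>\<^sub>o ?b) (P z))"
      by (simp only: pentagon_inv1 dual_objects objects bobj_Ob assms)
    also have "\<dots> = (rho z \<cdot> ((evl y z \<cdot> (?k \<otimes>\<^sub>a I ?b) \<cdot> \<alpha>' ?g c ?b) \<otimes>\<^sub>a I (P z))) \<cdot> \<alpha>' ?g (c \<otimes>\<^sub>o ?b) (P z)"
      by simp
    finally show "(rho z \<cdot> ((evl (c \<otimes>\<^sub>o y) z \<cdot> (I ?g \<otimes>\<^sub>a ?d)) \<otimes>\<^sub>a I (P z))) \<cdot> \<alpha>' ?g (c \<otimes>\<^sub>o ?b) (P z) = \<dots>" .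
  qed simp_all
qed simp_all

section \<open>The right distributor under \<open>evl\<close>\<close>

lemma iso_Pa:
  assumes "iso f"
  shows "iso (Pa f)"
proof (rule isoI)
  show "Pa (cinv C f) \<cdot> Pa f = I (src (Pa f))" "Pa f \<cdot> Pa (cinv C f) = I (trg (Pa f))"
    using assms H.functor_cmp[of f "cinv C f"] H.functor_cmp[of "cinv C f" f] by simp_all
qed (use assms in simp_all)

lemma iso_bassoc [simp]:
  assumes "x \<in> Ob C" "y \<in> Ob C" "z \<in> Ob C"
  shows "iso (bassoc C x y z)"
  unfolding bassoc_def by (intro iso_Pa iso_cmp) (use assms in simp_all)

text \<open>The universal property of \<open>evl\<close> provides a morphism \<open>\<delta>\<close>
  with the desired composite. The work is to show that its mate \<open>j\<close> is the morphism
  from the definition, which is stated without the inverse as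
  \<open>?a \<cdot> j = I w \<bullet>\<^sub>a \<eta>\<close>.\<close>

lemma distR:
  assumes [simp]: "w \<in> Ob C" "y \<in> Ob C" "c \<in> Ob C"
  shows distR_typing [simp]: "arr (distR C w y c)" "src (distR C w y c) = (w \<bullet>\<^sub>o y) \<otimes>\<^sub>o c"
      "trg (distR C w y c) = w \<bullet>\<^sub>o (y \<otimes>\<^sub>o c)"
    and evl_distR: "evl w (y \<otimes>\<^sub>o c) \<cdot> (I (G w) \<otimes>\<^sub>a distR C w y c) = (evl w y \<otimes>\<^sub>a I c) \<cdot> \<alpha>' (G w) (w \<bullet>\<^sub>o y) c"
proof -
  let ?Z = "w \<bullet>\<^sub>o (y \<otimes>\<^sub>o c)" and ?b = "w \<bullet>\<^sub>o y" and ?y = "(y \<otimes>\<^sub>o c) \<bullet>\<^sub>o G c"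
  let ?a = "bassoc C w (y \<otimes>\<^sub>o c) (G c)"
  obtain \<delta> where \<delta> [simp]: "arr \<delta>" "src \<delta> = ?b \<otimes>\<^sub>o c" "trg \<delta> = ?Z"
    and evl_\<delta>: "evl w (y \<otimes>\<^sub>o c) \<cdot> (I (G w) \<otimes>\<^sub>a \<delta>) = (evl w y \<otimes>\<^sub>a I c) \<cdot> \<alpha>' (G w) ?b c"
    by (rule evl_transpose[of w "y \<otimes>\<^sub>o c" "?b \<otimes>\<^sub>o c" "(evl w y \<otimes>\<^sub>a I c) \<cdot> \<alpha>' (G w) ?b c"]) auto
  define \<eta> where "\<eta> = ihom_coev C c y"
  \<comment> \<open>The last fact is a triangle identity of the adjunction: the unit followed by the
    counit is the identity.\<close>
  have \<eta> [simp]: "arr \<eta>" "src \<eta> = y" "trg \<eta> = ?y"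
    and evr_\<eta>: "evr (y \<otimes>\<^sub>o c) (G c) \<cdot> (\<eta> \<otimes>\<^sub>a pd C c) = I (y \<otimes>\<^sub>o c)"
    unfolding \<eta>_def ihom_coev_def by (subst ihom_adj; simp)+
  define j where "j = ihom_adj C ?b c ?Z \<delta>"
  have j [simp]: "arr j" "src j = ?b" "trg j = ?Z \<bullet>\<^sub>o G c"
    and evr_j: "evr ?Z (G c) \<cdot> (j \<otimes>\<^sub>a pd C c) = \<delta>"
    unfolding j_def by (subst ihom_adj; simp)+
  have "?a \<cdot> j = I w \<bullet>\<^sub>a \<eta>"
  proof (rule evl_cancel)
    show "evl w ?y \<cdot> (I (G w) \<otimes>\<^sub>a (?a \<cdot> j)) = evl w ?y \<cdot> (I (G w) \<otimes>\<^sub>a (I w \<bullet>\<^sub>a \<eta>))"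
    \<comment> \<open>The target of \<open>evl w ?y\<close> is again a product, so
      \<open>evr\<close> can test it. Then \<open>evr_evl_bassoc\<close> removes \<open>?a\<close>
      and puts the evaluation of \<open>j\<close> first, where it yields
      \<open>\<delta>\<close>.\<close>
    proof (rule evr_pd_cancel)
      have "evr (y \<otimes>\<^sub>o c) (G c) \<cdot> ((evl w ?y \<cdot> (I (G w) \<otimes>\<^sub>a (?a \<cdot> j))) \<otimes>\<^sub>a pd C c)
        = (evr (y \<otimes>\<^sub>o c) (G c) \<cdot> ((evl w ?y \<cdot> (I (G w) \<otimes>\<^sub>a ?a)) \<otimes>\<^sub>a I (P (G c)))) \<cdot> ((I (G w) \<otimes>\<^sub>a j) \<otimes>\<^sub>a pd C c)"
        by simp
      also have "\<dots> = (evl w (y \<otimes>\<^sub>o c) \<cdot> (I (G w) \<otimes>\<^sub>a evr ?Z (G c)) \<cdot> \<alpha> (G w) (?Z \<bullet>\<^sub>o G c) (P (G c))) \<cdot>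
          ((I (G w) \<otimes>\<^sub>a j) \<otimes>\<^sub>a pd C c)"
        by (subst evr_evl_bassoc) simp_all
      also have "\<dots> = evl w (y \<otimes>\<^sub>o c) \<cdot> (I (G w) \<otimes>\<^sub>a (evr ?Z (G c) \<cdot> (j \<otimes>\<^sub>a pd C c))) \<cdot> \<alpha> (G w) ?b c"
        by (simp add: assoc_slide)
      also have "\<dots> = (evl w (y \<otimes>\<^sub>o c) \<cdot> (I (G w) \<otimes>\<^sub>a \<delta>)) \<cdot> \<alpha> (G w) ?b c"
        unfolding evr_j by simp
      also have "\<dots> = evl w y \<otimes>\<^sub>a I c" unfolding evl_\<delta> by simp
      finally have 1: "evr (y \<otimes>\<^sub>o c) (G c) \<cdot> ((evl w ?y \<cdot> (I (G w) \<otimes>\<^sub>a (?a \<cdot> j))) \<otimes>\<^sub>a pd C c) = \<dots>" .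
      have 2: "evl w ?y \<cdot> (I (G w) \<otimes>\<^sub>a (I w \<bullet>\<^sub>a \<eta>)) = \<eta> \<cdot> evl w y"
        by (subst evl_nat[of "I w" w _ _ y]) simp_all
      have "evr (y \<otimes>\<^sub>o c) (G c) \<cdot> ((\<eta> \<cdot> evl w y) \<otimes>\<^sub>a pd C c)
        = (evr (y \<otimes>\<^sub>o c) (G c) \<cdot> (\<eta> \<otimes>\<^sub>a pd C c)) \<cdot> (evl w y \<otimes>\<^sub>a I c)" by simp
      also have "\<dots> = evl w y \<otimes>\<^sub>a I c" unfolding evr_\<eta> by simp
      finally show "evr (y \<otimes>\<^sub>o c) (G c) \<cdot> ((evl w ?y \<cdot> (I (G w) \<otimes>\<^sub>a (?a \<cdot> j))) \<otimes>\<^sub>a pd C c)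
        = evr (y \<otimes>\<^sub>o c) (G c) \<cdot> ((evl w ?y \<cdot> (I (G w) \<otimes>\<^sub>a (I w \<bullet>\<^sub>a \<eta>))) \<otimes>\<^sub>a pd C c)"
        unfolding 1 2 by (rule sym)
    qed simp_all
  qed simp_all
  then have "cinv C ?a \<cdot> (I w \<bullet>\<^sub>a \<eta>) = cinv C ?a \<cdot> ?a \<cdot> j" by (simp only:)
  also have "\<dots> = j" by simp
  finally have "cinv C ?a \<cdot> (I w \<bullet>\<^sub>a \<eta>) = j" .
  then have "distR C w y c = ihom_adj_inv C ?b c ?Z j"
    by (simp add: distR_def \<eta>_def)
  also have "\<dots> = \<delta>" by (simp add: ihom_adj_inv evr_j)
  finally show "arr (distR C w y c)" "src (distR C w y c) = ?b \<otimes>\<^sub>o c" "trg (distR C w y c) = ?Z"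
    "evl w (y \<otimes>\<^sub>o c) \<cdot> (I (G w) \<otimes>\<^sub>a distR C w y c) = (evl w y \<otimes>\<^sub>a I c) \<cdot> \<alpha>' (G w) ?b c"
    using evl_\<delta> by simp_all
qed

end

section \<open>The mixed triangle and pentagon identities\<close>

context gv_category
begin

section \<open>The mixed triangle identities\<close>

lemma distL_lunit:
  assumes [simp]: "y \<in> Ob C" "z \<in> Ob C"
  shows "(lunit C y \<bullet>\<^sub>a I z) \<cdot> distL C (tunit C) y z = lunit C (y \<bullet>\<^sub>o z)"
proof (rule evr_cancel)
  let ?i = "tunit C"
  have "evr y z \<cdot> (((lunit C y \<bullet>\<^sub>a I z) \<cdot> distL C ?i y z) \<otimes>\<^sub>a I (P z))
    = (evr y z \<cdot> ((lunit C y \<bullet>\<^sub>a I z) \<otimes>\<^sub>a I (P z))) \<cdot> (distL C ?i y z \<otimes>\<^sub>a I (P z))" by simp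
  also have "\<dots> = lunit C y \<cdot> (evr (?i \<otimes>\<^sub>o y) z \<cdot> (distL C ?i y z \<otimes>\<^sub>a I (P z)))"
    by (subst evr_barr_id) simp_all
  also have "\<dots> = (lunit C y \<cdot> (I ?i \<otimes>\<^sub>a evr y z)) \<cdot> \<alpha> ?i (y \<bullet>\<^sub>o z) (P z)"
    by (simp add: evr_distL)
  also have "\<dots> = evr y z \<cdot> (lunit C ((y \<bullet>\<^sub>o z) \<otimes>\<^sub>o P z) \<cdot> \<alpha> ?i (y \<bullet>\<^sub>o z) (P z))"
    by (simp add: lunit_nat)
  also have "\<dots> = evr y z \<cdot> (lunit C (y \<bullet>\<^sub>o z) \<otimes>\<^sub>a I (P z))"
    by (subst lunit_tensor) simp_all
  finally show "evr y z \<cdot> (((lunit C y \<bullet>\<^sub>a I z) \<cdot> distL C ?i y z) \<otimes>\<^sub>a I (P z))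
    = evr y z \<cdot> (lunit C (y \<bullet>\<^sub>o z) \<otimes>\<^sub>a I (P z))" .
qed simp_all

text \<open>The target \<open>c \<otimes>\<^sub>o y\<close> is not given as a product for
  \<open>\<bullet>\<close>, so there is no evaluation to test with. Instead, composing with
  \<open>runit\<close> turns the unitors themselves into evaluations at \<open>u\<close>.\<close>

lemma distL_brunit:
  assumes [simp]: "c \<in> Ob C" "y \<in> Ob C"
  shows "brunit C (c \<otimes>\<^sub>o y) \<cdot> distL C c y K = I c \<otimes>\<^sub>a brunit C y"
proof (rule iso_cancel_right)
  let ?i = "tunit C" and ?b = "y \<bullet>\<^sub>o K" and ?d = "distL C c y K"
  obtain u where u [simp]: "arr u" "src u = ?i" "trg u = P K"
    and br: "\<And>x. x \<in> Ob C \<Longrightarrow> brunit C x \<cdot> runit C (x \<bullet>\<^sub>o K) = evr x K \<cdot> (I (x \<bullet>\<^sub>o K) \<otimes>\<^sub>a u)"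
    by (rule brunit_evr) blast
  have "(brunit C (c \<otimes>\<^sub>o y) \<cdot> ?d) \<cdot> runit C (c \<otimes>\<^sub>o ?b)
    = (brunit C (c \<otimes>\<^sub>o y) \<cdot> runit C ((c \<otimes>\<^sub>o y) \<bullet>\<^sub>o K)) \<cdot> (?d \<otimes>\<^sub>a I ?i)"
    by (simp add: runit_nat)
  also have "\<dots> = (evr (c \<otimes>\<^sub>o y) K \<cdot> (?d \<otimes>\<^sub>a I (P K))) \<cdot> (I (c \<otimes>\<^sub>o ?b) \<otimes>\<^sub>a u)"
    by (subst br) simp_all
  also have "\<dots> = (I c \<otimes>\<^sub>a (evr y K \<cdot> (I ?b \<otimes>\<^sub>a u))) \<cdot> \<alpha> c ?b ?i"
    by (simp add: evr_distL assoc_slide)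
  also have "\<dots> = (I c \<otimes>\<^sub>a brunit C y) \<cdot> ((I c \<otimes>\<^sub>a runit C ?b) \<cdot> \<alpha> c ?b ?i)"
    by (subst br[symmetric]) simp_all
  also have "\<dots> = (I c \<otimes>\<^sub>a brunit C y) \<cdot> runit C (c \<otimes>\<^sub>o ?b)"
    by (subst runit_tensor) simp_all
  finally show "(brunit C (c \<otimes>\<^sub>o y) \<cdot> ?d) \<cdot> runit C (c \<otimes>\<^sub>o ?b) = (I c \<otimes>\<^sub>a brunit C y) \<cdot> runit C (c \<otimes>\<^sub>o ?b)" .
qed simp_all

lemma distR_runit:
  assumes [simp]: "w \<in> Ob C" "y \<in> Ob C"
  shows "(I w \<bullet>\<^sub>a runit C y) \<cdot> distR C w y (tunit C) = runit C (w \<bullet>\<^sub>o y)"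
proof (rule evl_cancel)
  let ?i = "tunit C" and ?b = "w \<bullet>\<^sub>o y" and ?d = "distR C w y (tunit C)"
  have "evl w y \<cdot> (I (G w) \<otimes>\<^sub>a ((I w \<bullet>\<^sub>a runit C y) \<cdot> ?d))
    = (evl w y \<cdot> (I (G w) \<otimes>\<^sub>a (I w \<bullet>\<^sub>a runit C y))) \<cdot> (I (G w) \<otimes>\<^sub>a ?d)" by simp
  also have "\<dots> = runit C y \<cdot> (evl w (y \<otimes>\<^sub>o ?i) \<cdot> (I (G w) \<otimes>\<^sub>a ?d))"
    by (subst evl_barr_id) simp_all
  also have "\<dots> = (runit C y \<cdot> (evl w y \<otimes>\<^sub>a I ?i)) \<cdot> \<alpha>' (G w) ?b ?i"
    by (simp add: evl_distR)
  also have "\<dots> = evl w y \<cdot> runit C (G w \<otimes>\<^sub>o ?b) \<cdot> \<alpha>' (G w) ?b ?i"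
    by (simp add: runit_nat)
  also have "\<dots> = evl w y \<cdot> ((I (G w) \<otimes>\<^sub>a runit C ?b) \<cdot> \<alpha> (G w) ?b ?i) \<cdot> \<alpha>' (G w) ?b ?i"
    by (subst runit_tensor) simp_all
  also have "\<dots> = evl w y \<cdot> (I (G w) \<otimes>\<^sub>a runit C ?b)" by simp
  finally show "evl w y \<cdot> (I (G w) \<otimes>\<^sub>a ((I w \<bullet>\<^sub>a runit C y) \<cdot> ?d)) = evl w y \<cdot> (I (G w) \<otimes>\<^sub>a runit C ?b)" .
qed simp_all

text \<open>As for \<open>distL_brunit\<close>, but here composing with \<open>lunit\<close> turns
  the left unitors into \<open>evl\<close> at \<open>\<upsilon>\<close>, and
  \<open>evl_distR\<close> applies.\<close>

lemma distR_blunit: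
  assumes [simp]: "y \<in> Ob C" "c \<in> Ob C"
  shows "blunit C (y \<otimes>\<^sub>o c) \<cdot> distR C K y c = blunit C y \<otimes>\<^sub>a I c"
proof (rule iso_cancel_right)
  let ?i = "tunit C" and ?b = "K \<bullet>\<^sub>o y" and ?d = "distR C K y c"
  have "(blunit C (y \<otimes>\<^sub>o c) \<cdot> ?d) \<cdot> lunit C (?b \<otimes>\<^sub>o c)
    = (blunit C (y \<otimes>\<^sub>o c) \<cdot> lunit C (K \<bullet>\<^sub>o (y \<otimes>\<^sub>o c))) \<cdot> (I ?i \<otimes>\<^sub>a ?d)"
    by (simp add: lunit_nat)
  also have "\<dots> = (evl K (y \<otimes>\<^sub>o c) \<cdot> (I (G K) \<otimes>\<^sub>a ?d)) \<cdot> (\<upsilon> \<otimes>\<^sub>a I (?b \<otimes>\<^sub>o c))"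
    by (subst blunit_evl) simp_all
  also have "\<dots> = ((evl K y \<cdot> (\<upsilon> \<otimes>\<^sub>a I ?b)) \<otimes>\<^sub>a I c) \<cdot> \<alpha>' ?i ?b c"
    by (simp add: evl_distR assoc_slide)
  also have "\<dots> = (blunit C y \<otimes>\<^sub>a I c) \<cdot> (lunit C ?b \<otimes>\<^sub>a I c) \<cdot> \<alpha>' ?i ?b c"
    by (subst blunit_evl[symmetric]) simp_all
  also have "\<dots> = (blunit C y \<otimes>\<^sub>a I c) \<cdot> (lunit C (?b \<otimes>\<^sub>o c) \<cdot> \<alpha> ?i ?b c) \<cdot> \<alpha>' ?i ?b c"
    by (subst lunit_tensor) simp_all
  also have "\<dots> = (blunit C y \<otimes>\<^sub>a I c) \<cdot> lunit C (?b \<otimes>\<^sub>o c)" by simp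
  finally show "(blunit C (y \<otimes>\<^sub>o c) \<cdot> ?d) \<cdot> lunit C (?b \<otimes>\<^sub>o c) = (blunit C y \<otimes>\<^sub>a I c) \<cdot> lunit C (?b \<otimes>\<^sub>o c)" .
qed simp_all

section \<open>The mixed pentagon identities\<close>

lemma distL_assoc:
  assumes [simp]: "c \<in> Ob C" "d \<in> Ob C" "y \<in> Ob C" "z \<in> Ob C"
  shows "(\<alpha> c d y \<bullet>\<^sub>a I z) \<cdot> distL C (c \<otimes>\<^sub>o d) y z
    = distL C c (d \<otimes>\<^sub>o y) z \<cdot> (I c \<otimes>\<^sub>a distL C d y z) \<cdot> \<alpha> c d (y \<bullet>\<^sub>o z)"
proof (rule evr_cancel)
  let ?b = "y \<bullet>\<^sub>o z" and ?e = "evr (c \<otimes>\<^sub>o (d \<otimes>\<^sub>o y)) z"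
  let ?r = "distL C c (d \<otimes>\<^sub>o y) z \<cdot> (I c \<otimes>\<^sub>a distL C d y z) \<cdot> \<alpha> c d ?b"
  have "?e \<cdot> (((\<alpha> c d y \<bullet>\<^sub>a I z) \<cdot> distL C (c \<otimes>\<^sub>o d) y z) \<otimes>\<^sub>a I (P z))
    = (?e \<cdot> ((\<alpha> c d y \<bullet>\<^sub>a I z) \<otimes>\<^sub>a I (P z))) \<cdot> (distL C (c \<otimes>\<^sub>o d) y z \<otimes>\<^sub>a I (P z))" by simp
  also have "\<dots> = \<alpha> c d y \<cdot> (evr ((c \<otimes>\<^sub>o d) \<otimes>\<^sub>o y) z \<cdot> (distL C (c \<otimes>\<^sub>o d) y z \<otimes>\<^sub>a I (P z)))"
    by (subst evr_barr_id) simp_all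
  also have "\<dots> = \<alpha> c d y \<cdot> (I (c \<otimes>\<^sub>o d) \<otimes>\<^sub>a evr y z) \<cdot> \<alpha> (c \<otimes>\<^sub>o d) ?b (P z)"
    by (simp add: evr_distL)
  also have "\<dots> = (I c \<otimes>\<^sub>a (I d \<otimes>\<^sub>a evr y z)) \<cdot> (\<alpha> c d (?b \<otimes>\<^sub>o P z) \<cdot> \<alpha> (c \<otimes>\<^sub>o d) ?b (P z))"
    by (simp add: assoc_slide)
  also have "\<dots> = (I c \<otimes>\<^sub>a (I d \<otimes>\<^sub>a evr y z)) \<cdot>
      ((I c \<otimes>\<^sub>a \<alpha> d ?b (P z)) \<cdot> \<alpha> c (d \<otimes>\<^sub>o ?b) (P z) \<cdot> (\<alpha> c d ?b \<otimes>\<^sub>a I (P z)))"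
    by (simp only: pentagon dual_objects bobj_Ob assms)
  also have "\<dots> = (I c \<otimes>\<^sub>a ((I d \<otimes>\<^sub>a evr y z) \<cdot> \<alpha> d ?b (P z))) \<cdot> \<alpha> c (d \<otimes>\<^sub>o ?b) (P z) \<cdot> (\<alpha> c d ?b \<otimes>\<^sub>a I (P z))"
    by simp
  also have "\<dots> = (I c \<otimes>\<^sub>a (evr (d \<otimes>\<^sub>o y) z \<cdot> (distL C d y z \<otimes>\<^sub>a I (P z)))) \<cdot> \<alpha> c (d \<otimes>\<^sub>o ?b) (P z) \<cdot> (\<alpha> c d ?b \<otimes>\<^sub>a I (P z))"
    by (simp only: evr_distL assms)
  also have "\<dots> = ((I c \<otimes>\<^sub>a evr (d \<otimes>\<^sub>o y) z) \<cdot> \<alpha> c ((d \<otimes>\<^sub>o y) \<bullet>\<^sub>o z) (P z)) \<cdot>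
      (((I c \<otimes>\<^sub>a distL C d y z) \<cdot> \<alpha> c d ?b) \<otimes>\<^sub>a I (P z))"
  proof -
    \<comment> \<open>The composite inside the tensor factor hides the shape
      \<open>(f \<otimes> g) \<otimes> h\<close> that naturality of the associator needs, so it is
      split by hand.\<close>
    have "((I c \<otimes>\<^sub>a evr (d \<otimes>\<^sub>o y) z) \<cdot> \<alpha> c ((d \<otimes>\<^sub>o y) \<bullet>\<^sub>o z) (P z)) \<cdot>
      (((I c \<otimes>\<^sub>a distL C d y z) \<cdot> \<alpha> c d ?b) \<otimes>\<^sub>a I (P z))
      = (I c \<otimes>\<^sub>a evr (d \<otimes>\<^sub>o y) z) \<cdot> (\<alpha> c ((d \<otimes>\<^sub>o y) \<bullet>\<^sub>o z) (P z) \<cdot>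
      ((I c \<otimes>\<^sub>a distL C d y z) \<otimes>\<^sub>a I (P z))) \<cdot> (\<alpha> c d ?b \<otimes>\<^sub>a I (P z))" by simp
    then show ?thesis by (simp add: assoc_slide)
  qed
  also have "\<dots> = (evr (c \<otimes>\<^sub>o (d \<otimes>\<^sub>o y)) z \<cdot> (distL C c (d \<otimes>\<^sub>o y) z \<otimes>\<^sub>a I (P z))) \<cdot>
      (((I c \<otimes>\<^sub>a distL C d y z) \<cdot> \<alpha> c d ?b) \<otimes>\<^sub>a I (P z))"
    by (simp only: evr_distL objects assms)
  also have "\<dots> = ?e \<cdot> (?r \<otimes>\<^sub>a I (P z))" by simp
  finally show "?e \<cdot> (((\<alpha> c d y \<bullet>\<^sub>a I z) \<cdot> distL C (c \<otimes>\<^sub>o d) y z) \<otimes>\<^sub>a I (P z)) = ?e \<cdot> (?r \<otimes>\<^sub>a I (P z))" .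
qed simp_all

text \<open>The target is a nested product: \<open>evl\<close> tests its outer layer and
  \<open>evr\<close> the inner one, the order in which \<open>evr_evl_bassoc\<close> controls both
  occurrences of \<open>bassoc\<close>. The distributor that comes first on the left is then met by
  \<open>evr\<close>, the other two by \<open>evl\<close>, where each contributes the contraction
  \<open>?k\<close>.\<close>

lemma distL_bassoc:
  assumes [simp]: "c \<in> Ob C" "y \<in> Ob C" "z \<in> Ob C" "w \<in> Ob C"
  shows "bassoc C (c \<otimes>\<^sub>o y) z w \<cdot> (distL C c y z \<bullet>\<^sub>a I w) \<cdot> distL C c (y \<bullet>\<^sub>o z) w
    = distL C c y (z \<bullet>\<^sub>o w) \<cdot> (I c \<otimes>\<^sub>a bassoc C y z w)"
proof (rule evl_cancel)
  let ?cy = "c \<otimes>\<^sub>o y" and ?g = "G (c \<otimes>\<^sub>o y)" and ?b = "y \<bullet>\<^sub>o z" and ?k = "dual_tensor_eval c y"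
  let ?U = "?b \<bullet>\<^sub>o w"
  let ?Y = "(distL C c y z \<bullet>\<^sub>a I w) \<cdot> distL C c ?b w"
  let ?A = "bassoc C ?cy z w" and ?B = "bassoc C y z w"
  let ?L = "?A \<cdot> ?Y" and ?R = "distL C c y (z \<bullet>\<^sub>o w) \<cdot> (I c \<otimes>\<^sub>a ?B)"
  show "evl ?cy (z \<bullet>\<^sub>o w) \<cdot> (I ?g \<otimes>\<^sub>a ?L) = evl ?cy (z \<bullet>\<^sub>o w) \<cdot> (I ?g \<otimes>\<^sub>a ?R)"
  proof (rule evr_cancel)
    have "evr (?cy \<bullet>\<^sub>o z) w \<cdot> (?Y \<otimes>\<^sub>a I (P w))
      = (evr (?cy \<bullet>\<^sub>o z) w \<cdot> ((distL C c y z \<bullet>\<^sub>a I w) \<otimes>\<^sub>a I (P w))) \<cdot> (distL C c ?b w \<otimes>\<^sub>a I (P w))" by simp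
    also have "\<dots> = distL C c y z \<cdot> (evr (c \<otimes>\<^sub>o ?b) w \<cdot> (distL C c ?b w \<otimes>\<^sub>a I (P w)))"
      by (subst evr_barr_id) simp_all
    finally have Y: "evr (?cy \<bullet>\<^sub>o z) w \<cdot> (?Y \<otimes>\<^sub>a I (P w)) = distL C c y z \<cdot> (I c \<otimes>\<^sub>a evr ?b w) \<cdot> \<alpha> c ?U (P w)"
      by (simp add: evr_distL)
    have "evr z w \<cdot> ((evl ?cy (z \<bullet>\<^sub>o w) \<cdot> (I ?g \<otimes>\<^sub>a ?L)) \<otimes>\<^sub>a I (P w))
      = (evr z w \<cdot> ((evl ?cy (z \<bullet>\<^sub>o w) \<cdot> (I ?g \<otimes>\<^sub>a ?A)) \<otimes>\<^sub>a I (P w))) \<cdot> ((I ?g \<otimes>\<^sub>a ?Y) \<otimes>\<^sub>a I (P w))"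
      by simp
    also have "\<dots> = (evl ?cy z \<cdot> (I ?g \<otimes>\<^sub>a evr (?cy \<bullet>\<^sub>o z) w) \<cdot> \<alpha> ?g ((?cy \<bullet>\<^sub>o z) \<bullet>\<^sub>o w) (P w)) \<cdot>
        ((I ?g \<otimes>\<^sub>a ?Y) \<otimes>\<^sub>a I (P w))"
      by (subst evr_evl_bassoc) simp_all
    also have "\<dots> = evl ?cy z \<cdot> (I ?g \<otimes>\<^sub>a (evr (?cy \<bullet>\<^sub>o z) w \<cdot> (?Y \<otimes>\<^sub>a I (P w)))) \<cdot> \<alpha> ?g (c \<otimes>\<^sub>o ?U) (P w)"
      by (simp add: assoc_slide)
    also have "\<dots> = (evl ?cy z \<cdot> (I ?g \<otimes>\<^sub>a distL C c y z)) \<cdot> (I ?g \<otimes>\<^sub>a (I c \<otimes>\<^sub>a evr ?b w)) \<cdot>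
        (I ?g \<otimes>\<^sub>a \<alpha> c ?U (P w)) \<cdot> \<alpha> ?g (c \<otimes>\<^sub>o ?U) (P w)"
      unfolding Y by simp
    also have "\<dots> = (evl y z \<cdot> (?k \<otimes>\<^sub>a I ?b) \<cdot> \<alpha>' ?g c ?b) \<cdot> (I ?g \<otimes>\<^sub>a (I c \<otimes>\<^sub>a evr ?b w)) \<cdot>
        (I ?g \<otimes>\<^sub>a \<alpha> c ?U (P w)) \<cdot> \<alpha> ?g (c \<otimes>\<^sub>o ?U) (P w)"
      by (simp only: evl_distL assms)
    also have "\<dots> = evl y z \<cdot> (?k \<otimes>\<^sub>a I ?b) \<cdot> (\<alpha>' ?g c ?b \<cdot> (I ?g \<otimes>\<^sub>a (I c \<otimes>\<^sub>a evr ?b w))) \<cdot>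
        (I ?g \<otimes>\<^sub>a \<alpha> c ?U (P w)) \<cdot> \<alpha> ?g (c \<otimes>\<^sub>o ?U) (P w)"
      by simp
    also have "\<dots> = evl y z \<cdot> (?k \<otimes>\<^sub>a evr ?b w) \<cdot>
        (\<alpha>' ?g c (?U \<otimes>\<^sub>o P w) \<cdot> (I ?g \<otimes>\<^sub>a \<alpha> c ?U (P w)) \<cdot> \<alpha> ?g (c \<otimes>\<^sub>o ?U) (P w))"
      by (simp add: assoc_slide)
    also have "\<dots> = evl y z \<cdot> (?k \<otimes>\<^sub>a evr ?b w) \<cdot> (\<alpha> (?g \<otimes>\<^sub>o c) ?U (P w) \<cdot> (\<alpha>' ?g c ?U \<otimes>\<^sub>a I (P w)))"
      by (simp only: pentagon_inv3 dual_objects objects bobj_Ob assms)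
    finally have L: "evr z w \<cdot> ((evl ?cy (z \<bullet>\<^sub>o w) \<cdot> (I ?g \<otimes>\<^sub>a ?L)) \<otimes>\<^sub>a I (P w)) = \<dots>" .
    have "evl ?cy (z \<bullet>\<^sub>o w) \<cdot> (I ?g \<otimes>\<^sub>a ?R)
      = (evl ?cy (z \<bullet>\<^sub>o w) \<cdot> (I ?g \<otimes>\<^sub>a distL C c y (z \<bullet>\<^sub>o w))) \<cdot> (I ?g \<otimes>\<^sub>a (I c \<otimes>\<^sub>a ?B))" by simp
    also have "\<dots> = (evl y (z \<bullet>\<^sub>o w) \<cdot> (?k \<otimes>\<^sub>a I (y \<bullet>\<^sub>o (z \<bullet>\<^sub>o w))) \<cdot> \<alpha>' ?g c (y \<bullet>\<^sub>o (z \<bullet>\<^sub>o w))) \<cdot> (I ?g \<otimes>\<^sub>a (I c \<otimes>\<^sub>a ?B))"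
      by (simp only: evl_distL bobj_Ob assms)
    also have "\<dots> = (evl y (z \<bullet>\<^sub>o w) \<cdot> (I (G y) \<otimes>\<^sub>a ?B)) \<cdot> (?k \<otimes>\<^sub>a I ?U) \<cdot> \<alpha>' ?g c ?U"
      by (simp add: assoc_slide)
    finally have R: "evl ?cy (z \<bullet>\<^sub>o w) \<cdot> (I ?g \<otimes>\<^sub>a ?R) = \<dots>" .
    have "evr z w \<cdot> ((evl ?cy (z \<bullet>\<^sub>o w) \<cdot> (I ?g \<otimes>\<^sub>a ?R)) \<otimes>\<^sub>a I (P w))
      = (evr z w \<cdot> ((evl y (z \<bullet>\<^sub>o w) \<cdot> (I (G y) \<otimes>\<^sub>a ?B)) \<otimes>\<^sub>a I (P w))) \<cdot>
        (((?k \<otimes>\<^sub>a I ?U) \<cdot> \<alpha>' ?g c ?U) \<otimes>\<^sub>a I (P w))"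
      unfolding R by simp
    also have "\<dots> = (evl y z \<cdot> (I (G y) \<otimes>\<^sub>a evr ?b w) \<cdot> \<alpha> (G y) ?U (P w)) \<cdot>
        (((?k \<otimes>\<^sub>a I ?U) \<cdot> \<alpha>' ?g c ?U) \<otimes>\<^sub>a I (P w))"
      by (simp only: evr_evl_bassoc assms)
    also have "\<dots> = evl y z \<cdot> (I (G y) \<otimes>\<^sub>a evr ?b w) \<cdot> (\<alpha> (G y) ?U (P w) \<cdot> ((?k \<otimes>\<^sub>a I ?U) \<otimes>\<^sub>a I (P w))) \<cdot>
        (\<alpha>' ?g c ?U \<otimes>\<^sub>a I (P w))" by simp
    also have "\<dots> = evl y z \<cdot> (?k \<otimes>\<^sub>a evr ?b w) \<cdot> (\<alpha> (?g \<otimes>\<^sub>o c) ?U (P w) \<cdot> (\<alpha>' ?g c ?U \<otimes>\<^sub>a I (P w)))"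
      by (simp add: assoc_slide)
    finally show "evr z w \<cdot> ((evl ?cy (z \<bullet>\<^sub>o w) \<cdot> (I ?g \<otimes>\<^sub>a ?L)) \<otimes>\<^sub>a I (P w))
      = evr z w \<cdot> ((evl ?cy (z \<bullet>\<^sub>o w) \<cdot> (I ?g \<otimes>\<^sub>a ?R)) \<otimes>\<^sub>a I (P w))"
      unfolding L by (rule sym)
  qed simp_all
qed simp_all

lemma distR_assoc:
  assumes [simp]: "w \<in> Ob C" "y \<in> Ob C" "c \<in> Ob C" "d \<in> Ob C"
  shows "(I w \<bullet>\<^sub>a \<alpha> y c d) \<cdot> distR C w (y \<otimes>\<^sub>o c) d \<cdot> (distR C w y c \<otimes>\<^sub>a I d)
    = distR C w y (c \<otimes>\<^sub>o d) \<cdot> \<alpha> (w \<bullet>\<^sub>o y) c d"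
proof (rule evl_cancel)
  let ?b = "w \<bullet>\<^sub>o y" and ?g = "G w"
  let ?D = "distR C w y c" and ?E = "distR C w (y \<otimes>\<^sub>o c) d"
  have "evl w (y \<otimes>\<^sub>o (c \<otimes>\<^sub>o d)) \<cdot> (I ?g \<otimes>\<^sub>a ((I w \<bullet>\<^sub>a \<alpha> y c d) \<cdot> ?E \<cdot> (?D \<otimes>\<^sub>a I d)))
    = (evl w (y \<otimes>\<^sub>o (c \<otimes>\<^sub>o d)) \<cdot> (I ?g \<otimes>\<^sub>a (I w \<bullet>\<^sub>a \<alpha> y c d))) \<cdot> (I ?g \<otimes>\<^sub>a (?E \<cdot> (?D \<otimes>\<^sub>a I d)))" by simp
  also have "\<dots> = \<alpha> y c d \<cdot> (evl w ((y \<otimes>\<^sub>o c) \<otimes>\<^sub>o d) \<cdot> (I ?g \<otimes>\<^sub>a ?E)) \<cdot> (I ?g \<otimes>\<^sub>a (?D \<otimes>\<^sub>a I d))"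
    by (subst evl_barr_id) simp_all
  also have "\<dots> = \<alpha> y c d \<cdot> ((evl w (y \<otimes>\<^sub>o c) \<cdot> (I ?g \<otimes>\<^sub>a ?D)) \<otimes>\<^sub>a I d) \<cdot> \<alpha>' ?g (?b \<otimes>\<^sub>o c) d"
    by (simp add: evl_distR assoc_slide)
  also have "\<dots> = (\<alpha> y c d \<cdot> ((evl w y \<otimes>\<^sub>a I c) \<otimes>\<^sub>a I d)) \<cdot> (\<alpha>' ?g ?b c \<otimes>\<^sub>a I d) \<cdot> \<alpha>' ?g (?b \<otimes>\<^sub>o c) d"
    by (simp add: evl_distR)
  also have "\<dots> = (evl w y \<otimes>\<^sub>a I (c \<otimes>\<^sub>o d)) \<cdot>
      (\<alpha> (?g \<otimes>\<^sub>o ?b) c d \<cdot> (\<alpha>' ?g ?b c \<otimes>\<^sub>a I d) \<cdot> \<alpha>' ?g (?b \<otimes>\<^sub>o c) d)"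
    by (simp add: assoc_slide)
  also have "\<dots> = (evl w y \<otimes>\<^sub>a I (c \<otimes>\<^sub>o d)) \<cdot> (\<alpha>' ?g ?b (c \<otimes>\<^sub>o d) \<cdot> (I ?g \<otimes>\<^sub>a \<alpha> ?b c d))"
    by (simp only: pentagon_inv4 dual_objects bobj_Ob assms)
  also have "\<dots> = ((evl w y \<otimes>\<^sub>a I (c \<otimes>\<^sub>o d)) \<cdot> \<alpha>' ?g ?b (c \<otimes>\<^sub>o d)) \<cdot> (I ?g \<otimes>\<^sub>a \<alpha> ?b c d)"
    by simp
  also have "\<dots> = (evl w (y \<otimes>\<^sub>o (c \<otimes>\<^sub>o d)) \<cdot> (I ?g \<otimes>\<^sub>a distR C w y (c \<otimes>\<^sub>o d))) \<cdot> (I ?g \<otimes>\<^sub>a \<alpha> ?b c d)"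
    by (simp only: evl_distR objects assms)
  also have "\<dots> = evl w (y \<otimes>\<^sub>o (c \<otimes>\<^sub>o d)) \<cdot> (I ?g \<otimes>\<^sub>a (distR C w y (c \<otimes>\<^sub>o d) \<cdot> \<alpha> ?b c d))" by simp
  finally show "evl w (y \<otimes>\<^sub>o (c \<otimes>\<^sub>o d)) \<cdot> (I ?g \<otimes>\<^sub>a ((I w \<bullet>\<^sub>a \<alpha> y c d) \<cdot> ?E \<cdot> (?D \<otimes>\<^sub>a I d))) = \<dots>" .
qed simp_all

text \<open>Both layers of the nested target are tested by \<open>evl\<close>, under which right
  distributors are known. On each side \<open>evl_bassoc\<close> merges the evaluations against
  \<open>G v\<close> and \<open>G w\<close> into one against
  \<open>G (v \<bullet>\<^sub>o w)\<close>, and \<open>evl_distR\<close> for \<open>?F\<close>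
  connects the two results.\<close>

lemma distR_bassoc:
  assumes [simp]: "v \<in> Ob C" "w \<in> Ob C" "y \<in> Ob C" "c \<in> Ob C"
  shows "(I v \<bullet>\<^sub>a distR C w y c) \<cdot> distR C v (w \<bullet>\<^sub>o y) c \<cdot> (bassoc C v w y \<otimes>\<^sub>a I c)
    = bassoc C v w (y \<otimes>\<^sub>o c) \<cdot> distR C (v \<bullet>\<^sub>o w) y c"
proof (rule evl_cancel)
  let ?wy = "w \<bullet>\<^sub>o y" and ?Z = "w \<bullet>\<^sub>o (y \<otimes>\<^sub>o c)" and ?V = "G w \<otimes>\<^sub>o G v" and ?T = "(v \<bullet>\<^sub>o w) \<bullet>\<^sub>o y"
  let ?A = "bassoc C v w y" and ?B = "bassoc C v w (y \<otimes>\<^sub>o c)"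
  let ?D = "distR C w y c" and ?E = "distR C v ?wy c" and ?F = "distR C (v \<bullet>\<^sub>o w) y c"
  let ?L = "(I v \<bullet>\<^sub>a ?D) \<cdot> ?E \<cdot> (?A \<otimes>\<^sub>a I c)" and ?R = "?B \<cdot> ?F"
  show "evl v ?Z \<cdot> (I (G v) \<otimes>\<^sub>a ?L) = evl v ?Z \<cdot> (I (G v) \<otimes>\<^sub>a ?R)"
  proof (rule evl_cancel)
    have "evl v ?Z \<cdot> (I (G v) \<otimes>\<^sub>a ?L)
      = (evl v ?Z \<cdot> (I (G v) \<otimes>\<^sub>a (I v \<bullet>\<^sub>a ?D))) \<cdot> (I (G v) \<otimes>\<^sub>a (?E \<cdot> (?A \<otimes>\<^sub>a I c)))" by simp
    also have "\<dots> = ?D \<cdot> (evl v (?wy \<otimes>\<^sub>o c) \<cdot> (I (G v) \<otimes>\<^sub>a ?E)) \<cdot> (I (G v) \<otimes>\<^sub>a (?A \<otimes>\<^sub>a I c))"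
      by (subst evl_barr_id) simp_all
    also have "\<dots> = ?D \<cdot> ((evl v ?wy \<cdot> (I (G v) \<otimes>\<^sub>a ?A)) \<otimes>\<^sub>a I c) \<cdot> \<alpha>' (G v) ?T c"
      by (simp add: evl_distR assoc_slide)
    finally have 1: "evl v ?Z \<cdot> (I (G v) \<otimes>\<^sub>a ?L) = \<dots>" .
    let ?X = "evl v ?wy \<cdot> (I (G v) \<otimes>\<^sub>a ?A)"
    let ?m = "dp C ?V \<otimes>\<^sub>a I ?T"
    have "evl w (y \<otimes>\<^sub>o c) \<cdot> (I (G w) \<otimes>\<^sub>a (evl v ?Z \<cdot> (I (G v) \<otimes>\<^sub>a ?L)))
      = (evl w (y \<otimes>\<^sub>o c) \<cdot> (I (G w) \<otimes>\<^sub>a ?D)) \<cdot> (I (G w) \<otimes>\<^sub>a (?X \<otimes>\<^sub>a I c)) \<cdot> (I (G w) \<otimes>\<^sub>a \<alpha>' (G v) ?T c)"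
      unfolding 1 by simp
    also have "\<dots> = (evl w y \<otimes>\<^sub>a I c) \<cdot> (\<alpha>' (G w) ?wy c \<cdot> (I (G w) \<otimes>\<^sub>a (?X \<otimes>\<^sub>a I c))) \<cdot> (I (G w) \<otimes>\<^sub>a \<alpha>' (G v) ?T c)"
      by (simp add: evl_distR)
    also have "\<dots> = ((evl w y \<cdot> (I (G w) \<otimes>\<^sub>a ?X)) \<otimes>\<^sub>a I c) \<cdot> \<alpha>' (G w) (G v \<otimes>\<^sub>o ?T) c \<cdot> (I (G w) \<otimes>\<^sub>a \<alpha>' (G v) ?T c)"
      by (simp add: assoc_slide)
    also have "\<dots> = ((evl (v \<bullet>\<^sub>o w) y \<cdot> ?m \<cdot> \<alpha>' (G w) (G v) ?T) \<otimes>\<^sub>a I c) \<cdot>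
        (\<alpha>' (G w) (G v \<otimes>\<^sub>o ?T) c \<cdot> (I (G w) \<otimes>\<^sub>a \<alpha>' (G v) ?T c))"
      by (simp only: evl_bassoc assms)
    also have "\<dots> = ((evl (v \<bullet>\<^sub>o w) y \<cdot> ?m \<cdot> \<alpha>' (G w) (G v) ?T) \<otimes>\<^sub>a I c) \<cdot>
        ((\<alpha> (G w) (G v) ?T \<otimes>\<^sub>a I c) \<cdot> \<alpha>' ?V ?T c \<cdot> \<alpha>' (G w) (G v) (?T \<otimes>\<^sub>o c))"
      by (simp only: pentagon_inv2 dual_objects bobj_Ob assms)
    also have "\<dots> = ((evl (v \<bullet>\<^sub>o w) y \<cdot> ?m) \<otimes>\<^sub>a I c) \<cdot> \<alpha>' ?V ?T c \<cdot> \<alpha>' (G w) (G v) (?T \<otimes>\<^sub>o c)"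
      by simp
    also have "\<dots> = ((evl (v \<bullet>\<^sub>o w) y \<otimes>\<^sub>a I c) \<cdot> \<alpha>' (G (v \<bullet>\<^sub>o w)) ?T c) \<cdot>
        (dp C ?V \<otimes>\<^sub>a I (?T \<otimes>\<^sub>o c)) \<cdot> \<alpha>' (G w) (G v) (?T \<otimes>\<^sub>o c)"
      by (simp add: assoc_slide)
    also have "\<dots> = (evl (v \<bullet>\<^sub>o w) (y \<otimes>\<^sub>o c) \<cdot> (I (G (v \<bullet>\<^sub>o w)) \<otimes>\<^sub>a ?F)) \<cdot>
        (dp C ?V \<otimes>\<^sub>a I (?T \<otimes>\<^sub>o c)) \<cdot> \<alpha>' (G w) (G v) (?T \<otimes>\<^sub>o c)"
      by (simp only: evl_distR bobj_Ob assms)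
    also have "\<dots> = (evl (v \<bullet>\<^sub>o w) (y \<otimes>\<^sub>o c) \<cdot> (dp C ?V \<otimes>\<^sub>a I ((v \<bullet>\<^sub>o w) \<bullet>\<^sub>o (y \<otimes>\<^sub>o c))) \<cdot>
        \<alpha>' (G w) (G v) ((v \<bullet>\<^sub>o w) \<bullet>\<^sub>o (y \<otimes>\<^sub>o c))) \<cdot> (I (G w) \<otimes>\<^sub>a (I (G v) \<otimes>\<^sub>a ?F))"
      by (simp add: assoc_slide)
    also have "\<dots> = (evl w (y \<otimes>\<^sub>o c) \<cdot> (I (G w) \<otimes>\<^sub>a (evl v ?Z \<cdot> (I (G v) \<otimes>\<^sub>a ?B)))) \<cdot>
        (I (G w) \<otimes>\<^sub>a (I (G v) \<otimes>\<^sub>a ?F))"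
      by (simp only: evl_bassoc objects assms)
    also have "\<dots> = evl w (y \<otimes>\<^sub>o c) \<cdot> (I (G w) \<otimes>\<^sub>a (evl v ?Z \<cdot> (I (G v) \<otimes>\<^sub>a ?R)))" by simp
    finally show "evl w (y \<otimes>\<^sub>o c) \<cdot> (I (G w) \<otimes>\<^sub>a (evl v ?Z \<cdot> (I (G v) \<otimes>\<^sub>a ?L))) = \<dots>" .
  qed simp_all
qed simp_all

end

theorem proposition4p11:
  fixes k :: "('k, 'r) ring_scheme"
    and C :: "('o, 'm, 'c) gvcat_scheme" (structure)
    and V :: "'o \<Rightarrow> 'o \<Rightarrow> ('k, 'm) module"
    and c d v w y z :: 'o
  assumes "algebraically_closed k"
    and "linear_gv_category k C V"
    and "c \<in> Ob C" "d \<in> Ob C" "v \<in> Ob C" "w \<in> Ob C" "y \<in> Ob C" "z \<in> Ob C"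
  shows
    "(lunit C y \<bullet>\<^sub>a iden C z) \<cdot> distL C (tunit C) y z = lunit C (y \<bullet>\<^sub>o z) \<and>
     brunit C (c \<otimes>\<^sub>o y) \<cdot> distL C c y (dualizing C) = iden C c \<otimes>\<^sub>a brunit C y \<and>
     (iden C w \<bullet>\<^sub>a runit C y) \<cdot> distR C w y (tunit C) = runit C (w \<bullet>\<^sub>o y) \<and>
     blunit C (y \<otimes>\<^sub>o c) \<cdot> distR C (dualizing C) y c = blunit C y \<otimes>\<^sub>a iden C c \<and>
     (assoc C c d y \<bullet>\<^sub>a iden C z) \<cdot> distL C (c \<otimes>\<^sub>o d) y z
       = distL C c (d \<otimes>\<^sub>o y) z \<cdot> (iden C c \<otimes>\<^sub>a distL C d y z) \<cdot> assoc C c d (y \<bullet>\<^sub>o z) \<and>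
     bassoc C (c \<otimes>\<^sub>o y) z w \<cdot> (distL C c y z \<bullet>\<^sub>a iden C w) \<cdot> distL C c (y \<bullet>\<^sub>o z) w
       = distL C c y (z \<bullet>\<^sub>o w) \<cdot> (iden C c \<otimes>\<^sub>a bassoc C y z w) \<and>
     (iden C w \<bullet>\<^sub>a assoc C y c d) \<cdot> distR C w (y \<otimes>\<^sub>o c) d \<cdot> (distR C w y c \<otimes>\<^sub>a iden C d)
       = distR C w y (c \<otimes>\<^sub>o d) \<cdot> assoc C (w \<bullet>\<^sub>o y) c d \<and>
     (iden C v \<bullet>\<^sub>a distR C w y c) \<cdot> distR C v (w \<bullet>\<^sub>o y) c \<cdot> (bassoc C v w y \<otimes>\<^sub>a iden C c)
       = bassoc C v w (y \<otimes>\<^sub>o c) \<cdot> distR C (v \<bullet>\<^sub>o w) y c"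
proof -
  interpret linear_gv_category k C V by fact
  show ?thesis
    by (intro conjI distL_lunit distL_brunit distR_runit distR_blunit
        distL_assoc distL_bassoc distR_assoc distR_bassoc assms(3-))
qed

end
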